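(* Let $K:[0,\infty)\to\mathbb{R}$ be Borel measurable, nonnegative with $K(0)=0$, bounded, having a right limit $K(0+)$ at zero and, if $K(0+)=0$, a finite right derivative at zero. Let $h:\mathbb{R}\to\mathbb{R}$ be convex with $h(0)=0$, continuously differentiable on $\mathbb{R}\setminus\{0\}$, with $h'(z)>0$ for $z>0$ and $h'(z)<0$ for $z<0$, and polynomially bounded, i.e. there exist a positive integer $a$ and $b_0,b_1>0$ with $h(z)\le b_0+b_1|z|^a$ for all $z\in\mathbb{R}$. Let $f:\mathbb{R}\to\mathbb{R}$ be continuously differentiable with $f'$ absolutely continuous on every compact interval. Assume that $$f(z_1)-f(z_2)\ge-K(z_1-z_2)-k(z_1-z_2)\quad\text{for }z_1>z_2,$$ that there exist a positive integer $d$ and positive numbers $a_0,a_1$ with $$|f'(z)|<a_0\ \text{ for }z<0,\qquad |f'(z)|<a_0+a_1z^d\ \text{ for }z\ge0,$$ and that there exists a positive number $\underline{\nu}$ such that $$\tfrac12\sigma^2f''(z)-\mu f'(z)+h(z)\ge\underline{\nu}\quad\text{for all }z\in\mathbb{R}\text{ at which }f''(z)\text{ exists}.$$ Then $\operatorname{AC}(x,Y)\ge\underline{\nu}$ for every $x\in\mathbb{R}$ and every $Y\in\mathcal{U}$.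
   Context: Model. Fix $\mu>0$, $\sigma>0$, $k\ge 0$. Let $B$ be a standard Brownian motion on a filtered probability space $(\Omega,\mathcal{F},\mathbb{F},\mathbb{P})$ with filtration $\mathbb{F}=\{\mathcal{F}(t):t\ge0\}$ (an $\mathbb{F}$-Brownian motion). For $x\in\mathbb{R}$ put $X(t)=x-\mu t+\sigma B(t)$. An admissible ordering policy is an $\mathbb{F}$-adapted process $Y=\{Y(t):t\ge0\}$ whose sample paths are all nondecreasing, nonnegative, right-continuous on $[0,\infty)$ with left limits on $(0,\infty)$; $\mathcal{U}$ is the set of admissible policies. Conventions: $Y(0-)=0$, $Z(0-)=x$, $\Delta Y(t)=Y(t)-Y(t-)$. The inventory process is $Z(t)=X(t)+Y(t)$, and $Y^c(t)=Y(t)-\sum_{0\le u\le t}\Delta Y(u)$ is the continuous part of $Y$. Put $\ell=\liminf_{\xi\downarrow0}K(\xi)/\xi\in[0,\infty]$ (so $\ell=\infty$ if $K(0+)>0$), with the convention $0\cdot\infty=0$. The long-run average cost (a value in $[0,\infty]$) is $$\operatorname{AC}(x,Y)=\limsup_{t\to\infty}\frac1t\,\mathbb{E}_x\Big[\int_0^t h(Z(u))\,du+\sum_{0\le u\le t}K(\Delta Y(u))+kY(t)+\ell Y^c(t)\Big],$$ where $\mathbb{E}_x$ denotes expectation given $Z(0-)=x$. *)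

theory Defs
  imports "HOL-Probability.Probability"
begin

text \<open>
  The library's locale \<open>filtration\<close> takes the whole index type as its time set. The time set
  here is \<open>[0, \<infinity>)\<close>, so the locale is applied to \<open>\<lambda>t. F (max 0 t)\<close>, which leaves the values of
  \<open>F\<close> at negative times unconstrained.
\<close>

definition filtered_prob_space :: "'a measure \<Rightarrow> (real \<Rightarrow> 'a measure) \<Rightarrow> bool" where
  "filtered_prob_space M F \<longleftrightarrow>
     prob_space M \<and> filtration (space M) (\<lambda>t. F (max 0 t)) \<and> (\<forall>t\<ge>0. subalgebra M (F t))"

definition adapted :: "(real \<Rightarrow> 'a measure) \<Rightarrow> (real \<Rightarrow> 'a \<Rightarrow> real) \<Rightarrow> bool" where
  "adapted F Y \<longleftrightarrow> (\<forall>t\<ge>0. Y t \<in> borel_measurable (F t))"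

text \<open>
  The initial value and the continuity of paths are only required almost surely, which includes
  the case where they hold for every path. The density form of the normal law is used for
  \<open>s < t\<close> only, since for \<open>s = t\<close> the increment is zero.
\<close>

definition brownian_motion ::
    "'a measure \<Rightarrow> (real \<Rightarrow> 'a measure) \<Rightarrow> (real \<Rightarrow> 'a \<Rightarrow> real) \<Rightarrow> bool" where
  "brownian_motion M F B \<longleftrightarrow>
     adapted F B \<and>
     (AE \<omega> in M. B 0 \<omega> = 0) \<and>
     (AE \<omega> in M. continuous_on {0..} (\<lambda>t. B t \<omega>)) \<and>
     (\<forall>s t. 0 \<le> s \<and> s < t \<longrightarrow>
        distributed M lborel (\<lambda>\<omega>. B t \<omega> - B s \<omega>) (normal_density 0 (sqrt (t - s))) \<and>
        prob_space.indep_set M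
          {(\<lambda>\<omega>. B t \<omega> - B s \<omega>) -` A \<inter> space M | A. A \<in> sets borel} (sets (F s)))"

definition admissible_policy ::
    "'a measure \<Rightarrow> (real \<Rightarrow> 'a measure) \<Rightarrow> (real \<Rightarrow> 'a \<Rightarrow> real) \<Rightarrow> bool" where
  "admissible_policy M F Y \<longleftrightarrow>
     adapted F Y \<and>
     (\<forall>\<omega>\<in>space M.
        mono_on {0..} (\<lambda>t. Y t \<omega>) \<and>
        (\<forall>t\<ge>0. 0 \<le> Y t \<omega>) \<and>
        (\<forall>t\<ge>0. continuous (at_right t) (\<lambda>s. Y s \<omega>)) \<and>
        (\<forall>t>0. \<exists>l. ((\<lambda>s. Y s \<omega>) \<longlongrightarrow> l) (at_left t)))"

definition left_value :: "(real \<Rightarrow> real) \<Rightarrow> real \<Rightarrow> real" where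
  "left_value y t = (if t \<le> 0 then 0 else Lim (at_left t) y)"

definition jump :: "(real \<Rightarrow> real) \<Rightarrow> real \<Rightarrow> real" where
  "jump y t = y t - left_value y t"

text \<open>
  The jumps of a nondecreasing nonnegative path are nonnegative and those in \<open>[0, t]\<close> add up to
  at most \<open>y t\<close>, so the unordered sum below is a convergent one.
\<close>

definition continuous_part :: "(real \<Rightarrow> real) \<Rightarrow> real \<Rightarrow> real" where
  "continuous_part y t = y t - (\<Sum>\<^sub>\<infinity>u\<in>{0..t}. jump y u)"

definition slope_at_zero :: "(real \<Rightarrow> real) \<Rightarrow> ennreal" where
  "slope_at_zero K = Liminf (at_right 0) (\<lambda>\<xi>. ennreal (K \<xi> / \<xi>))"

definition inventory ::
    "real \<Rightarrow> real \<Rightarrow> (real \<Rightarrow> 'a \<Rightarrow> real) \<Rightarrow> real \<Rightarrow> (real \<Rightarrow> 'a \<Rightarrow> real) \<Rightarrow> real \<Rightarrow> 'a \<Rightarrow> real" where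
  "inventory \<mu> \<sigma> B x Y t \<omega> = (x - \<mu> * t + \<sigma> * B t \<omega>) + Y t \<omega>"

text \<open>
  Cost of an inventory path \<open>z\<close> and a policy path \<open>y\<close> on \<open>[0, t]\<close>, a value in \<open>[0, \<infinity>]\<close>. All terms
  are nonnegative for nonnegative \<open>h\<close>, \<open>K\<close> and \<open>k\<close>. Multiplication on \<^typ>\<open>ennreal\<close> satisfies
  \<open>0 * \<infinity> = 0\<close>, and the unordered sum is infinite if it diverges.
\<close>

definition path_cost ::
    "(real \<Rightarrow> real) \<Rightarrow> (real \<Rightarrow> real) \<Rightarrow> real \<Rightarrow> (real \<Rightarrow> real) \<Rightarrow> (real \<Rightarrow> real) \<Rightarrow> real \<Rightarrow> ennreal" where
  "path_cost h K k z y t =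
     (\<integral>\<^sup>+u\<in>{0..t}. ennreal (h (z u)) \<partial>lborel)
     + (\<Sum>\<^sub>\<infinity>u\<in>{0..t}. ennreal (K (jump y u)))
     + ennreal (k * y t)
     + slope_at_zero K * ennreal (continuous_part y t)"

text \<open>
  The initial state \<open>x\<close> is a parameter of the inventory process, so the expectation given
  \<open>Z(0-) = x\<close> is the expectation under \<open>M\<close>.
\<close>

definition average_cost ::
    "'a measure \<Rightarrow> real \<Rightarrow> real \<Rightarrow> (real \<Rightarrow> 'a \<Rightarrow> real) \<Rightarrow> (real \<Rightarrow> real) \<Rightarrow> (real \<Rightarrow> real) \<Rightarrow> real \<Rightarrow>
     real \<Rightarrow> (real \<Rightarrow> 'a \<Rightarrow> real) \<Rightarrow> ennreal" where
  "average_cost M \<mu> \<sigma> B h K k x Y =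
     Limsup at_top (\<lambda>t.
       (\<integral>\<^sup>+\<omega>. path_cost h K k (\<lambda>u. inventory \<mu> \<sigma> B x Y u \<omega>) (\<lambda>u. Y u \<omega>) t \<partial>M) / ennreal t)"

definition absolutely_continuous_on_interval :: "real \<Rightarrow> real \<Rightarrow> (real \<Rightarrow> real) \<Rightarrow> bool" where
  "absolutely_continuous_on_interval a b g \<longleftrightarrow>
     (\<forall>\<epsilon>>0. \<exists>\<delta>>0. \<forall>(n::nat) u v.
        (\<forall>i<n. a \<le> u i \<and> u i \<le> v i \<and> v i \<le> b) \<longrightarrow>
        disjoint_family_on (\<lambda>i. {u i<..<v i}) {..<n} \<longrightarrow>
        (\<Sum>i<n. v i - u i) < \<delta> \<longrightarrow>
        (\<Sum>i<n. \<bar>g (v i) - g (u i)\<bar>) < \<epsilon>)"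

end

theory Submission
  imports Defs "HOL-Real_Asymp.Real_Asymp"
begin

text \<open>
  The theorem is a verification argument without stochastic integration. Adding \<open>(k + \<epsilon>) z\<close> to \<open>f\<close>
  absorbs the proportional cost and makes \<open>f\<close> nondecreasing up to a bounded error and unbounded above.
  At a point \<open>m\<close> where \<open>f\<close> exceeds all its previous values and \<open>f'\<close> is small compared with \<open>h\<close>, the
  function is bent to a constant; such an \<open>m\<close> exists, for otherwise the generator inequality forces
  exponential growth. Averaging twice over short intervals gives a smooth potential with bounded
  derivatives that still satisfies the jump condition, because that condition is translation invariant.

  On a grid of \<open>[0, t]\<close> every step is split into a move of \<open>X\<close>, which is independent of the past and is
  handled by a Taylor expansion, and a move of \<open>Y\<close>. The latter contributes a nonnegative sum whose
  lower limit is controlled path by path by the jumps of \<open>Y\<close>; Fatou's lemma then yields the integrated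
  inequality for fixed \<open>t\<close>. Finally, if the average cost were below \<open>\<nu>\<close>, then by Tonelli the mean of
  \<open>\<bar>Z t\<bar>\<close> would be bounded along arbitrarily large times \<open>t\<close>, and the inequality at these times is
  contradictory.
\<close>

section \<open>Absolutely continuous functions\<close>

text \<open>Under an arbitrary policy finite cost gives only first moments of \<open>Z\<close>, at
  some times, whereas \<open>f\<close> may grow polynomially on the right. Hence the potential is
  replaced by one with bounded derivative and bounded above, whose mean at the final time is then
  bounded above whatever \<open>Z\<close> does. The linear term that absorbs \<open>k\<close> lowers
  the generator by \<open>\<mu> * (k + \<epsilon>)\<close>; the part \<open>\<mu> * k\<close> is
  regained from the cost \<open>k * Y t\<close>, because \<open>Y\<close> must offset the drift and
  its mean is at least \<open>\<mu> * t\<close> up to a constant at the times used. A loss of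
  \<open>\<epsilon> * (\<nu> + \<mu>)\<close> remains, the share of \<open>\<nu>\<close> coming from
  a scaling by \<open>1 - \<epsilon>\<close> that creates slack at the truncation point. As
  \<open>f''\<close> exists only almost everywhere, the generator inequality is carried in
  integrated form over intervals, which survives truncation and becomes pointwise under averaging.
  Fatou needs nonnegative summands: adding \<open>c * z\<close>, where \<open>-c\<close> bounds the
  derivative from below, provides them, and \<open>c\<close> is kept at most the slope of
  \<open>K\<close> at zero so that the cost of the continuous part of \<open>Y\<close> covers
  it.\<close>

definition variation_sums :: "(real \<Rightarrow> real) \<Rightarrow> real \<Rightarrow> real \<Rightarrow> real set" where
  "variation_sums g x y =
     {s. \<exists>n t. mono t \<and> (\<forall>i. x \<le> t i \<and> t i \<le> y) \<and> s = (\<Sum>i<n. \<bar>g (t (Suc i)) - g (t i)\<bar>)}"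

definition variation :: "(real \<Rightarrow> real) \<Rightarrow> real \<Rightarrow> real \<Rightarrow> real" where
  "variation g x y = Sup (variation_sums g x y)"

lemma zero_in_variation_sums: "x \<le> y \<Longrightarrow> 0 \<in> variation_sums g x y"
  unfolding variation_sums_def
  by (intro CollectI exI[of _ "0::nat"] exI[of _ "\<lambda>_. x"]) (auto simp: mono_def)

text \<open>Partitions are monotone sequences of which only the first \<open>n\<close> steps count,
  repeated points allowed. Clipping all points at \<open>y\<close> from above and from below
  therefore gives partitions of both halves; only a step across \<open>y\<close> changes, and there
  the triangle inequality applies.\<close>

lemma variation_sums_split:
  assumes "s \<in> variation_sums g x z" "x \<le> y" "y \<le> z"
  obtains p q where "p \<in> variation_sums g x y" "q \<in> variation_sums g y z" "s \<le> p + q"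
proof -
  obtain n t where t: "mono t" "\<And>i. x \<le> t i \<and> t i \<le> z"
    and s: "s = (\<Sum>i<n. \<bar>g (t (Suc i)) - g (t i)\<bar>)"
    using assms(1) unfolding variation_sums_def by blast
  let ?l = "\<lambda>i. min (t i) y" and ?r = "\<lambda>i. max (t i) y"
  let ?p = "\<Sum>i<n. \<bar>g (?l (Suc i)) - g (?l i)\<bar>" and ?q = "\<Sum>i<n. \<bar>g (?r (Suc i)) - g (?r i)\<bar>"
  have "?p \<in> variation_sums g x y"
    unfolding variation_sums_def using t assms(2,3)
    by (intro CollectI exI[of _ n] exI[of _ ?l] conjI allI) (auto simp: mono_def min.coboundedI1)
  moreover have "?q \<in> variation_sums g y z"
    unfolding variation_sums_def using t assms(2,3)
    by (intro CollectI exI[of _ n] exI[of _ ?r] conjI allI) (auto simp: mono_def max.coboundedI1)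
  moreover have "s \<le> ?p + ?q"
    unfolding s sum.distrib[symmetric]
  proof (rule sum_mono)
    fix i
    have "t i \<le> t (Suc i)" using t(1) by (simp add: monoD)
    then show "\<bar>g (t (Suc i)) - g (t i)\<bar> \<le> \<bar>g (?l (Suc i)) - g (?l i)\<bar> + \<bar>g (?r (Suc i)) - g (?r i)\<bar>"
      by (auto simp: min_def max_def)
  qed
  ultimately show thesis using that by blast
qed

lemma variation_sums_append:
  assumes "s \<in> variation_sums g x y" "x \<le> y" "y \<le> z"
  shows "\<exists>r\<in>variation_sums g x z. s + \<bar>g z - g y\<bar> \<le> r"
proof -
  obtain n t where t: "mono t" "\<And>i. x \<le> t i \<and> t i \<le> y"
    and s: "s = (\<Sum>i<n. \<bar>g (t (Suc i)) - g (t i)\<bar>)"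
    using assms(1) unfolding variation_sums_def by blast
  \<comment> \<open>After index \<open>n\<close> the sequence passes through \<open>y\<close> and
    then stays at \<open>z\<close>. The step into \<open>y\<close> only adds a nonnegative term; the
    step from \<open>y\<close> to \<open>z\<close> is the wanted one.\<close>
  let ?t = "\<lambda>i. if i \<le> n then t i else if i = Suc n then y else z"
  have tz: "t i \<le> z" "x \<le> z" for i using t(2)[of i] assms(2,3) by auto
  have "mono ?t"
    unfolding mono_def using t assms(2,3) tz by (auto dest: monoD)
  then have "(\<Sum>i<Suc (Suc n). \<bar>g (?t (Suc i)) - g (?t i)\<bar>) \<in> variation_sums g x z"
    unfolding variation_sums_def using t assms(2,3) tz
    by (intro CollectI exI[of _ "Suc (Suc n)"] exI[of _ ?t] conjI allI) auto
  moreover have "s + \<bar>g z - g y\<bar> \<le> (\<Sum>i<Suc (Suc n). \<bar>g (?t (Suc i)) - g (?t i)\<bar>)"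
    unfolding s by auto
  ultimately show ?thesis by blast
qed

lemma mono_intervals_disjoint:
  fixes t :: "nat \<Rightarrow> real"
  assumes "mono t"
  shows "disjoint_family_on (\<lambda>i. {t i<..<t (Suc i)}) A"
proof -
  have *: "{t i<..<t (Suc i)} \<inter> {t j<..<t (Suc j)} = {}" if "i < j" for i j
    using monoD[OF assms, of "Suc i" j] that by auto
  have "{t i<..<t (Suc i)} \<inter> {t j<..<t (Suc j)} = {}" if "i \<noteq> j" for i j
    using *[of i j] *[of j i] that by (cases "i < j") (simp_all add: Int_commute)
  then show ?thesis
    unfolding disjoint_family_on_def by blast
qed

text \<open>Free index types allow families indexed by an interval together with a position in its
  partition, without enumerating them again.\<close>

lemma absolutely_continuous_on_interval_finite_family:
  assumes ac: "absolutely_continuous_on_interval a b g" and "\<epsilon> > 0"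
  shows "\<exists>\<delta>>0. \<forall>(I :: 'i set) u v. finite I \<longrightarrow> (\<forall>i\<in>I. a \<le> u i \<and> u i \<le> v i \<and> v i \<le> b) \<longrightarrow>
       disjoint_family_on (\<lambda>i. {u i<..<v i}) I \<longrightarrow> (\<Sum>i\<in>I. v i - u i) < \<delta> \<longrightarrow>
       (\<Sum>i\<in>I. \<bar>g (v i) - g (u i)\<bar>) < \<epsilon>"
proof -
  obtain \<delta> where d: "\<delta> > 0" and *: "\<forall>(n::nat) u v.
        (\<forall>i<n. a \<le> u i \<and> u i \<le> v i \<and> v i \<le> b) \<longrightarrow>
        disjoint_family_on (\<lambda>i. {u i<..<v i}) {..<n} \<longrightarrow>
        (\<Sum>i<n. v i - u i) < \<delta> \<longrightarrow> (\<Sum>i<n. \<bar>g (v i) - g (u i)\<bar>) < \<epsilon>"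
    using mp[OF spec[OF ac[unfolded absolutely_continuous_on_interval_def]] \<open>\<epsilon> > 0\<close>]
    by (elim exE conjE)
  show ?thesis
  proof (intro exI[of _ \<delta>] conjI d allI impI)
    fix I :: "'i set" and u v
    assume I: "finite I" "\<forall>i\<in>I. a \<le> u i \<and> u i \<le> v i \<and> v i \<le> b"
       "disjoint_family_on (\<lambda>i. {u i<..<v i}) I" "(\<Sum>i\<in>I. v i - u i) < \<delta>"
    obtain e where e: "bij_betw e {..<card I} I"
      using ex_bij_betw_nat_finite[OF I(1)] by (auto simp: atLeast0LessThan)
    have "(\<Sum>i<card I. \<bar>g (v (e i)) - g (u (e i))\<bar>) < \<epsilon>"
    proof (rule *[rule_format])
      show "a \<le> u (e i) \<and> u (e i) \<le> v (e i) \<and> v (e i) \<le> b" if "i < card I" for i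
        using that I(2) bij_betwE[OF e] by auto
      show "disjoint_family_on (\<lambda>i. {u (e i)<..<v (e i)}) {..<card I}"
        unfolding disjoint_family_on_def
      proof (intro ballI impI)
        fix m n assume mn: "m \<in> {..<card I}" "n \<in> {..<card I}" "m \<noteq> n"
        then have "e m \<noteq> e n" "e m \<in> I" "e n \<in> I"
          using e bij_betwE[OF e] by (auto dest: inj_onD[OF bij_betw_imp_inj_on])
        then show "{u (e m)<..<v (e m)} \<inter> {u (e n)<..<v (e n)} = {}"
          using I(3) unfolding disjoint_family_on_def by blast
      qed
      show "(\<Sum>i<card I. v (e i) - u (e i)) < \<delta>"
        using I(4) sum.reindex_bij_betw[OF e, of "\<lambda>i. v i - u i"] by simp
    qed
    then show "(\<Sum>i\<in>I. \<bar>g (v i) - g (u i)\<bar>) < \<epsilon>"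
      using sum.reindex_bij_betw[OF e, of "\<lambda>i. \<bar>g (v i) - g (u i)\<bar>"] by simp
  qed
qed

text \<open>Absolute continuity with tolerance 1 bounds the sums over any interval shorter than
  \<open>\<delta>\<close> by 1. Cutting off pieces of length \<open>\<delta> / 2\<close> and
  splitting the sums at the cuts gives a bound by the number of pieces.\<close>

lemma variation_sums_bounded:
  assumes ac: "absolutely_continuous_on_interval a b g"
  shows "\<exists>C. \<forall>x y s. a \<le> x \<longrightarrow> x \<le> y \<longrightarrow> y \<le> b \<longrightarrow> s \<in> variation_sums g x y \<longrightarrow> s \<le> C"
proof -
  obtain \<delta> where d: "\<delta> > 0" and *: "\<forall>(I :: nat set) u v. finite I \<longrightarrow> (\<forall>i\<in>I. a \<le> u i \<and> u i \<le> v i \<and> v i \<le> b) \<longrightarrow>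
       disjoint_family_on (\<lambda>i. {u i<..<v i}) I \<longrightarrow> (\<Sum>i\<in>I. v i - u i) < \<delta> \<longrightarrow>
       (\<Sum>i\<in>I. \<bar>g (v i) - g (u i)\<bar>) < 1"
    using absolutely_continuous_on_interval_finite_family[OF ac zero_less_one, where ?'i = nat]
    by (elim exE conjE)
  have short: "s \<le> 1" if xy: "a \<le> x" "x \<le> y" "y \<le> b" "y - x < \<delta>" "s \<in> variation_sums g x y" for x y s
  proof -
    obtain n t where t: "mono t" "\<And>i. x \<le> t i \<and> t i \<le> y"
      and s: "s = (\<Sum>i<n. \<bar>g (t (Suc i)) - g (t i)\<bar>)"
      using xy(5) unfolding variation_sums_def by blast
    have "(\<Sum>i<n. t (Suc i) - t i) = t n - t 0" by (rule sum_lessThan_telescope)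
    also have "\<dots> < \<delta>" using t(2)[of n] t(2)[of 0] xy(4) by linarith
    finally have len: "(\<Sum>i<n. t (Suc i) - t i) < \<delta>" .
    have "a \<le> t i \<and> t i \<le> t (Suc i) \<and> t (Suc i) \<le> b" for i
      using t(2)[of i] t(2)[of "Suc i"] xy(1,3) monoD[OF t(1), of i "Suc i"] by auto
    then have "s < 1"
      unfolding s by (intro *[rule_format] mono_intervals_disjoint[OF t(1)] len) auto
    then show ?thesis by simp
  qed
  have long: "s \<le> real k + 1" if "a \<le> x" "x \<le> y" "y \<le> b" "y - x < (real k + 1) * (\<delta> / 2)" "s \<in> variation_sums g x y" for x y s k
    using that
  proof (induction k arbitrary: x s)
    case 0
    then show ?case using short[of x y s] d by auto
  next
    case (Suc k)
    let ?m = "min y (x + \<delta> / 2)"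
    have m: "x \<le> ?m" "?m \<le> y" using Suc.prems(2) d by auto
    obtain p q where pq: "p \<in> variation_sums g x ?m" "q \<in> variation_sums g ?m y" "s \<le> p + q"
      by (rule variation_sums_split[OF Suc.prems(5) m])
    have "p \<le> 1"
    proof (rule short[OF _ _ _ _ pq(1)])
      show "a \<le> x" "x \<le> ?m" "?m \<le> b" "?m - x < \<delta>" using Suc.prems(1,3) m d by auto
    qed
    moreover have "q \<le> real k + 1"
    proof (rule Suc.IH[OF _ _ _ _ pq(2)])
      show "a \<le> ?m" "?m \<le> y" "y \<le> b" using Suc.prems(1,3) m by auto
      have "0 < (real k + 1) * (\<delta> / 2)" using d by simp
      then show "y - ?m < (real k + 1) * (\<delta> / 2)"
        using Suc.prems(4) by (auto simp: min_def algebra_simps)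
    qed
    ultimately show ?case using pq(3) by auto
  qed
  obtain k :: nat where k: "(b - a) / (\<delta> / 2) < real k" using reals_Archimedean2 by blast
  have "s \<le> real k + 1" if "a \<le> x" "x \<le> y" "y \<le> b" "s \<in> variation_sums g x y" for x y s
  proof (rule long[OF that(1-3) _ that(4)])
    have "b - a < real k * (\<delta> / 2)" using k d by (simp add: field_simps)
    then show "y - x < (real k + 1) * (\<delta> / 2)" using that d by (simp add: algebra_simps)
  qed
  then show ?thesis by blast
qed

section \<open>Monotonicity and absolute continuity of the variation function\<close>

context
  fixes a b :: real and g :: "real \<Rightarrow> real"
  assumes ac: "absolutely_continuous_on_interval a b g"
begin

lemma bdd_above_variation_sums:
  assumes "a \<le> x" "x \<le> y" "y \<le> b"
  shows "bdd_above (variation_sums g x y)"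
proof -
  obtain C where "\<forall>x y s. a \<le> x \<longrightarrow> x \<le> y \<longrightarrow> y \<le> b \<longrightarrow> s \<in> variation_sums g x y \<longrightarrow> s \<le> C"
    using variation_sums_bounded[OF ac] by (elim exE)
  then show ?thesis using assms by (intro bdd_aboveI[of _ C]) simp
qed

lemma variation_sums_le:
  assumes "a \<le> x" "x \<le> y" "y \<le> b" "s \<in> variation_sums g x y"
  shows "s \<le> variation g x y"
  unfolding variation_def by (rule cSup_upper[OF assms(4) bdd_above_variation_sums[OF assms(1-3)]])

lemma variation_le_add:
  assumes "a \<le> x" "x \<le> y" "y \<le> z" "z \<le> b"
  shows "variation g x z \<le> variation g x y + variation g y z"
  unfolding variation_def[of g x z]
proof (rule cSup_least)
  show "variation_sums g x z \<noteq> {}" using zero_in_variation_sums[of x z g] assms by auto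
  fix s assume "s \<in> variation_sums g x z"
  then obtain p q where pq: "p \<in> variation_sums g x y" "q \<in> variation_sums g y z" "s \<le> p + q"
    by (rule variation_sums_split[OF _ assms(2,3)])
  have "p \<le> variation g x y" "q \<le> variation g y z"
    using assms by (auto intro!: variation_sums_le pq)
  then show "s \<le> variation g x y + variation g y z" using pq by simp
qed

text \<open>Appending one step to the partitions of the left part shows that the variation dominates
  the increments of \<open>g\<close>. Hence \<open>variation g a\<close> and its difference with
  \<open>g\<close> are both nondecreasing.\<close>

lemma variation_add_le:
  assumes "a \<le> x" "x \<le> y" "y \<le> z" "z \<le> b"
  shows "variation g x y + \<bar>g z - g y\<bar> \<le> variation g x z"
proof -
  have "s + \<bar>g z - g y\<bar> \<le> variation g x z" if s: "s \<in> variation_sums g x y" for s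
  proof -
    obtain r where "r \<in> variation_sums g x z" "s + \<bar>g z - g y\<bar> \<le> r"
      using variation_sums_append[OF s assms(2,3)] by (elim bexE)
    moreover have "r \<le> variation g x z" if "r \<in> variation_sums g x z" for r
      using that assms by (intro variation_sums_le) auto
    ultimately show ?thesis by (meson order_trans)
  qed
  then have "s \<le> variation g x z - \<bar>g z - g y\<bar>" if "s \<in> variation_sums g x y" for s
    using that by force
  then have "variation g x y \<le> variation g x z - \<bar>g z - g y\<bar>"
    unfolding variation_def[of g x y] using zero_in_variation_sums[OF assms(2)]
    by (intro cSup_least) auto
  then show ?thesis by simp
qed

text \<open>Each interval is replaced by a partition that nearly attains its variation. The pieces
  of all partitions together form one disjoint family of no larger total length, to which absolute
  continuity of \<open>g\<close> applies.\<close>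

lemma variation_absolutely_continuous:
  assumes "\<epsilon> > 0"
  shows "\<exists>\<delta>>0. \<forall>(I :: 'i set) u v. finite I \<longrightarrow> (\<forall>i\<in>I. a \<le> u i \<and> u i \<le> v i \<and> v i \<le> b) \<longrightarrow>
       disjoint_family_on (\<lambda>i. {u i<..<v i}) I \<longrightarrow> (\<Sum>i\<in>I. v i - u i) < \<delta> \<longrightarrow>
       (\<Sum>i\<in>I. variation g a (v i) - variation g a (u i)) < \<epsilon>"
proof -
  from assms have e2: "\<epsilon> / 2 > 0" by simp
  obtain \<delta> where d: "\<delta> > 0" and *: "\<forall>(I :: ('i \<times> nat) set) u v. finite I \<longrightarrow> (\<forall>i\<in>I. a \<le> u i \<and> u i \<le> v i \<and> v i \<le> b) \<longrightarrow>
       disjoint_family_on (\<lambda>i. {u i<..<v i}) I \<longrightarrow> (\<Sum>i\<in>I. v i - u i) < \<delta> \<longrightarrow>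
       (\<Sum>i\<in>I. \<bar>g (v i) - g (u i)\<bar>) < \<epsilon> / 2"
    using absolutely_continuous_on_interval_finite_family[OF ac e2, where ?'i = "'i \<times> nat"]
    by (elim exE conjE)
  show ?thesis
  proof (intro exI[of _ \<delta>] conjI d allI impI)
    fix I :: "'i set" and u v
    assume I: "finite I" "\<forall>i\<in>I. a \<le> u i \<and> u i \<le> v i \<and> v i \<le> b"
       "disjoint_family_on (\<lambda>i. {u i<..<v i}) I" "(\<Sum>i\<in>I. v i - u i) < \<delta>"
    \<comment> \<open>Half of \<open>\<epsilon>\<close> is shared among the intervals as
      approximation error; the summand 1 keeps the denominator nonzero for empty
      \<open>I\<close>.\<close>
    define e where "e = \<epsilon> / (2 * (real (card I) + 1))"
    have e: "e > 0" unfolding e_def using assms by simp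
    have ex: "\<exists>n t. mono t \<and> (\<forall>j. u i \<le> t j \<and> t j \<le> v i) \<and>
        variation g (u i) (v i) < (\<Sum>j<n. \<bar>g (t (Suc j)) - g (t j)\<bar>) + e" if "i \<in> I" for i
    proof -
      have "\<exists>s\<in>variation_sums g (u i) (v i). variation g (u i) (v i) - e < s"
        unfolding variation_def using e zero_in_variation_sums I(2)[rule_format, OF that]
        by (intro less_cSupD) auto
      then obtain s where "s\<in>variation_sums g (u i) (v i)" "variation g (u i) (v i) < s + e"
        by (auto simp: algebra_simps)
      then show ?thesis unfolding variation_sums_def by blast
    qed
    let ?P = "\<lambda>i n t. mono t \<and> (\<forall>j. u i \<le> t j \<and> t j \<le> v i) \<and>
        variation g (u i) (v i) < (\<Sum>j<n. \<bar>g (t (Suc j)) - g (t j)\<bar>) + e"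
    have "\<forall>i\<in>I. \<exists>n t. ?P i n t" using ex by simp
    from bchoice[OF this] obtain n where "\<forall>i\<in>I. \<exists>t. ?P i (n i) t" by (elim exE)
    from bchoice[OF this] obtain t where tt: "\<forall>i\<in>I. ?P i (n i) (t i)" by (elim exE)
    then have t: "\<And>i. i \<in> I \<Longrightarrow> mono (t i)" "\<And>i j. i \<in> I \<Longrightarrow> u i \<le> t i j \<and> t i j \<le> v i"
      and v: "\<And>i. i \<in> I \<Longrightarrow> variation g (u i) (v i) < (\<Sum>j<n i. \<bar>g (t i (Suc j)) - g (t i j)\<bar>) + e"
      by simp_all
    have tm: "t i j \<le> t i (Suc j)" if "i \<in> I" for i j using monoD[OF t(1)[OF that]] by simp
    let ?J = "Sigma I (\<lambda>i. {..<n i})"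
    have "(\<Sum>p\<in>?J. \<bar>g (t (fst p) (Suc (snd p))) - g (t (fst p) (snd p))\<bar>) < \<epsilon> / 2"
    proof (rule *[rule_format])
      show "finite ?J" using I(1) by auto
      show "a \<le> t (fst p) (snd p) \<and> t (fst p) (snd p) \<le> t (fst p) (Suc (snd p)) \<and> t (fst p) (Suc (snd p)) \<le> b"
        if pJ: "p \<in> ?J" for p
      proof -
        obtain i j where p: "p = (i, j)" "i \<in> I" using pJ by (cases p) auto
        then show ?thesis using t(2)[OF p(2), of j] t(2)[OF p(2), of "Suc j"] I(2) tm[OF p(2), of j] by auto
      qed
      have "{t i j<..<t i (Suc j)} \<inter> {t i' j'<..<t i' (Suc j')} = {}"
        if "i \<in> I" "i' \<in> I" "(i, j) \<noteq> (i', j')" for i j i' j'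
      proof (cases "i = i'")
        case True
        with that have "j \<noteq> j'" by auto
        with mono_intervals_disjoint[OF t(1)[OF that(1)], of UNIV] True show ?thesis
          unfolding disjoint_family_on_def by auto
      next
        case False
        have "{t i j<..<t i (Suc j)} \<subseteq> {u i<..<v i}" "{t i' j'<..<t i' (Suc j')} \<subseteq> {u i'<..<v i'}"
          using t(2)[OF that(1), of j] t(2)[OF that(1), of "Suc j"]
            t(2)[OF that(2), of j'] t(2)[OF that(2), of "Suc j'"] by auto
        moreover have "{u i<..<v i} \<inter> {u i'<..<v i'} = {}"
          using I(3) that False unfolding disjoint_family_on_def by blast
        ultimately show ?thesis by blast
      qed
      then show "disjoint_family_on (\<lambda>p. {t (fst p) (snd p)<..<t (fst p) (Suc (snd p))}) ?J"
        unfolding disjoint_family_on_def by (auto simp del: greaterThanLessThan_iff)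
      have "(\<Sum>p\<in>?J. t (fst p) (Suc (snd p)) - t (fst p) (snd p))
        = (\<Sum>i\<in>I. \<Sum>j<n i. t i (Suc j) - t i j)"
        using I(1) by (subst sum.Sigma) (auto simp: case_prod_beta)
      also have "\<dots> \<le> (\<Sum>i\<in>I. v i - u i)"
        unfolding sum_lessThan_telescope using t(2) by (intro sum_mono diff_mono) auto
      finally show "(\<Sum>p\<in>?J. t (fst p) (Suc (snd p)) - t (fst p) (snd p)) < \<delta>" using I(4) by simp
    qed
    then have small: "(\<Sum>i\<in>I. \<Sum>j<n i. \<bar>g (t i (Suc j)) - g (t i j)\<bar>) < \<epsilon> / 2"
      using I(1) by (subst sum.Sigma) (auto simp: case_prod_beta)
    have "(\<Sum>i\<in>I. variation g a (v i) - variation g a (u i)) \<le> (\<Sum>i\<in>I. variation g (u i) (v i))"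
    proof (rule sum_mono)
      fix i assume "i \<in> I"
      then show "variation g a (v i) - variation g a (u i) \<le> variation g (u i) (v i)"
        using variation_le_add[of a "u i" "v i"] I(2) by force
    qed
    also have "\<dots> \<le> (\<Sum>i\<in>I. (\<Sum>j<n i. \<bar>g (t i (Suc j)) - g (t i j)\<bar>) + e)"
      using v by (intro sum_mono) force
    also have "\<dots> = (\<Sum>i\<in>I. \<Sum>j<n i. \<bar>g (t i (Suc j)) - g (t i j)\<bar>) + real (card I) * e"
      by (simp add: sum.distrib)
    also have "real (card I) * e \<le> \<epsilon> / 2" unfolding e_def using assms by (simp add: field_simps)
    finally show "(\<Sum>i\<in>I. variation g a (v i) - variation g a (u i)) < \<epsilon>" using small by simp
  qed
qed

end


text \<open>The epsilon-delta condition makes the interval measure of \<open>U\<close> vanish on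
  Lebesgue null sets, so Radon-Nikodym supplies the density. The index type \<open>real set\<close>
  lets the intervals of a cover index themselves.\<close>

lemma monotone_absolutely_continuous_density:
  fixes U :: "real \<Rightarrow> real"
  assumes ab: "a < b"
    and mono: "\<And>x y. a \<le> x \<Longrightarrow> x \<le> y \<Longrightarrow> y \<le> b \<Longrightarrow> U x \<le> U y"
    and ac: "\<And>\<epsilon>. \<epsilon> > 0 \<Longrightarrow> \<exists>\<delta>>0. \<forall>(I :: real set set) u v. finite I \<longrightarrow>
       (\<forall>i\<in>I. a \<le> u i \<and> u i \<le> v i \<and> v i \<le> b) \<longrightarrow>
       disjoint_family_on (\<lambda>i. {u i<..<v i}) I \<longrightarrow> (\<Sum>i\<in>I. v i - u i) < \<delta> \<longrightarrow>
       (\<Sum>i\<in>I. U (v i) - U (u i)) < \<epsilon>"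
  shows "\<exists>p. integrable lborel p \<and>
     (\<forall>x y. a \<le> x \<longrightarrow> x \<le> y \<longrightarrow> y \<le> b \<longrightarrow> U y - U x = (LINT z:{x..y}|lborel. p z))"
proof -
  \<comment> \<open>Constant continuation outside \<open>{a..b}\<close> gives a monotone continuous
    function on the whole line, as the interval measure requires.\<close>
  define W where "W x = U (max a (min b x))" for x
  have W_eq: "W x = U x" if "a \<le> x" "x \<le> b" for x using that by (simp add: W_def max_def min_def)
  have W_mono: "W x \<le> W y" if "x \<le> y" for x y
    unfolding W_def using that ab by (intro mono) (auto simp: max_def min_def)
  have W_cont: "continuous_on UNIV W"
    unfolding continuous_on_iff
  proof (intro ballI allI impI)
    fix x e :: real assume "0 < e"
    obtain \<delta> where d: "\<delta> > 0" and *: "\<forall>(I :: real set set) u v. finite I \<longrightarrow>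
       (\<forall>i\<in>I. a \<le> u i \<and> u i \<le> v i \<and> v i \<le> b) \<longrightarrow>
       disjoint_family_on (\<lambda>i. {u i<..<v i}) I \<longrightarrow> (\<Sum>i\<in>I. v i - u i) < \<delta> \<longrightarrow>
       (\<Sum>i\<in>I. U (v i) - U (u i)) < e"
      using ac[OF \<open>0 < e\<close>] by (elim exE conjE)
    have near: "U v - U u < e" if "a \<le> u" "u \<le> v" "v \<le> b" "v - u < \<delta>" for u v
      using *[rule_format, of "{{}}" "\<lambda>_. u" "\<lambda>_. v"] that by (simp add: disjoint_family_on_def)
    have near': "\<bar>U v - U u\<bar> < e" if "a \<le> u" "u \<le> b" "a \<le> v" "v \<le> b" "\<bar>v - u\<bar> < \<delta>" for u v
      using near[of u v] near[of v u] mono[of u v] mono[of v u] that by (cases "u \<le> v") simp_all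
    have "dist (W y) (W x) < e" if "dist y x < \<delta>" for y
    proof -
      let ?x = "max a (min b x)" and ?y = "max a (min b y)"
      have "\<bar>?y - ?x\<bar> < \<delta>" using that d by (auto simp: dist_real_def max_def min_def)
      moreover have "a \<le> ?x" "?x \<le> b" "a \<le> ?y" "?y \<le> b" using ab by auto
      ultimately show ?thesis
        unfolding W_def dist_real_def by (intro near')
    qed
    then show "\<exists>d>0. \<forall>x'\<in>UNIV. dist x' x < d \<longrightarrow> dist (W x') (W x) < e"
      using d by blast
  qed
  define \<mu> where "\<mu> = interval_measure W"
  have sets_mu: "sets \<mu> = sets borel" by (simp add: \<mu>_def)
  have em: "emeasure \<mu> {c..d} = ennreal (U d - U c)" if "a \<le> c" "c \<le> d" "d \<le> b" for c d
    unfolding \<mu>_def using that W_mono W_cont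
    by (subst emeasure_interval_measure_Icc) (simp_all add: W_eq)
  define \<mu>' where "\<mu>' = density \<mu> (indicator {a..b})"
  have sets_mu': "sets \<mu>' = sets borel" by (simp add: \<mu>'_def sets_mu)
  have em': "emeasure \<mu>' A = emeasure \<mu> ({a..b} \<inter> A)" if "A \<in> sets borel" for A
    unfolding \<mu>'_def using that by (intro emeasure_restricted) (auto simp: sets_mu)
  have "emeasure \<mu>' N = 0" if N: "N \<in> null_sets lborel" for N
  proof -
    have Nb: "N \<in> sets borel" using N by (auto simp: null_sets_def)
    \<comment> \<open>The null set is covered by countably many closed intervals with disjoint
      interiors and union of measure at most \<open>\<delta> / 2\<close>, hence below
      \<open>\<delta>\<close>.\<close>
    have small: "emeasure \<mu> ({a..b} \<inter> N) \<le> 0 + ennreal e" if e: "e > 0" for e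
    proof -
      obtain \<delta> where d: "\<delta> > 0" and *: "\<forall>(I :: real set set) u v. finite I \<longrightarrow>
         (\<forall>i\<in>I. a \<le> u i \<and> u i \<le> v i \<and> v i \<le> b) \<longrightarrow>
         disjoint_family_on (\<lambda>i. {u i<..<v i}) I \<longrightarrow> (\<Sum>i\<in>I. v i - u i) < \<delta> \<longrightarrow>
         (\<Sum>i\<in>I. U (v i) - U (u i)) < e"
        using ac[OF e] by (elim exE conjE)
      have NL: "{a..b} \<inter> N \<in> null_sets lebesgue"
        using N by (intro null_set_Int1 null_sets_completionI) auto
      have lm: "{a..b} \<inter> N \<in> lmeasurable" and m0: "measure lebesgue ({a..b} \<inter> N) = 0"
        using NL by (auto simp: fmeasurable_def measure_def null_sets_def)
      have sub: "{a..b} \<inter> N \<subseteq> cbox a b" by auto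
      have d2: "\<delta> / 2 > 0" using d by simp
      obtain \<D> where cD: "countable \<D>"
        and D: "\<And>K. K \<in> \<D> \<Longrightarrow> K \<subseteq> cbox a b \<and> K \<noteq> {} \<and> (\<exists>c d. K = cbox c d)"
        and pw: "pairwise (\<lambda>A B. interior A \<inter> interior B = {}) \<D>"
        and cov: "{a..b} \<inter> N \<subseteq> \<Union>\<D>" and Dl: "\<Union>\<D> \<in> lmeasurable"
        and Dm: "measure lebesgue (\<Union>\<D>) \<le> measure lebesgue ({a..b} \<inter> N) + \<delta> / 2"
        by (rule measurable_outer_intervals_bounded[OF lm sub d2]) (rule that; assumption)
      have K: "K = {Inf K..Sup K} \<and> a \<le> Inf K \<and> Inf K \<le> Sup K \<and> Sup K \<le> b" if KD: "K \<in> \<D>" for K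
      proof -
        obtain c d where "K = {c..d}" using D[OF KD] by (auto simp: cbox_interval)
        with D[OF KD] show ?thesis by (auto simp: cbox_interval)
      qed
      have Kb: "K \<in> sets borel" if "K \<in> \<D>" for K
        using K[OF that] by (metis atLeastAtMost_borel)
      \<comment> \<open>Absolute continuity controls finite families only; the countable cover is
        reached afterwards by continuity from below along an enumeration. Lengths are compared
        through the open interiors, which are disjoint although the closed intervals may
        touch.\<close>
      have fin: "emeasure \<mu> (\<Union>I) \<le> ennreal e" if I: "finite I" "I \<subseteq> \<D>" for I
      proof -
        have int: "interior K = {Inf K<..<Sup K}" if "K \<in> I" for K
          using K[of K] that I(2) interior_atLeastAtMost_real[of "Inf K" "Sup K"] by (metis subsetD)
        have dis: "disjoint_family_on (\<lambda>K. {Inf K<..<Sup K}) I"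
          unfolding disjoint_family_on_def
        proof (intro ballI impI)
          fix A B assume AB: "A \<in> I" "B \<in> I" "A \<noteq> B"
          with I(2) have "A \<in> \<D>" "B \<in> \<D>" by auto
          with AB show "{Inf A<..<Sup A} \<inter> {Inf B<..<Sup B} = {}"
            using pairwiseD[OF pw, of A B] I(2) int[of A] int[of B] by (simp add: subset_iff)
        qed
        have ioo_fin: "emeasure lborel {x<..<y} \<noteq> \<top>" for x y :: real by (cases "x \<le> y") simp_all
        have "(\<Sum>K\<in>I. Sup K - Inf K) = (\<Sum>K\<in>I. measure lebesgue {Inf K<..<Sup K})"
          using K I(2) by (intro sum.cong) auto
        also have "\<dots> = measure lebesgue (\<Union>K\<in>I. {Inf K<..<Sup K})"
          using I dis by (intro measure_finite_Union[symmetric]) (auto simp: ioo_fin)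
        also have "\<dots> \<le> measure lebesgue (\<Union>\<D>)"
        proof (rule measure_mono_fmeasurable)
          show "(\<Union>K\<in>I. {Inf K<..<Sup K}) \<subseteq> \<Union>\<D>"
            using int interior_subset I(2) by blast
          show "(\<Union>K\<in>I. {Inf K<..<Sup K}) \<in> sets lebesgue" using I(1) by auto
        qed (rule Dl)
        also have "\<dots> < \<delta>" using Dm m0 d by simp
        finally have len: "(\<Sum>K\<in>I. Sup K - Inf K) < \<delta>" .
        have "emeasure \<mu> (\<Union>I) \<le> (\<Sum>K\<in>I. emeasure \<mu> K)"
          using emeasure_subadditive_finite[OF I(1), of "\<lambda>K. K" \<mu>] Kb I(2) sets_mu by auto
        also have "\<dots> = (\<Sum>K\<in>I. ennreal (U (Sup K) - U (Inf K)))"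
        proof (rule sum.cong[OF refl])
          fix K' assume "K' \<in> I"
          then have k: "K' = {Inf K'..Sup K'}" "a \<le> Inf K'" "Inf K' \<le> Sup K'" "Sup K' \<le> b"
            using K I(2) by blast+
          show "emeasure \<mu> K' = ennreal (U (Sup K') - U (Inf K'))"
            using em[OF k(2-4)] k(1) by simp
        qed
        also have "\<dots> = ennreal (\<Sum>K\<in>I. U (Sup K) - U (Inf K))"
          using K mono I(2) by (intro sum_ennreal) (simp add: subset_iff)
        also have "\<dots> \<le> ennreal e"
          using *[rule_format, of I Inf Sup] I K dis len by (intro ennreal_leI less_imp_le) auto
        finally show ?thesis .
      qed
      have "emeasure \<mu> (\<Union>\<D>) \<le> ennreal e"
      proof (cases "\<D> = {}")
        case False
        define A where "A n = \<Union>(from_nat_into \<D> ` {..n})" for n :: nat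
        have inD: "from_nat_into \<D> n \<in> \<D>" for n using from_nat_into[OF False] .
        have U: "\<Union>\<D> = (\<Union>n. A n)"
        proof -
          have "(\<Union>n. A n) = \<Union>(range (from_nat_into \<D>))"
          proof (intro equalityI subsetI)
            fix x assume "x \<in> \<Union>(range (from_nat_into \<D>))"
            then obtain n where "x \<in> from_nat_into \<D> n" by blast
            then have "x \<in> A n" unfolding A_def by auto
            then show "x \<in> (\<Union>n. A n)" by blast
          qed (auto simp: A_def)
          then show ?thesis using range_from_nat_into[OF False cD] by simp
        qed
        have "incseq A" unfolding A_def by (intro monoI Union_mono image_mono) auto
        moreover have "range A \<subseteq> sets \<mu>"
          using inD Kb unfolding A_def sets_mu by (auto intro!: sets.finite_UN)
        ultimately have "emeasure \<mu> (\<Union>\<D>) = (SUP n. emeasure \<mu> (A n))"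
          unfolding U by (simp add: SUP_emeasure_incseq)
        also have "\<dots> \<le> ennreal e"
          unfolding A_def using inD by (intro SUP_least fin) auto
        finally show ?thesis .
      qed simp
      moreover have "\<Union>\<D> \<in> sets \<mu>"
        unfolding sets_mu using cD Kb by (intro sets.countable_Union) auto
      ultimately show ?thesis
        using order_trans[OF emeasure_mono[OF cov, of \<mu>]] by simp
    qed
    have "emeasure \<mu> ({a..b} \<inter> N) \<le> 0"
      by (rule ennreal_le_epsilon) (rule small)
    then show ?thesis using em'[OF Nb] by simp
  qed
  then have "absolutely_continuous lborel \<mu>'"
    unfolding absolutely_continuous_def by (auto simp: null_sets_def sets_mu')
  then obtain f where f[measurable]: "f \<in> borel_measurable lborel" and fd: "density lborel f = \<mu>'"
    using sigma_finite_measure.Radon_Nikodym[OF lborel.sigma_finite_measure_axioms, of \<mu>'] by (auto simp: sets_mu')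
  have fm[measurable]: "f \<in> borel_measurable borel" using f by simp
  have emf: "(\<integral>\<^sup>+z. f z * indicator {x..y} z \<partial>lborel) = ennreal (U y - U x)" if "a \<le> x" "x \<le> y" "y \<le> b" for x y
  proof -
    have "(\<integral>\<^sup>+z. f z * indicator {x..y} z \<partial>lborel) = emeasure \<mu>' {x..y}"
      unfolding fd[symmetric] by (rule emeasure_density[symmetric]) auto
    also have "\<dots> = emeasure \<mu> {x..y}" using that by (subst em') (auto intro!: arg_cong[where f = "emeasure \<mu>"])
    finally show ?thesis using em that by simp
  qed
  \<comment> \<open>The density is finite almost everywhere on \<open>{a..b}\<close> because its
    integral there is finite, so passing to real values changes it on a null set only.\<close>
  define p where "p z = enn2real (f z) * indicator {a..b} z" for z
  have pm[measurable]: "p \<in> borel_measurable borel" unfolding p_def by measurable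
  have "AE z in lborel. f z * indicator {a..b} z \<noteq> \<infinity>"
    using emf[of a b] ab by (intro nn_integral_noteq_infinite) auto
  then have AEf: "AE z in lborel. ennreal (p z) = f z * indicator {a..b} z"
    by eventually_elim (auto simp: p_def ennreal_enn2real_if indicator_def split: if_splits)
  have nnp: "(\<integral>\<^sup>+z. ennreal (indicator {x..y} z * p z) \<partial>lborel) = ennreal (U y - U x)"
    if "a \<le> x" "x \<le> y" "y \<le> b" for x y
  proof -
    have "(\<integral>\<^sup>+z. ennreal (indicator {x..y} z * p z) \<partial>lborel) = (\<integral>\<^sup>+z. f z * indicator {x..y} z \<partial>lborel)"
    proof (rule nn_integral_cong_AE)
      show "AE z in lborel. ennreal (indicator {x..y} z * p z) = f z * indicator {x..y} z"
        using AEf by eventually_elim (use that in \<open>auto simp: indicator_def split: if_splits\<close>)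
    qed
    then show ?thesis using emf[OF that] by simp
  qed
  have p0: "0 \<le> p z" for z by (simp add: p_def)
  have pab: "indicator {a..b} z * p z = p z" for z by (simp add: p_def indicator_def)
  have "integrable lborel p"
    using nnp[of a b] ab p0 unfolding pab by (intro integrableI_nonneg) auto
  moreover have "U y - U x = (LINT z:{x..y}|lborel. p z)" if "a \<le> x" "x \<le> y" "y \<le> b" for x y
  proof -
    have "(LINT z:{x..y}|lborel. p z) = enn2real (\<integral>\<^sup>+z. ennreal (indicator {x..y} z * p z) \<partial>lborel)"
      unfolding set_lebesgue_integral_def by (subst integral_eq_nn_integral) (auto simp: p0)
    also have "\<dots> = U y - U x" using nnp[OF that] mono[OF that] by simp
    finally show ?thesis by simp
  qed
  ultimately show ?thesis by blast
qed

text \<open>Jordan decomposition: \<open>g\<close> is the variation minus the difference of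
  variation and \<open>g\<close>. Both are nondecreasing, and an increment of the second is at most
  twice that of the first, so both are absolutely continuous.\<close>

lemma absolutely_continuous_density:
  assumes ac: "absolutely_continuous_on_interval a b g" and ab: "a < b"
  shows "\<exists>p. integrable lborel p \<and>
     (\<forall>x y. a \<le> x \<longrightarrow> x \<le> y \<longrightarrow> y \<le> b \<longrightarrow> g y - g x = (LINT z:{x..y}|lborel. p z))"
proof -
  let ?V = "variation g a" and ?W = "\<lambda>x. variation g a x - g x"
  have step: "?V x + \<bar>g y - g x\<bar> \<le> ?V y" if "a \<le> x" "x \<le> y" "y \<le> b" for x y
    using variation_add_le[OF ac _ _ that(2,3)] that by auto
  have "\<exists>p. integrable lborel p \<and>
     (\<forall>x y. a \<le> x \<longrightarrow> x \<le> y \<longrightarrow> y \<le> b \<longrightarrow> ?V y - ?V x = (LINT z:{x..y}|lborel. p z))"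
  proof (rule monotone_absolutely_continuous_density[OF ab])
    fix x y assume "a \<le> x" "x \<le> y" "y \<le> b"
    then show "?V x \<le> ?V y" using step[of x y] by linarith
  qed (rule variation_absolutely_continuous[OF ac])
  then obtain p where p: "integrable lborel p"
    "\<And>x y. a \<le> x \<Longrightarrow> x \<le> y \<Longrightarrow> y \<le> b \<Longrightarrow> ?V y - ?V x = (LINT z:{x..y}|lborel. p z)"
    by blast
  have "\<exists>q. integrable lborel q \<and>
     (\<forall>x y. a \<le> x \<longrightarrow> x \<le> y \<longrightarrow> y \<le> b \<longrightarrow> ?W y - ?W x = (LINT z:{x..y}|lborel. q z))"
  proof (rule monotone_absolutely_continuous_density[OF ab])
    fix x y assume "a \<le> x" "x \<le> y" "y \<le> b"
    then show "?W x \<le> ?W y" using step[of x y] by linarith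
  next
    fix \<epsilon> :: real assume "\<epsilon> > 0"
    then have e2: "\<epsilon> / 2 > 0" by simp
    obtain \<delta> where d: "\<delta> > 0" and *: "\<forall>(I :: real set set) u v. finite I \<longrightarrow>
       (\<forall>i\<in>I. a \<le> u i \<and> u i \<le> v i \<and> v i \<le> b) \<longrightarrow>
       disjoint_family_on (\<lambda>i. {u i<..<v i}) I \<longrightarrow> (\<Sum>i\<in>I. v i - u i) < \<delta> \<longrightarrow>
       (\<Sum>i\<in>I. ?V (v i) - ?V (u i)) < \<epsilon> / 2"
      using variation_absolutely_continuous[OF ac e2, where ?'i = "real set"] by (elim exE conjE)
    show "\<exists>\<delta>>0. \<forall>(I :: real set set) u v. finite I \<longrightarrow>
       (\<forall>i\<in>I. a \<le> u i \<and> u i \<le> v i \<and> v i \<le> b) \<longrightarrow>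
       disjoint_family_on (\<lambda>i. {u i<..<v i}) I \<longrightarrow> (\<Sum>i\<in>I. v i - u i) < \<delta> \<longrightarrow>
       (\<Sum>i\<in>I. ?W (v i) - ?W (u i)) < \<epsilon>"
    proof (intro exI[of _ \<delta>] conjI d allI impI)
      fix I :: "real set set" and u v
      assume I: "finite I" "\<forall>i\<in>I. a \<le> u i \<and> u i \<le> v i \<and> v i \<le> b"
        "disjoint_family_on (\<lambda>i. {u i<..<v i}) I" "(\<Sum>i\<in>I. v i - u i) < \<delta>"
      have "(\<Sum>i\<in>I. ?W (v i) - ?W (u i)) \<le> (\<Sum>i\<in>I. 2 * (?V (v i) - ?V (u i)))"
      proof (rule sum_mono)
        fix i assume "i \<in> I"
        then show "?W (v i) - ?W (u i) \<le> 2 * (?V (v i) - ?V (u i))"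
          using step[of "u i" "v i"] I(2) by force
      qed
      also have "\<dots> < \<epsilon>"
        using *[rule_format, OF I(1) _ I(3,4)] I(2) by (simp only: sum_distrib_left[symmetric]) simp
      finally show "(\<Sum>i\<in>I. ?W (v i) - ?W (u i)) < \<epsilon>" .
    qed
  qed
  then obtain q where q: "integrable lborel q"
    "\<And>x y. a \<le> x \<Longrightarrow> x \<le> y \<Longrightarrow> y \<le> b \<Longrightarrow> ?W y - ?W x = (LINT z:{x..y}|lborel. q z)"
    by blast
  have "g y - g x = (LINT z:{x..y}|lborel. p z - q z)" if "a \<le> x" "x \<le> y" "y \<le> b" for x y
  proof -
    have "set_integrable lborel {x..y} p" "set_integrable lborel {x..y} q"
      unfolding set_integrable_def by (intro integrable_mult_indicator p(1) q(1); simp)+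
    then have "(LINT z:{x..y}|lborel. p z - q z) = (?V y - ?V x) - (?W y - ?W x)"
      using p(2)[OF that] q(2)[OF that] by (simp add: set_integral_diff)
    then show ?thesis by simp
  qed
  with p(1) q(1) show ?thesis by (intro exI[of _ "\<lambda>z. p z - q z"]) auto
qed

text \<open>The differentiation theorem used here concerns cubes with \<open>x\<close> as lower
  corner, that is the right-hand derivative. Applying it to \<open>p\<close> and to its reflection
  covers both sides outside the union of two null sets.\<close>

lemma indefinite_integral_AE_derivative:
  fixes p g :: "real \<Rightarrow> real"
  assumes int: "\<And>c d. p integrable_on {c..d}"
    and g: "\<And>x y. a \<le> x \<Longrightarrow> x \<le> y \<Longrightarrow> y \<le> b \<Longrightarrow> g y - g x = integral {x..y} p"
  shows "\<exists>N. negligible N \<and> (\<forall>x\<in>{a<..<b} - N. (g has_real_derivative p x) (at x))"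
proof -
  have "p integrable_on cbox c d" for c d :: real using int by (simp add: cbox_interval)
  then obtain N1 where N1: "negligible N1" and
    r: "\<And>x e. x \<notin> N1 \<Longrightarrow> 0 < e \<Longrightarrow> \<exists>d>0. \<forall>h. 0 < h \<and> h < d \<longrightarrow>
        norm (integral (cbox x (x + h *\<^sub>R One)) p /\<^sub>R h ^ DIM(real) - p x) < e"
    by (rule integrable_ccontinuous_explicit) blast
  have "(\<lambda>x. p (- x)) integrable_on cbox c d" for c d :: real
    using int[of "-d" "-c"] Henstock_Kurzweil_Integration.integrable_reflect_real[where f = p and a = "-d" and b = "-c"] by (simp add: cbox_interval)
  then obtain N2 where N2: "negligible N2" and
    l: "\<And>x e. x \<notin> N2 \<Longrightarrow> 0 < e \<Longrightarrow> \<exists>d>0. \<forall>h. 0 < h \<and> h < d \<longrightarrow>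
        norm (integral (cbox x (x + h *\<^sub>R One)) (\<lambda>x. p (- x)) /\<^sub>R h ^ DIM(real) - p (- x)) < e"
    by (rule integrable_ccontinuous_explicit) blast
  have "negligible (N1 \<union> uminus ` N2)"
    using N1 N2 by (intro negligible_Un negligible_differentiable_image_negligible)
      (auto intro!: differentiable_on_minus)
  moreover have "(g has_real_derivative p x) (at x)" if x: "a < x" "x < b" "x \<notin> N1 \<union> uminus ` N2" for x
    unfolding DERIV_def LIM_eq
  proof (intro allI impI)
    fix e :: real assume e: "0 < e"
    have "- x \<notin> N2" using x(3) by (metis UnCI add.inverse_inverse image_eqI)
    obtain d1 where d1: "d1 > 0" "\<And>h. 0 < h \<Longrightarrow> h < d1 \<Longrightarrow> \<bar>integral {x..x + h} p / h - p x\<bar> < e"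
      using r[of x e] x(3) e by (auto simp: cbox_interval divide_inverse_commute)
    obtain d2 where d2: "d2 > 0" "\<And>h. 0 < h \<Longrightarrow> h < d2 \<Longrightarrow> \<bar>integral {-x..-x + h} (\<lambda>x. p (- x)) / h - p x\<bar> < e"
      using l[of "-x" e] \<open>- x \<notin> N2\<close> e by (auto simp: cbox_interval divide_inverse_commute)
    define s where "s = min (min d1 d2) (min (x - a) (b - x))"
    have "s > 0" using x d1(1) d2(1) by (simp add: s_def)
    moreover have "norm ((g (x + h) - g x) / h - p x) < e" if h: "h \<noteq> 0" "norm (h - 0) < s" for h
    proof (cases "h > 0")
      case True
      then have "g (x + h) - g x = integral {x..x + h} p"
        using h x by (intro g) (auto simp: s_def)
      then show ?thesis using d1(2)[of h] True h by (simp add: s_def)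
    next
      case False
      have "g x - g (x + h) = integral {x + h..x} p"
        using h x False by (intro g) (auto simp: s_def)
      also have "\<dots> = integral {-x..-x + -h} (\<lambda>x. p (- x))"
        using Henstock_Kurzweil_Integration.integral_reflect_real[of "-(x + h)" "-x" "\<lambda>x. p (- x)"]
        by (simp add: add.commute)
      finally have "(g (x + h) - g x) / h = integral {-x..-x + -h} (\<lambda>x. p (- x)) / (-h)"
        by (simp add: field_simps)
      then show ?thesis using d2(2)[of "-h"] False h by (simp add: s_def)
    qed
    ultimately show "\<exists>s>0. \<forall>h. h \<noteq> 0 \<and> norm (h - 0) < s \<longrightarrow> norm ((g (x + h) - g x) / h - p x) < e"
      by blast
  qed
  ultimately show ?thesis by (intro exI[of _ "N1 \<union> uminus ` N2"]) auto
qed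

text \<open>This converts the generator inequality, assumed only where the second derivative exists,
  into one on increments over intervals.\<close>

lemma absolutely_continuous_increment_ge:
  fixes g c :: "real \<Rightarrow> real"
  assumes ac: "absolutely_continuous_on_interval a b g" and ab: "a \<le> b"
    and c: "continuous_on {a..b} c"
    and g: "\<And>z. a < z \<Longrightarrow> z < b \<Longrightarrow> g differentiable (at z) \<Longrightarrow> deriv g z \<ge> c z"
  shows "integral {a..b} c \<le> g b - g a"
proof (cases "a = b")
  case False
  with ab have ab: "a < b" by simp
  obtain p where p: "integrable lborel p"
    and pg: "\<And>x y. a \<le> x \<Longrightarrow> x \<le> y \<Longrightarrow> y \<le> b \<Longrightarrow> g y - g x = (LINT z:{x..y}|lborel. p z)"
    using absolutely_continuous_density[OF ac ab] by blast
  have si: "set_integrable lborel {x..y} p" for x y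
    unfolding set_integrable_def using p by (intro integrable_mult_indicator) auto
  have int: "p integrable_on {x..y}" for x y using set_borel_integral_eq_integral(1)[OF si] .
  have gi: "g y - g x = integral {x..y} p" if "a \<le> x" "x \<le> y" "y \<le> b" for x y
    using pg[OF that] set_borel_integral_eq_integral(2)[OF si] by simp
  obtain N where N: "negligible N" and der: "\<And>x. x \<in> {a<..<b} - N \<Longrightarrow> (g has_real_derivative p x) (at x)"
    using indefinite_integral_AE_derivative[of p a b g] int gi by blast
  have neg: "negligible (N \<union> {a, b})" using N by simp
  \<comment> \<open>On the null set without known derivative \<open>q\<close> takes the value of
    \<open>c\<close>, so \<open>c x \<le> q x\<close> holds at every point while \<open>q\<close>
    has the same integral as \<open>p\<close>.\<close>
  define q where "q x = (if x \<in> N \<union> {a, b} then c x else p x)" for x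
  have "integral {a..b} c \<le> integral {a..b} q"
  proof (rule integral_le)
    show "c integrable_on {a..b}" by (rule integrable_continuous_real[OF c])
    show "q integrable_on {a..b}"
      by (rule integrable_spike[OF int neg]) (auto simp: q_def)
    fix x assume x: "x \<in> {a..b}"
    show "c x \<le> q x"
    proof (cases "x \<in> N \<union> {a, b}")
      case False
      then have d: "(g has_real_derivative p x) (at x)" using x by (intro der) auto
      then have "c x \<le> deriv g x"
        using False x by (intro g) (auto simp: real_differentiable_def)
      then show ?thesis using False DERIV_imp_deriv[OF d] by (simp add: q_def)
    qed (simp add: q_def)
  qed
  also have "\<dots> = integral {a..b} p" by (rule integral_spike[OF neg]) (auto simp: q_def)
  also have "\<dots> = g b - g a" using gi ab by simp
  finally show ?thesis .
qed simp

section \<open>Truncating the potential\<close>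

text \<open>If the slope were too large at all records (points where \<open>\<phi>\<close> is
  maximal over the half-line to their left), every point after an initial record \<open>m0\<close>
  would be a record and the generator inequality would give
  \<open>\<phi>' b \<ge> c * (\<phi> b - \<phi> m0)\<close>. The slack left by the factor
  \<open>1 - \<epsilon>\<close> is what makes the rate \<open>c\<close> positive; polynomial growth
  then gives the contradiction.\<close>

lemma exists_good_record:
  fixes \<phi> \<phi>' H :: "real \<Rightarrow> real"
  assumes s: "s > 0" and mu: "\<mu> > 0" and eps: "0 < \<epsilon>" "\<epsilon> < 1" and nu: "\<nu> > 0"
    and der: "\<And>z. (\<phi> has_real_derivative \<phi>' z) (at z)"
    and cont: "continuous_on UNIV \<phi>'" and H: "continuous_on UNIV H"
    and gen: "\<And>a b. a \<le> b \<Longrightarrow> integral {a..b} (\<lambda>z. \<mu> * \<phi>' z + \<nu> - H z) \<le> s * (\<phi>' b - \<phi>' a)"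
    and below: "\<And>z. z \<ge> 0 \<Longrightarrow> \<phi> z \<ge> L + \<epsilon> * z"
    and above: "\<And>Q. \<exists>U. \<forall>z\<le>Q. \<phi> z \<le> U"
    and Q: "Q \<ge> 0" "\<And>z. z \<ge> Q \<Longrightarrow> H z > \<nu>"
    and growth: "\<And>z. z \<ge> 0 \<Longrightarrow> \<phi>' z \<le> A0 + A1 * z ^ d"
  shows "\<exists>m\<ge>0. (\<forall>z\<le>m. \<phi> z \<le> \<phi> m) \<and> \<mu> * ((1 - \<epsilon>) * \<phi>' m) < H m - (1 - \<epsilon>) * \<nu>"
proof (rule ccontr)
  assume none: "\<not> ?thesis"
  have bad: "\<mu> * ((1 - \<epsilon>) * \<phi>' m) \<ge> H m - (1 - \<epsilon>) * \<nu>" if "m \<ge> Q" "\<forall>z\<le>m. \<phi> z \<le> \<phi> m" for m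
  proof (rule ccontr)
    assume "\<not> ?thesis"
    moreover have "m \<ge> 0" using that(1) Q(1) by linarith
    ultimately show False using none that(2) by (meson not_less)
  qed
  have posd: "\<phi>' m > 0" if "m \<ge> Q" "\<forall>z\<le>m. \<phi> z \<le> \<phi> m" for m
  proof -
    have "(1 - \<epsilon>) * \<nu> \<le> 1 * \<nu>" using eps nu by (intro mult_right_mono) auto
    then have "\<mu> * ((1 - \<epsilon>) * \<phi>' m) > 0" using bad[OF that] Q(2)[OF that(1)] by linarith
    then show ?thesis using mu eps by (simp add: zero_less_mult_iff)
  qed
  have contphi: "continuous_on S \<phi>" for S
    using der by (meson DERIV_isCont continuous_at_imp_continuous_on)
  obtain U where U: "\<forall>z\<le>Q. \<phi> z \<le> U" using above by blast
  \<comment> \<open>By \<open>below\<close>, the value of \<open>\<phi>\<close> at \<open>z1\<close>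
    exceeds its upper bound \<open>U\<close> on the left of \<open>Q\<close>; a maximum point over
    \<open>{Q..z1}\<close> is therefore a record.\<close>
  define z1 where "z1 = max Q ((\<bar>U\<bar> + \<bar>L\<bar> + 1) / \<epsilon>)"
  have z1: "z1 \<ge> Q" "\<phi> z1 > U"
  proof -
    show "z1 \<ge> Q" by (simp add: z1_def)
    have "(\<bar>U\<bar> + \<bar>L\<bar> + 1) / \<epsilon> \<le> z1" by (simp add: z1_def)
    then have "\<bar>U\<bar> + \<bar>L\<bar> + 1 \<le> \<epsilon> * z1" using eps by (simp add: field_simps)
    then show "\<phi> z1 > U" using below[of z1] \<open>z1 \<ge> Q\<close> Q(1) by linarith
  qed
  have "\<exists>m\<in>{Q..z1}. \<forall>y\<in>{Q..z1}. \<phi> y \<le> \<phi> m"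
    using z1 by (intro continuous_attains_sup contphi) auto
  then obtain m0 where m0: "m0 \<in> {Q..z1}" "\<And>y. y \<in> {Q..z1} \<Longrightarrow> \<phi> y \<le> \<phi> m0" by blast
  have rec0: "\<phi> z \<le> \<phi> m0" if "z \<le> m0" for z
    using m0(2)[of z] m0(2)[of z1] U[rule_format, of z] z1 that m0(1) by (cases "z \<le> Q") auto
  \<comment> \<open>A maximum point over \<open>{m0..b}\<close> is a record, so the derivative there
    is positive; being a maximum it can then only be the right end \<open>b\<close>.\<close>
  have rec: "\<phi> z \<le> \<phi> b" if b: "b \<ge> m0" and z: "z \<le> b" for z b
  proof -
    have "\<exists>m\<in>{m0..b}. \<forall>y\<in>{m0..b}. \<phi> y \<le> \<phi> m"
      using b by (intro continuous_attains_sup contphi) auto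
    then obtain m where m: "m \<in> {m0..b}" "\<And>y. y \<in> {m0..b} \<Longrightarrow> \<phi> y \<le> \<phi> m" by blast
    have mr: "\<phi> y \<le> \<phi> m" if "y \<le> m" for y
      using m(2)[of y] m(2)[of m0] rec0[of y] that m(1) by (cases "y \<le> m0") auto
    have "m \<ge> Q" using m(1) m0(1) by auto
    with mr have "\<phi>' m > 0" by (intro posd) auto
    then obtain d where d: "d > 0" "\<And>h. 0 < h \<Longrightarrow> h < d \<Longrightarrow> \<phi> m < \<phi> (m + h)"
      using DERIV_pos_inc_right[OF der] by blast
    have "m = b"
    proof (rule ccontr)
      assume "m \<noteq> b"
      with m(1) have "m < b" by auto
      then have "\<phi> m < \<phi> (m + min (d / 2) (b - m))" using d(1) by (intro d(2)) auto
      moreover have "\<phi> (m + min (d / 2) (b - m)) \<le> \<phi> m"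
        using m(1) d(1) by (intro m(2)) (auto simp: min_def)
      ultimately show False by simp
    qed
    then show ?thesis using mr z by simp
  qed
  have pos: "\<phi>' z > 0" if "z \<ge> m0" for z
    using posd[of z] rec[of z] that m0(1) by auto
  define c where "c = \<epsilon> * \<mu> / s"
  have c: "c > 0" using eps mu s by (simp add: c_def)
  define w where "w z = \<phi> z - \<phi> m0" for z
  have wder: "(w has_real_derivative \<phi>' z) (at z)" for z
    unfolding w_def by (auto intro!: derivative_eq_intros der)
  \<comment> \<open>Every point of \<open>{m0..b}\<close> is a record with large slope, so the
    integrand of the generator inequality is at least \<open>\<epsilon> * \<mu> * \<phi>' z\<close>,
    whose integral is explicit.\<close>
  have ineq: "\<phi>' b \<ge> c * w b" if b: "b \<ge> m0" for b
  proof -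
    have "(\<phi>' has_integral (\<phi> b - \<phi> m0)) {m0..b}"
      using b der by (intro fundamental_theorem_of_calculus)
        (auto simp: has_real_derivative_iff_has_vector_derivative[symmetric] intro: has_field_derivative_at_within)
    then have "((\<lambda>z. \<epsilon> * \<mu> * \<phi>' z) has_integral (\<epsilon> * \<mu> * w b)) {m0..b}"
      unfolding w_def by (rule has_integral_mult_right)
    moreover have "((\<lambda>z. \<mu> * \<phi>' z + \<nu> - H z) has_integral integral {m0..b} (\<lambda>z. \<mu> * \<phi>' z + \<nu> - H z)) {m0..b}"
      by (intro integrable_integral integrable_continuous_real continuous_intros
          continuous_on_subset[OF cont] continuous_on_subset[OF H]) auto
    ultimately have "\<epsilon> * \<mu> * w b \<le> integral {m0..b} (\<lambda>z. \<mu> * \<phi>' z + \<nu> - H z)"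
    proof (rule has_integral_le)
      fix z assume "z \<in> {m0..b}"
      then have "\<mu> * ((1 - \<epsilon>) * \<phi>' z) \<ge> H z - (1 - \<epsilon>) * \<nu>"
        using rec[of z] m0(1) by (intro bad) auto
      moreover have "\<epsilon> * \<nu> > 0" using eps nu by simp
      ultimately show "\<epsilon> * \<mu> * \<phi>' z \<le> \<mu> * \<phi>' z + \<nu> - H z" by (simp add: algebra_simps)
    qed
    also have "\<dots> \<le> s * (\<phi>' b - \<phi>' m0)" using gen b by simp
    also have "\<dots> \<le> s * \<phi>' b" using pos[of m0] s by simp
    finally show ?thesis using s by (simp add: c_def field_simps)
  qed
  have wpos: "w (m0 + 1) > 0"
    unfolding w_def using DERIV_pos_imp_increasing[of m0 "m0 + 1" \<phi>] der pos by fastforce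
  \<comment> \<open>Gronwall's argument: since the derivative of \<open>w\<close> is at least
    \<open>c * w\<close>, the product with the integrating factor is nondecreasing.\<close>
  have growing: "w z * exp (- c * z) \<ge> w (m0 + 1) * exp (- c * (m0 + 1))" if "z \<ge> m0 + 1" for z
  proof (rule DERIV_nonneg_imp_nondecreasing[OF that])
    fix x assume x: "m0 + 1 \<le> x" "x \<le> z"
    have "((\<lambda>z. w z * exp (- c * z)) has_real_derivative (\<phi>' x - c * w x) * exp (- c * x)) (at x)"
      by (auto intro!: derivative_eq_intros wder simp: algebra_simps)
    moreover have "(\<phi>' x - c * w x) * exp (- c * x) \<ge> 0" using ineq[of x] x by simp
    ultimately show "\<exists>y. ((\<lambda>z. w z * exp (- c * z)) has_real_derivative y) (at x) \<and> 0 \<le> y" by blast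
  qed
  have poly: "w z \<le> (\<phi> 0 - \<phi> m0) + z * (\<bar>A0\<bar> + \<bar>A1\<bar> * z ^ d)" if z: "z > 0" for z
  proof -
    obtain y where y: "0 < y" "y < z" "\<phi> z - \<phi> 0 = (z - 0) * \<phi>' y"
      using MVT2[OF z, of \<phi> \<phi>'] der by blast
    have "\<phi>' y \<le> A0 + A1 * y ^ d" using growth y by simp
    also have "\<dots> \<le> \<bar>A0\<bar> + \<bar>A1\<bar> * z ^ d"
    proof (intro add_mono)
      have "A1 * y ^ d \<le> \<bar>A1\<bar> * y ^ d" using y by (intro mult_right_mono) auto
      also have "\<dots> \<le> \<bar>A1\<bar> * z ^ d" using y by (intro mult_left_mono power_mono) auto
      finally show "A1 * y ^ d \<le> \<bar>A1\<bar> * z ^ d" .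
    qed simp
    finally have "z * \<phi>' y \<le> z * (\<bar>A0\<bar> + \<bar>A1\<bar> * z ^ d)" using z by (intro mult_left_mono) auto
    then show ?thesis using y(3) by (simp add: w_def)
  qed
  define B where "B = \<phi> 0 - \<phi> m0"
  have lim: "((\<lambda>z. (B + z * (\<bar>A0\<bar> + \<bar>A1\<bar> * z ^ d)) * exp (- c * z)) \<longlongrightarrow> 0) at_top"
    using c by real_asymp
  have "w (m0 + 1) * exp (- c * (m0 + 1)) > 0" using wpos by simp
  from order_tendstoD(2)[OF lim this]
  have "\<forall>\<^sub>F z in at_top. (B + z * (\<bar>A0\<bar> + \<bar>A1\<bar> * z ^ d)) * exp (- c * z) < w (m0 + 1) * exp (- c * (m0 + 1))" .
  moreover have "\<forall>\<^sub>F z in at_top. z \<ge> m0 + 1 \<and> z > 0"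
    by (intro eventually_conj eventually_ge_at_top eventually_gt_at_top)
  ultimately have "\<forall>\<^sub>F z in at_top. (z::real) < z"
  proof eventually_elim
    case (elim z)
    have "w z * exp (- c * z) \<le> (B + z * (\<bar>A0\<bar> + \<bar>A1\<bar> * z ^ d)) * exp (- c * z)"
      using poly[of z] elim by (intro mult_right_mono) (auto simp: B_def)
    with growing[of z] elim show ?case by linarith
  qed
  then show False by simp
qed

lemma continuous_has_antiderivative:
  fixes g :: "real \<Rightarrow> real"
  assumes "continuous_on UNIV g"
  shows "\<exists>G. \<forall>x. (G has_real_derivative g x) (at x)"
proof -
  have "\<exists>F. \<forall>x :: real. -\<infinity> < ereal x \<longrightarrow> ereal x < \<infinity> \<longrightarrow> (F has_vector_derivative g x) (at x)"
    using assms by (intro einterval_antiderivative) (auto simp: continuous_on_eq_continuous_at)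
  then show ?thesis by (auto simp: has_real_derivative_iff_has_vector_derivative)
qed

text \<open>
  Beyond \<open>m\<close> the derivative decreases with the slope \<open>- D\<close>, the steepest descent that the generator inequality
  allows at \<open>m\<close> and hence, \<open>h\<close> being nondecreasing there, everywhere to the right of \<open>m\<close>.
\<close>

lemma truncated_potential:
  fixes f f' h K :: "real \<Rightarrow> real"
  assumes s: "s > 0" and mu: "\<mu> > 0" and k: "k \<ge> 0" and eps: "0 < \<epsilon>" "\<epsilon> < 1" and nu: "\<nu> > 0"
    and der: "\<And>z. (f has_real_derivative f' z) (at z)"
    and cont: "continuous_on UNIV f'" and h: "continuous_on UNIV h"
    and h0: "\<And>z. h z \<ge> 0" and h_mono: "\<And>x y. 0 \<le> x \<Longrightarrow> x \<le> y \<Longrightarrow> h x \<le> h y"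
    and Q: "Q \<ge> 0" "\<And>z. z \<ge> Q \<Longrightarrow> h z > \<nu>"
    and gen: "\<And>a b. a \<le> b \<Longrightarrow> integral {a..b} (\<lambda>z. \<mu> * f' z + \<nu> - h z) \<le> s * (f' b - f' a)"
    and K: "\<And>\<xi>. \<xi> \<ge> 0 \<Longrightarrow> 0 \<le> K \<xi>" "\<And>\<xi>. \<xi> \<ge> 0 \<Longrightarrow> K \<xi> \<le> Kb"
    and fK: "\<And>z1 z2. z1 > z2 \<Longrightarrow> f z1 - f z2 \<ge> - K (z1 - z2) - k * (z1 - z2)"
    and growth: "\<And>z. z < 0 \<Longrightarrow> \<bar>f' z\<bar> \<le> a0" "\<And>z. z \<ge> 0 \<Longrightarrow> \<bar>f' z\<bar> \<le> a0 + a1 * z ^ d" "a1 > 0"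
  shows "\<exists>F F' A M C. (\<forall>z. (F has_real_derivative F' z) (at z)) \<and> continuous_on UNIV F' \<and>
    (\<forall>z. \<bar>F' z\<bar> \<le> A) \<and> M \<ge> 0 \<and> (\<forall>z\<ge>M. F' z = 0) \<and> (\<forall>z. F z \<le> C) \<and>
    (\<forall>z1 z2. z1 > z2 \<longrightarrow> F z1 - F z2 \<ge> - K (z1 - z2)) \<and>
    (\<forall>a b. a \<le> b \<longrightarrow> integral {a..b} (\<lambda>z. \<mu> * F' z + ((1 - \<epsilon>) * \<nu> - \<mu> * (k + \<epsilon>)) - h z) \<le> s * (F' b - F' a))"
proof -
  define \<phi> where "\<phi> z = f z + (k + \<epsilon>) * z" for z
  define \<phi>' where "\<phi>' z = f' z + (k + \<epsilon>)" for z
  \<comment> \<open>The linear term lowers the generator by \<open>\<theta>\<close>; adding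
    \<open>\<theta>\<close> to the holding cost makes \<open>\<phi>\<close> satisfy the inequality
    with the original \<open>\<nu>\<close>.\<close>
  define \<theta> where "\<theta> = \<mu> * (k + \<epsilon>)"
  define H where "H z = h z + \<theta>" for z
  have th: "\<theta> > 0" using mu k eps by (simp add: \<theta>_def)
  have dphi: "(\<phi> has_real_derivative \<phi>' z) (at z)" for z
    unfolding \<phi>_def \<phi>'_def by (auto intro!: derivative_eq_intros der)
  have cphi: "continuous_on UNIV \<phi>'" unfolding \<phi>'_def by (intro continuous_intros cont)
  have cH: "continuous_on UNIV H" unfolding H_def by (intro continuous_intros h)
  have genphi: "integral {a..b} (\<lambda>z. \<mu> * \<phi>' z + \<nu> - H z) \<le> s * (\<phi>' b - \<phi>' a)" if "a \<le> b" for a b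
    using gen[OF that] by (simp add: \<phi>'_def H_def \<theta>_def algebra_simps)
  have phiK: "\<phi> z1 - \<phi> z2 \<ge> - K (z1 - z2) + \<epsilon> * (z1 - z2)" if "z1 > z2" for z1 z2
    using fK[OF that] by (simp add: \<phi>_def algebra_simps)
  have Kb: "Kb \<ge> 0" using K[of 0] by simp
  have below: "\<phi> z \<ge> (\<phi> 0 - Kb) + \<epsilon> * z" if "z \<ge> 0" for z
    using phiK[of 0 z] K(2)[of z] that Kb by (cases "z = 0") auto
  have above: "\<exists>U. \<forall>z\<le>q. \<phi> z \<le> U" for q
  proof (intro exI allI impI)
    fix z assume "z \<le> q"
    moreover have "0 \<le> \<epsilon> * (q - z)" using calculation eps by simp
    ultimately show "\<phi> z \<le> \<phi> q + Kb" using phiK[of z q] K(2)[of "q - z"] Kb by (cases "z = q") auto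
  qed
  have Qh: "H z > \<nu>" if "z \<ge> Q" for z using Q(2)[OF that] th by (simp add: H_def)
  have gr: "\<phi>' z \<le> (a0 + k + \<epsilon>) + a1 * z ^ d" if "z \<ge> 0" for z
    using growth(2)[OF that] by (auto simp: \<phi>'_def)
  obtain m where m: "m \<ge> 0" and rec: "\<And>z. z \<le> m \<Longrightarrow> \<phi> z \<le> \<phi> m"
    and slope: "\<mu> * ((1 - \<epsilon>) * \<phi>' m) < H m - (1 - \<epsilon>) * \<nu>"
    using exists_good_record[OF s mu eps nu dphi cphi cH genphi below above Q(1) Qh gr] by blast
  define v where "v = (1 - \<epsilon>) * \<phi>' m"
  have "\<phi>' m \<ge> 0"
  proof (rule ccontr)
    assume "\<not> ?thesis"
    then obtain d where d: "d > 0" "\<And>h. 0 < h \<Longrightarrow> h < d \<Longrightarrow> \<phi> m < \<phi> (m - h)"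
      using DERIV_neg_dec_left[OF dphi, of m] by (auto simp: not_le)
    then have "\<phi> m < \<phi> (m - d / 2)" by simp
    then show False using rec[of "m - d / 2"] d(1) by simp
  qed
  then have v: "v \<ge> 0" using eps by (simp add: v_def)
  define D where "D = (H m - (1 - \<epsilon>) * \<nu> - \<mu> * v) / s"
  have D: "D > 0" using slope s by (simp add: D_def v_def)
  have sD: "s * D = H m - (1 - \<epsilon>) * \<nu> - \<mu> * v" using s by (simp add: D_def)
  define u where "u z = max 0 (v - D * (z - m))" for z
  define F' where "F' z = (if z \<le> m then (1 - \<epsilon>) * \<phi>' z else u z)" for z
  have F'_ge: "F' z = u z" if "z \<ge> m" for z
    using that v by (cases "z = m") (auto simp: F'_def u_def v_def)
  have F'_le: "F' z = (1 - \<epsilon>) * \<phi>' z" if "z \<le> m" for z using that by (simp add: F'_def)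
  have cF: "continuous_on UNIV F'"
  proof -
    have "continuous_on ({..m} \<union> {m..}) F'"
    proof (rule continuous_on_closed_Un)
      show "continuous_on {..m} F'"
        using continuous_on_cong[of "{..m}" "{..m}" F' "\<lambda>z. (1 - \<epsilon>) * \<phi>' z"] F'_le
        by (auto intro!: continuous_intros continuous_on_subset[OF cphi])
      have "continuous_on {m..} u" unfolding u_def by (intro continuous_intros)
      then show "continuous_on {m..} F'"
        using continuous_on_cong[of "{m..}" "{m..}" F' u] F'_ge by auto
    qed auto
    moreover have "{..m} \<union> {m..} = UNIV" by auto
    ultimately show ?thesis by simp
  qed
  obtain G where G: "\<And>x. (G has_real_derivative F' x) (at x)"
    using continuous_has_antiderivative[OF cF] by blast
  define F where "F z = G z - G m + (1 - \<epsilon>) * \<phi> m" for z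
  have dF: "(F has_real_derivative F' z) (at z)" for z
    unfolding F_def by (auto intro!: derivative_eq_intros G)
  have Fm: "F m = (1 - \<epsilon>) * \<phi> m" by (simp add: F_def)
  have F_le: "F z = (1 - \<epsilon>) * \<phi> z" if z: "z \<le> m" for z
  proof (cases "z = m")
    case False
    with z have zm: "z < m" by simp
    let ?D = "\<lambda>z. F z - (1 - \<epsilon>) * \<phi> z"
    have dD: "(?D has_real_derivative F' x - (1 - \<epsilon>) * \<phi>' x) (at x)" for x
      by (auto intro!: derivative_eq_intros dF dphi)
    have "?D m = ?D z"
    proof (rule DERIV_isconst2[OF zm])
      show "continuous_on {z..m} ?D"
        using dD by (meson DERIV_isCont continuous_at_imp_continuous_on)
      show "(?D has_real_derivative 0) (at x)" if "z < x" "x < m" for x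
        using dD[of x] F'_le[of x] that by simp
    qed (use zm in auto)
    then show ?thesis using Fm by simp
  qed (simp add: Fm)
  have F_mono: "F x \<le> F y" if "m \<le> x" "x \<le> y" for x y
  proof (rule DERIV_nonneg_imp_nondecreasing[OF that(2)])
    fix z assume "x \<le> z" "z \<le> y"
    then have "0 \<le> F' z" using that(1) by (simp add: F'_ge u_def)
    then show "\<exists>y. (F has_real_derivative y) (at z) \<and> 0 \<le> y" using dF by blast
  qed
  \<comment> \<open>From \<open>m\<close> on the derivative falls from \<open>v\<close> with slope
    \<open>- D\<close>, so it reaches zero here.\<close>
  define M where "M = m + v / D"
  have mM: "m \<le> M" using v D by (simp add: M_def)
  have F'M: "F' z = 0" if "z \<ge> M" for z
  proof -
    have "v / D \<le> z - m" using that by (simp add: M_def)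
    then have "v \<le> D * (z - m)" using D by (simp add: field_simps)
    then show ?thesis using F'_ge[of z] that mM by (simp add: u_def)
  qed
  have F_bound: "F z \<le> F M" for z
  proof -
    consider "z \<le> m" | "m \<le> z" "z \<le> M" | "M \<le> z" by linarith
    then show ?thesis
    proof cases
      case 1
      have "F z \<le> F m" unfolding F_le[OF 1] Fm using rec[OF 1] eps by (intro mult_left_mono) auto
      then show ?thesis using F_mono[of m M] mM by simp
    next
      case 2
      then show ?thesis by (rule F_mono)
    next
      case 3
      show ?thesis
      proof (rule DERIV_nonpos_imp_nonincreasing[OF 3])
        fix x assume "M \<le> x" "x \<le> z"
        then show "\<exists>y. (F has_real_derivative y) (at x) \<and> y \<le> 0" using dF[of x] F'M[of x] by auto
      qed
    qed
  qed
  \<comment> \<open>The record property serves here: a jump across \<open>m\<close> starts at a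
    value at most \<open>F m\<close> and ends at one at least \<open>F m\<close>, since
    \<open>F\<close> does not decrease after \<open>m\<close>. On the left the jump condition of
    \<open>f\<close> is scaled by \<open>1 - \<epsilon>\<close>, which only helps as
    \<open>K\<close> is nonnegative.\<close>
  have jump: "F z1 - F z2 \<ge> - K (z1 - z2)" if z: "z1 > z2" for z1 z2
  proof -
    have Kp: "K (z1 - z2) \<ge> 0" using K(1) z by simp
    consider "z1 \<le> m" | "z2 \<le> m" "m \<le> z1" | "m \<le> z2" by linarith
    then show ?thesis
    proof cases
      case 1
      have "0 \<le> \<epsilon> * (z1 - z2)" using eps z by simp
      then have "\<phi> z1 - \<phi> z2 \<ge> - K (z1 - z2)" using phiK[OF z] by linarith
      then have "(1 - \<epsilon>) * (\<phi> z1 - \<phi> z2) \<ge> (1 - \<epsilon>) * (- K (z1 - z2))"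
        using eps by (intro mult_left_mono) auto
      moreover have "\<epsilon> * K (z1 - z2) \<ge> 0" using eps Kp by simp
      ultimately show ?thesis using F_le[of z1] F_le[of z2] 1 z by (simp add: algebra_simps)
    next
      case 2
      have "F z2 \<le> F m" unfolding F_le[OF 2(1)] Fm using rec[OF 2(1)] eps by (intro mult_left_mono) auto
      also have "\<dots> \<le> F z1" using F_mono 2 by simp
      finally show ?thesis using Kp by simp
    next
      case 3
      then show ?thesis using F_mono[of z2 z1] z Kp by simp
    qed
  qed
  define A where "A = (\<bar>a0\<bar> + a1 * m ^ d + k + \<epsilon>) + v"
  have F'_bound: "\<bar>F' z\<bar> \<le> A" for z
  proof (cases "z \<le> m")
    case True
    have p: "0 \<le> a1 * m ^ d" using growth(3) m by simp
    have "\<bar>f' z\<bar> \<le> \<bar>a0\<bar> + a1 * m ^ d"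
    proof (cases "z < 0")
      case True
      then show ?thesis using growth(1)[OF True] p by linarith
    next
      case False
      then have "a1 * z ^ d \<le> a1 * m ^ d" using True growth(3) by (intro mult_left_mono power_mono) auto
      then show ?thesis using growth(2)[of z] False by linarith
    qed
    then have b: "\<bar>\<phi>' z\<bar> \<le> \<bar>a0\<bar> + a1 * m ^ d + k + \<epsilon>" using k eps by (auto simp: \<phi>'_def)
    have "\<bar>F' z\<bar> = (1 - \<epsilon>) * \<bar>\<phi>' z\<bar>" using F'_le[OF True] eps by (simp add: abs_mult)
    also have "\<dots> \<le> 1 * \<bar>\<phi>' z\<bar>" using eps by (intro mult_right_mono) auto
    finally show ?thesis using b v by (simp add: A_def)
  next
    case False
    then have "0 \<le> D * (z - m)" using D by simp
    then have "0 \<le> F' z" "F' z \<le> v" using F'_ge[of z] False v by (auto simp: u_def)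
    moreover have "0 \<le> a1 * m ^ d" using growth(3) m by simp
    ultimately show ?thesis using k eps by (auto simp: A_def)
  qed
  define q where "q z = \<mu> * F' z + (1 - \<epsilon>) * \<nu> - H z" for z
  have qi: "q integrable_on {a..b}" for a b
    unfolding q_def by (intro integrable_continuous_real continuous_intros
        continuous_on_subset[OF cF] continuous_on_subset[OF cH]) auto
  \<comment> \<open>Scaling the inequality for \<open>\<phi>\<close> by
    \<open>1 - \<epsilon>\<close> also scales \<open>H\<close>; restoring the full \<open>H\<close>
    only lowers the integrand, since \<open>H\<close> is nonnegative.\<close>
  have left: "integral {a..b} q \<le> s * (F' b - F' a)" if ab: "a \<le> b" "b \<le> m" for a b
  proof -
    let ?g = "\<lambda>z. \<mu> * \<phi>' z + \<nu> - H z"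
    have gi: "?g integrable_on {a..b}"
      by (intro integrable_continuous_real continuous_intros
        continuous_on_subset[OF cphi] continuous_on_subset[OF cH]) auto
    have "integral {a..b} q \<le> integral {a..b} (\<lambda>z. (1 - \<epsilon>) * ?g z)"
    proof (rule integral_le[OF qi])
      show "(\<lambda>z. (1 - \<epsilon>) * ?g z) integrable_on {a..b}" using gi by (rule integrable_on_mult_right)
      fix z assume "z \<in> {a..b}"
      then have "F' z = (1 - \<epsilon>) * \<phi>' z" using ab by (intro F'_le) auto
      then have "\<mu> * F' z = (1 - \<epsilon>) * (\<mu> * \<phi>' z)" by simp
      moreover have "0 \<le> \<epsilon> * H z" using eps h0[of z] th by (simp add: H_def)
      ultimately show "q z \<le> (1 - \<epsilon>) * ?g z" unfolding q_def by (simp add: algebra_simps)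
    qed
    also have "\<dots> = (1 - \<epsilon>) * integral {a..b} ?g" by simp
    also have "\<dots> \<le> (1 - \<epsilon>) * (s * (\<phi>' b - \<phi>' a))"
      using genphi[OF ab(1)] eps by (intro mult_left_mono) auto
    also have "\<dots> = s * (F' b - F' a)"
      unfolding F'_le[OF ab(2)] F'_le[OF order_trans[OF ab]] by (simp add: algebra_simps)
    finally show ?thesis .
  qed
  have right: "integral {a..b} q \<le> s * (F' b - F' a)" if ab: "m \<le> a" "a \<le> b" for a b
  proof -
    have "integral {a..b} q \<le> integral {a..b} (\<lambda>z. - (s * D))"
    proof (rule integral_le[OF qi])
      fix z assume z: "z \<in> {a..b}"
      then have "0 \<le> D * (z - m)" using ab D by auto
      then have "F' z \<le> v" using F'_ge[of z] z ab v by (auto simp: u_def)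
      then have "\<mu> * F' z \<le> \<mu> * v" using mu by simp
      moreover have "H m \<le> H z" using h_mono[of m z] m z ab by (simp add: H_def)
      ultimately show "q z \<le> - (s * D)" unfolding q_def sD by simp
    qed auto
    also have "\<dots> = s * (- (D * (b - a)))" using ab by (simp add: algebra_simps)
    also have "\<dots> \<le> s * (F' b - F' a)"
    proof (rule mult_left_mono)
      have "0 \<le> D * (b - a)" using ab D by simp
      then show "- (D * (b - a)) \<le> F' b - F' a"
        using F'_ge[of a] F'_ge[of b] ab by (auto simp: u_def max_def algebra_simps)
    qed (use s in auto)
    finally show ?thesis .
  qed
  have genF: "integral {a..b} q \<le> s * (F' b - F' a)" if ab: "a \<le> b" for a b
  proof -
    consider "b \<le> m" | "m \<le> a" | "a \<le> m" "m \<le> b" by linarith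
    then show ?thesis
    proof cases
      case 3
      have "integral {a..b} q = integral {a..m} q + integral {m..b} q"
        by (rule Henstock_Kurzweil_Integration.integral_combine[OF 3 qi, symmetric])
      also have "\<dots> \<le> s * (F' m - F' a) + s * (F' b - F' m)" using left[of a m] right[of m b] 3 by simp
      finally show ?thesis by (simp add: algebra_simps)
    qed (use left right ab in auto)
  qed
  have q_eq: "q = (\<lambda>z. \<mu> * F' z + ((1 - \<epsilon>) * \<nu> - \<mu> * (k + \<epsilon>)) - h z)"
    by (simp add: q_def H_def \<theta>_def fun_eq_iff)
  have "0 \<le> M" using m mM by simp
  then show ?thesis
    using dF cF F'_bound F'M F_bound jump genF unfolding q_eq
    by (intro exI[of _ F] exI[of _ F'] exI[of _ A] exI[of _ M] exI[of _ "F M"]) auto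
qed

section \<open>Mollifying the potential\<close>

definition box_average :: "real \<Rightarrow> (real \<Rightarrow> real) \<Rightarrow> real \<Rightarrow> real" where
  "box_average \<eta> g z = integral {-\<eta>..\<eta>} (\<lambda>r. g (z + r)) / (2 * \<eta>)"

context
  fixes \<eta> :: real
  assumes eta: "\<eta> > 0"
begin

lemma box_integrable:
  fixes g :: "real \<Rightarrow> real"
  assumes "continuous_on UNIV g"
  shows "(\<lambda>r. g (z + r)) integrable_on {-\<eta>..\<eta>}"
proof (rule integrable_continuous_real)
  show "continuous_on {-\<eta>..\<eta>} (\<lambda>r. g (z + r))"
    by (rule continuous_on_compose2[OF assms]) (auto intro!: continuous_intros)
qed

lemma box_average_antiderivative:
  assumes G: "\<And>x. (G has_real_derivative g x) (at x)"
  shows "box_average \<eta> g z = (G (z + \<eta>) - G (z - \<eta>)) / (2 * \<eta>)"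
proof -
  have "((\<lambda>r. G (z + r)) has_real_derivative g (z + r)) (at r)" for r
    using G[of "r + z"] DERIV_shift[of G "g (r + z)" r z] by (simp add: add.commute)
  then have "((\<lambda>r. g (z + r)) has_integral (G (z + \<eta>) - G (z + - \<eta>))) {-\<eta>..\<eta>}"
    using eta by (intro fundamental_theorem_of_calculus)
      (auto simp: has_real_derivative_iff_has_vector_derivative[symmetric] intro: has_field_derivative_at_within)
  then show ?thesis by (simp add: box_average_def integral_unique)
qed

lemma box_average_integral:
  assumes "continuous_on UNIV g"
  shows "box_average \<eta> g z = integral {z - \<eta>..z + \<eta>} g / (2 * \<eta>)"
proof -
  obtain G where G: "\<And>x. (G has_real_derivative g x) (at x)"
    using continuous_has_antiderivative[OF assms] by blast
  have "(g has_integral (G (z + \<eta>) - G (z - \<eta>))) {z - \<eta>..z + \<eta>}"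
    using eta G by (intro fundamental_theorem_of_calculus)
      (auto simp: has_real_derivative_iff_has_vector_derivative[symmetric] intro: has_field_derivative_at_within)
  then show ?thesis by (simp add: box_average_antiderivative[OF G] integral_unique)
qed

lemma box_average_has_derivative:
  assumes "continuous_on UNIV g"
  shows "(box_average \<eta> g has_real_derivative (g (z + \<eta>) - g (z - \<eta>)) / (2 * \<eta>)) (at z)"
proof -
  obtain G where G: "\<And>x. (G has_real_derivative g x) (at x)"
    using continuous_has_antiderivative[OF assms] by blast
  have eq: "box_average \<eta> g = (\<lambda>z. (G (z + \<eta>) - G (z - \<eta>)) / (2 * \<eta>))"
    using box_average_antiderivative[OF G] by (simp add: fun_eq_iff)
  have p: "((\<lambda>z. G (z + \<eta>)) has_real_derivative g (z + \<eta>)) (at z)"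
    using G[of "z + \<eta>"] DERIV_shift[of G "g (z + \<eta>)" z \<eta>] by simp
  have m: "((\<lambda>z. G (z - \<eta>)) has_real_derivative g (z - \<eta>)) (at z)"
    using G[of "z - \<eta>"] DERIV_shift[of G "g (z - \<eta>)" z "- \<eta>"] by simp
  show ?thesis unfolding eq by (intro DERIV_cdivide DERIV_diff p m)
qed

lemma continuous_on_box_average: "continuous_on UNIV g \<Longrightarrow> continuous_on UNIV (box_average \<eta> g)"
  using box_average_has_derivative by (meson DERIV_isCont continuous_at_imp_continuous_on)

lemma box_average_derivative_commute:
  assumes G: "\<And>x. (G has_real_derivative g x) (at x)"
  shows "(box_average \<eta> G has_real_derivative box_average \<eta> g z) (at z)"
proof -
  have "continuous_on UNIV G" using G by (meson DERIV_isCont continuous_at_imp_continuous_on)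
  from box_average_has_derivative[OF this] show ?thesis
    unfolding box_average_antiderivative[OF G] .
qed

text \<open>Separate base points and the constant \<open>c\<close> allow comparison at translated
  arguments, which is how the jump condition passes through the average.\<close>

lemma box_average_mono:
  assumes "continuous_on UNIV f" "continuous_on UNIV g"
    and "\<And>r. \<bar>r\<bar> \<le> \<eta> \<Longrightarrow> f (x + r) \<le> g (y + r) + c"
  shows "box_average \<eta> f x \<le> box_average \<eta> g y + c"
proof -
  have "integral {-\<eta>..\<eta>} (\<lambda>r. f (x + r)) \<le> integral {-\<eta>..\<eta>} (\<lambda>r. g (y + r) + c)"
    using assms(3) by (intro integral_le integrable_add box_integrable assms integrable_const_ivl) auto
  also have "\<dots> = integral {-\<eta>..\<eta>} (\<lambda>r. g (y + r)) + 2 * \<eta> * c"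
    using eta by (subst Henstock_Kurzweil_Integration.integral_add[OF box_integrable[OF assms(2)]]) auto
  finally have "integral {-\<eta>..\<eta>} (\<lambda>r. f (x + r)) / (2 * \<eta>) \<le> (integral {-\<eta>..\<eta>} (\<lambda>r. g (y + r)) + 2 * \<eta> * c) / (2 * \<eta>)"
    using eta by (intro divide_right_mono) auto
  then show ?thesis using eta by (simp add: box_average_def add_divide_distrib)
qed

lemma box_average_const: "box_average \<eta> (\<lambda>_. c) z = c"
  using eta by (simp add: box_average_def)

lemma box_average_le:
  assumes "continuous_on UNIV f" and "\<And>r. \<bar>r\<bar> \<le> \<eta> \<Longrightarrow> f (x + r) \<le> c"
  shows "box_average \<eta> f x \<le> c"
  using box_average_mono[of f "\<lambda>_. 0" x x c] assms by (simp add: box_average_const)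

lemma box_average_ge:
  assumes "continuous_on UNIV f" and "\<And>r. \<bar>r\<bar> \<le> \<eta> \<Longrightarrow> f (x + r) \<ge> c"
  shows "box_average \<eta> f x \<ge> c"
  using box_average_mono[of "\<lambda>_. c" f x x 0] assms by (simp add: box_average_const)

lemma box_average_abs_le:
  assumes "continuous_on UNIV f" and "\<And>r. \<bar>r\<bar> \<le> \<eta> \<Longrightarrow> \<bar>f (x + r)\<bar> \<le> c"
  shows "\<bar>box_average \<eta> f x\<bar> \<le> c"
proof -
  have "box_average \<eta> f x \<le> c" using assms by (intro box_average_le) (auto simp: abs_le_iff)
  moreover have "box_average \<eta> f x \<ge> - c"
    using assms by (intro box_average_ge) (auto simp: abs_le_iff minus_le_iff)
  ultimately show ?thesis by (auto simp: abs_le_iff)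
qed

lemma box_average_generator:
  assumes "continuous_on UNIV f" "continuous_on UNIV h"
  shows "box_average \<eta> (\<lambda>z. a * f z + b - h z) x = a * box_average \<eta> f x + b - box_average \<eta> h x"
proof -
  have "((\<lambda>r. a * f (x + r) + b - h (x + r)) has_integral
      a * integral {-\<eta>..\<eta>} (\<lambda>r. f (x + r)) + 2 * \<eta> * b - integral {-\<eta>..\<eta>} (\<lambda>r. h (x + r))) {-\<eta>..\<eta>}"
    using has_integral_const_real[of b "-\<eta>" \<eta>] eta
    by (intro has_integral_diff has_integral_add has_integral_mult_right integrable_integral box_integrable assms) auto
  then show ?thesis
    using eta unfolding box_average_def by (simp add: integral_unique add_divide_distrib diff_divide_distrib)
qed

end

text \<open>One average makes the second derivative continuous, a difference quotient of
  \<open>F'\<close>; the second makes it Lipschitz, as the cubic Taylor remainder demands. The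
  inequality on intervals of length \<open>2 * \<eta>\<close> becomes pointwise with the first
  average. The twice averaged \<open>h\<close> sees arguments within \<open>2 * \<eta>\<close> of
  \<open>z\<close>, where \<open>h_max\<close> bounds it by the values at the ends.\<close>

lemma mollified_potential:
  fixes F F' h K :: "real \<Rightarrow> real"
  assumes s: "s > 0" and eta: "\<eta> > 0"
    and der: "\<And>z. (F has_real_derivative F' z) (at z)" and cont: "continuous_on UNIV F'"
    and h: "continuous_on UNIV h" and h_max: "\<And>x y z. x \<le> y \<Longrightarrow> y \<le> z \<Longrightarrow> h y \<le> max (h x) (h z)"
    and A: "\<And>z. \<bar>F' z\<bar> \<le> A" and M: "\<And>z. z \<ge> M \<Longrightarrow> F' z = 0"
    and c: "\<And>z. F' z \<ge> - c"
    and jump: "\<And>z1 z2. z1 > z2 \<Longrightarrow> F z1 - F z2 \<ge> - K (z1 - z2)"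
    and gen: "\<And>a b. a \<le> b \<Longrightarrow> integral {a..b} (\<lambda>z. \<mu> * F' z + \<nu> - h z) \<le> s * (F' b - F' a)"
  shows "\<exists>G G' G'' L1 L2. (\<forall>z. (G has_real_derivative G' z) (at z)) \<and> (\<forall>z. (G' has_real_derivative G'' z) (at z)) \<and>
    (\<forall>x y. \<bar>G'' x - G'' y\<bar> \<le> L2 * \<bar>x - y\<bar>) \<and> (\<forall>z. \<bar>G'' z\<bar> \<le> L1) \<and> (\<forall>z. \<bar>G' z\<bar> \<le> A) \<and> (\<forall>z. G' z \<ge> - c) \<and>
    (\<forall>z1 z2. z1 > z2 \<longrightarrow> G z1 - G z2 \<ge> - K (z1 - z2)) \<and>
    (\<forall>z. s * G'' z - \<mu> * G' z \<ge> \<nu> - max (h (z - 2 * \<eta>)) (h (z + 2 * \<eta>))) \<and>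
    (\<forall>z\<ge>M + 2 * \<eta>. G' z = 0 \<and> G'' z = 0) \<and> (\<forall>z. \<bar>G z - F z\<bar> \<le> 2 * \<eta> * A)"
proof -
  let ?T = "box_average \<eta>"
  note cT = continuous_on_box_average[OF eta]
  have cF: "continuous_on UNIV F" using der by (meson DERIV_isCont continuous_at_imp_continuous_on)
  have A0: "A \<ge> 0" using A[of 0] by linarith
  define G1 where "G1 z = (F' (z + \<eta>) - F' (z - \<eta>)) / (2 * \<eta>)" for z
  have G1: "(?T F' has_real_derivative G1 z) (at z)" for z
    unfolding G1_def by (rule box_average_has_derivative[OF eta cont])
  have cG1: "continuous_on UNIV G1"
    unfolding G1_def using eta
    by (intro continuous_intros continuous_on_compose2[OF cont]) auto
  have G1_bound: "\<bar>G1 z\<bar> \<le> A / \<eta>" for z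
  proof -
    have "\<bar>F' (z + \<eta>) - F' (z - \<eta>)\<bar> \<le> 2 * A" using A[of "z + \<eta>"] A[of "z - \<eta>"] by linarith
    then show ?thesis using eta by (simp add: G1_def field_simps)
  qed
  have d0: "(?T (?T F) has_real_derivative ?T (?T F') z) (at z)" for z
    by (intro box_average_derivative_commute[OF eta] der)
  have d1: "(?T (?T F') has_real_derivative ?T G1 z) (at z)" for z
    by (intro box_average_derivative_commute[OF eta] G1)
  have lip: "\<bar>?T G1 x - ?T G1 y\<bar> \<le> (A / \<eta> / \<eta>) * \<bar>x - y\<bar>" for x y
  proof -
    have "norm (?T G1 x - ?T G1 y) \<le> (A / \<eta> / \<eta>) * norm (x - y)"
    proof (rule field_differentiable_bound[of UNIV])
      show "(?T G1 has_field_derivative (G1 (z + \<eta>) - G1 (z - \<eta>)) / (2 * \<eta>)) (at z within UNIV)" for z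
        using box_average_has_derivative[OF eta cG1] by simp
      fix z
      have "\<bar>G1 (z + \<eta>) - G1 (z - \<eta>)\<bar> \<le> 2 * (A / \<eta>)"
        using G1_bound[of "z + \<eta>"] G1_bound[of "z - \<eta>"] by linarith
      then show "norm ((G1 (z + \<eta>) - G1 (z - \<eta>)) / (2 * \<eta>)) \<le> A / \<eta> / \<eta>"
        using eta by (simp add: field_simps)
    qed auto
    then show ?thesis by simp
  qed
  have b2: "\<bar>?T G1 z\<bar> \<le> A / \<eta>" for z using G1_bound by (intro box_average_abs_le[OF eta cG1])
  have b1: "\<bar>?T (?T F') z\<bar> \<le> A" for z
    using A by (intro box_average_abs_le[OF eta] cT cont)
  have lower: "?T (?T F') z \<ge> - c" for z
    using c by (intro box_average_ge[OF eta] cT cont)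
  have jmp: "?T (?T F) z1 - ?T (?T F) z2 \<ge> - K (z1 - z2)" if z: "z1 > z2" for z1 z2
  proof -
    have "?T F (z2 + r) \<le> ?T F (z1 + r) + K (z1 - z2)" for r
    proof (rule box_average_mono[OF eta cF cF])
      fix r' show "F (z2 + r + r') \<le> F (z1 + r + r') + K (z1 - z2)"
        using jump[of "z2 + r + r'" "z1 + r + r'"] z by simp
    qed
    then have "?T (?T F) z2 \<le> ?T (?T F) z1 + K (z1 - z2)"
      by (rule box_average_mono[OF eta cT[OF cF] cT[OF cF]])
    then show ?thesis by simp
  qed
  let ?q = "\<lambda>z. \<mu> * F' z + \<nu> - h z"
  have cq: "continuous_on UNIV ?q" by (intro continuous_intros cont h)
  have g1: "?T ?q z \<le> s * G1 z" for z
  proof -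
    have "?T ?q z = integral {z - \<eta>..z + \<eta>} ?q / (2 * \<eta>)" by (rule box_average_integral[OF eta cq])
    also have "\<dots> \<le> s * (F' (z + \<eta>) - F' (z - \<eta>)) / (2 * \<eta>)"
      using eta by (intro divide_right_mono gen) auto
    finally show ?thesis by (simp add: G1_def)
  qed
  have gen2: "s * ?T G1 z - \<mu> * ?T (?T F') z \<ge> \<nu> - max (h (z - 2 * \<eta>)) (h (z + 2 * \<eta>))" for z
  proof -
    have "?T (?T ?q) z \<le> ?T (\<lambda>z. s * G1 z + 0 - 0) z"
      using box_average_mono[OF eta, of "?T ?q" "\<lambda>z. s * G1 z + 0 - 0" z z 0] g1
      by (simp add: cT[OF cq] continuous_on_mult[OF continuous_on_const cG1])
    also have "\<dots> = s * ?T G1 z"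
      by (subst box_average_generator[OF eta cG1]) (simp_all add: box_average_const[OF eta])
    finally have 1: "?T (?T ?q) z \<le> s * ?T G1 z" .
    have "?T ?q = (\<lambda>z. \<mu> * ?T F' z + \<nu> - ?T h z)"
      using box_average_generator[OF eta cont h] by (simp add: fun_eq_iff)
    then have 2: "?T (?T ?q) z = \<mu> * ?T (?T F') z + \<nu> - ?T (?T h) z"
      using box_average_generator[OF eta cT[OF cont] cT[OF h]] by simp
    have "?T (?T h) z \<le> max (h (z - 2 * \<eta>)) (h (z + 2 * \<eta>))"
    proof (intro box_average_le[OF eta] cT h)
      fix r r' assume "\<bar>r\<bar> \<le> \<eta>" "\<bar>r'\<bar> \<le> \<eta>"
      then show "h (z + r + r') \<le> max (h (z - 2 * \<eta>)) (h (z + 2 * \<eta>))"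
        by (intro h_max) auto
    qed
    with 1 2 show ?thesis by simp
  qed
  have zero: "?T (?T F') z = 0 \<and> ?T G1 z = 0" if z: "z \<ge> M + 2 * \<eta>" for z
  proof -
    have "F' (z + r + r') = 0" if "\<bar>r\<bar> \<le> \<eta>" "\<bar>r'\<bar> \<le> \<eta>" for r r'
      using that z by (intro M) auto
    then have "\<bar>?T F' (z + r)\<bar> \<le> 0" if "\<bar>r\<bar> \<le> \<eta>" for r
      using that by (intro box_average_abs_le[OF eta cont]) auto
    then have "\<bar>?T (?T F') z\<bar> \<le> 0" by (rule box_average_abs_le[OF eta cT[OF cont]])
    moreover have "\<bar>?T G1 z\<bar> \<le> 0"
    proof (intro box_average_abs_le[OF eta cG1])
      fix r assume "\<bar>r\<bar> \<le> \<eta>"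
      then have "F' (z + r + \<eta>) = 0" "F' (z + r - \<eta>) = 0" using z eta by (auto intro!: M)
      then show "\<bar>G1 (z + r)\<bar> \<le> 0" by (simp add: G1_def)
    qed
    ultimately show ?thesis by simp
  qed
  have lipF: "\<bar>F x - F y\<bar> \<le> A * \<bar>x - y\<bar>" for x y
    using field_differentiable_bound[of UNIV F F' A x y] der A by auto
  have near: "\<bar>?T (?T F) z - F z\<bar> \<le> 2 * \<eta> * A" for z
  proof -
    have b: "\<bar>F (z + r + r') - F z\<bar> \<le> 2 * \<eta> * A" if "\<bar>r\<bar> \<le> \<eta>" "\<bar>r'\<bar> \<le> \<eta>" for r r'
    proof -
      have "\<bar>F (z + r + r') - F z\<bar> \<le> A * \<bar>r + r'\<bar>" using lipF[of "z + r + r'" z] by (simp add: add.assoc)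
      also have "\<dots> \<le> A * (2 * \<eta>)" using that A0 by (intro mult_left_mono) auto
      finally show ?thesis by (simp add: algebra_simps)
    qed
    have "?T (?T F) z \<le> F z + 2 * \<eta> * A"
      using b by (intro box_average_le[OF eta] cT cF) (smt (verit))
    moreover have "?T (?T F) z \<ge> F z - 2 * \<eta> * A"
      using b by (intro box_average_ge[OF eta] cT cF) (smt (verit))
    ultimately show ?thesis by linarith
  qed
  show ?thesis
    using d0 d1 lip b2 b1 lower jmp gen2 zero near
    by (intro exI[of _ "?T (?T F)"] exI[of _ "?T (?T F')"] exI[of _ "?T G1"] exI[of _ "A / \<eta>"] exI[of _ "A / \<eta> / \<eta>"]) auto
qed

section \<open>Jumps along a path\<close>

text \<open>\<open>i\<close> is the index of the grid cell containing \<open>u\<close>. Cells are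
  open on the left, so the left grid point lies strictly before \<open>u\<close> and left limits
  appear; counting cells from zero explains the subtraction of 1.\<close>

lemma grid_indices:
  fixes t u :: real and n :: nat
  assumes "t > 0" "0 < u" "u \<le> t" "n > 0"
  defines "i \<equiv> nat (\<lceil>u * n / t\<rceil> - 1)"
  shows "i < n" "t * i / n < u" "u \<le> t * Suc i / n" "u - t / n \<le> t * i / n" "t * Suc i / n \<le> u + t / n"
proof -
  let ?c = "\<lceil>u * n / t\<rceil>"
  have "0 < u * n / t" using assms by simp
  then have c1: "?c \<ge> 1" by linarith
  have "u * n / t \<le> t * n / t" using assms by (intro divide_right_mono mult_right_mono) auto
  then have "u * n / t \<le> real n" using assms by simp
  then have cn: "?c \<le> int n" by (simp add: ceiling_le_iff)
  have ri: "real i = of_int ?c - 1" using c1 by (simp add: i_def)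
  then show "i < n" using cn by linarith
  have lo: "of_int ?c - 1 < u * n / t" and hi: "u * n / t \<le> of_int ?c"
    by linarith+
  have tn: "t / n > 0" using assms by simp
  have ex: "(u * n / t) * (t / n) = u" using assms by simp
  have "real i * (t / n) < (u * n / t) * (t / n)" using lo ri tn by (intro mult_strict_right_mono) auto
  then show a: "t * i / n < u" unfolding ex by (simp add: mult.commute)
  have "(u * n / t) * (t / n) \<le> real (Suc i) * (t / n)" using hi ri tn by (intro mult_right_mono) auto
  then show b: "u \<le> t * Suc i / n" unfolding ex by (simp add: mult.commute)
  have st: "t * Suc i / n = t * i / n + t / n" by (simp add: field_simps add_divide_distrib)
  show "u - t / n \<le> t * i / n" using b unfolding st by linarith
  show "t * Suc i / n \<le> u + t / n" using a unfolding st by linarith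
qed

text \<open>Negative reals are sent to 0, so splitting a sum can only increase the result, whatever
  the signs.\<close>

lemma ennreal_add_le_add: "ennreal (a + b) \<le> ennreal a + ennreal b"
proof (cases "0 \<le> a \<and> 0 \<le> b")
  case True
  then show ?thesis by (simp add: ennreal_plus)
next
  case False
  then have "a + b \<le> a \<or> a + b \<le> b" by auto
  then show ?thesis
  proof
    assume "a + b \<le> a"
    then have "ennreal (a + b) \<le> ennreal a" by (rule ennreal_leI)
    then show ?thesis by (simp add: add_increasing2)
  next
    assume "a + b \<le> b"
    then have "ennreal (a + b) \<le> ennreal b" by (rule ennreal_leI)
    then show ?thesis by (simp add: add_increasing)
  qed
qed

lemma left_value_tendsto:
  fixes y :: "real \<Rightarrow> real"
  assumes "\<exists>l. (y \<longlongrightarrow> l) (at_left u)" "u > 0"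
  shows "(y \<longlongrightarrow> left_value y u) (at_left u)"
  using assms by (auto simp: left_value_def tendsto_Lim trivial_limit_at_left_real)

text \<open>
  Within a grid step the uncontrolled path \<open>X\<close> moves first, so that the increment of \<open>G\<close> recorded here is
  the one caused by \<open>y\<close> alone.
\<close>

definition grid_increment ::
    "(real \<Rightarrow> real) \<Rightarrow> (real \<Rightarrow> real) \<Rightarrow> (real \<Rightarrow> real) \<Rightarrow> real \<Rightarrow> nat \<Rightarrow> nat \<Rightarrow> real" where
  "grid_increment G X y t n i =
     G (X (t * Suc i / n) + y (t * Suc i / n)) - G (X (t * Suc i / n) + y (t * i / n))"

definition grid_sum ::
    "(real \<Rightarrow> real) \<Rightarrow> (real \<Rightarrow> real) \<Rightarrow> (real \<Rightarrow> real) \<Rightarrow> real \<Rightarrow> nat \<Rightarrow> real" where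
  "grid_sum G X y t n = (G (X 0 + y 0) - G (X 0)) + (\<Sum>i<n. grid_increment G X y t n i)"

section \<open>Lower limit of the grid sums along one path\<close>

context
  fixes y X G K :: "real \<Rightarrow> real" and t c :: real
  assumes t: "t > 0" and c: "c \<ge> 0"
    and y_mono: "mono_on {0..} y" and y_nonneg: "\<And>s. s \<ge> 0 \<Longrightarrow> y s \<ge> 0"
    and y_right: "\<And>s. s \<ge> 0 \<Longrightarrow> continuous (at_right s) y"
    and y_left: "\<And>s. s > 0 \<Longrightarrow> \<exists>l. (y \<longlongrightarrow> l) (at_left s)"
    and X_cont: "continuous_on {0..} X"
    and G_cont: "continuous_on UNIV G" and G_mono: "\<And>a b. a \<le> b \<Longrightarrow> G a \<le> G b"
    and G_jump: "\<And>a b. a < b \<Longrightarrow> G b - G a \<ge> c * (b - a) - K (b - a)"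
    and K0: "K 0 = 0" and K_nonneg: "\<And>\<xi>. \<xi> \<ge> 0 \<Longrightarrow> K \<xi> \<ge> 0"
begin

lemma grid_increment_nonneg: "0 \<le> grid_increment G X y t n i"
proof -
  have "y (t * i / n) \<le> y (t * Suc i / n)"
    using t by (intro mono_onD[OF y_mono]) (auto intro!: divide_right_mono)
  then show ?thesis unfolding grid_increment_def by (auto intro!: G_mono)
qed

lemma grid_sum_nonneg: "0 \<le> grid_sum G X y t n"
  unfolding grid_sum_def using grid_increment_nonneg y_nonneg[of 0]
  by (auto intro!: add_nonneg_nonneg sum_nonneg G_mono)

lemma left_value_le: "u > 0 \<Longrightarrow> left_value y u \<le> y u"
proof -
  assume u: "u > 0"
  have "\<forall>\<^sub>F s in at_left u. y s \<le> y u"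
    using eventually_at_left_real[OF u] by eventually_elim (use u in \<open>auto intro!: mono_onD[OF y_mono]\<close>)
  then show ?thesis
    using left_value_tendsto[OF y_left[OF u] u] by (intro tendsto_upperbound) auto
qed

lemma jump_nonneg: "u \<ge> 0 \<Longrightarrow> jump y u \<ge> 0"
  using left_value_le[of u] y_nonneg[of 0] by (cases "u = 0") (auto simp: jump_def left_value_def)

text \<open>The cell containing \<open>u\<close> shrinks to \<open>u\<close>, its left end strictly
  before \<open>u\<close> and its right end not before \<open>u\<close>. So \<open>y\<close>
  contributes its left limit at one end and, by right continuity, its value at the other, while
  \<open>X\<close> is continuous.\<close>

lemma grid_increment_limit:
  assumes u: "0 < u" "u \<le> t"
  shows "(\<lambda>n. grid_increment G X y t n (nat (\<lceil>u * n / t\<rceil> - 1)))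
    \<longlonglongrightarrow> G (X u + y u) - G (X u + left_value y u)"
proof -
  define i where "i n = nat (\<lceil>u * real n / t\<rceil> - 1)" for n :: nat
  define l where "l n = t * real (i n) / real n" for n :: nat
  define r where "r n = t * real (Suc (i n)) / real n" for n :: nat
  have ev: "\<forall>\<^sub>F n in sequentially. l n < u \<and> u \<le> r n \<and> u - t / n \<le> l n \<and> r n \<le> u + t / n"
    using eventually_gt_at_top[of 0]
    by eventually_elim (use grid_indices[OF t u] in \<open>auto simp: l_def r_def i_def\<close>)
  have tn: "(\<lambda>n. t / real n) \<longlonglongrightarrow> 0" by (rule lim_const_over_n)
  have "l \<longlonglongrightarrow> u"
  proof (rule tendsto_sandwich)
    show "\<forall>\<^sub>F n in sequentially. u - t / n \<le> l n" "\<forall>\<^sub>F n in sequentially. l n \<le> u"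
      using ev by (auto elim: eventually_mono)
    show "(\<lambda>n. u - t / n) \<longlonglongrightarrow> u" using tendsto_diff[OF tendsto_const tn] by simp
  qed auto
  then have l: "filterlim l (at_left u) sequentially"
    using ev by (intro tendsto_imp_filterlim_at_left) (auto elim: eventually_mono)
  have r: "r \<longlonglongrightarrow> u"
  proof (rule tendsto_sandwich)
    show "\<forall>\<^sub>F n in sequentially. u \<le> r n" "\<forall>\<^sub>F n in sequentially. r n \<le> u + t / n"
      using ev by (auto elim: eventually_mono)
    show "(\<lambda>n. u + t / n) \<longlonglongrightarrow> u" using tendsto_add[OF tendsto_const tn] by simp
  qed auto
  have yl: "(\<lambda>n. y (l n)) \<longlonglongrightarrow> left_value y u"
    by (rule filterlim_compose[OF left_value_tendsto[OF y_left] l]) (use u in auto)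
  have yr: "(\<lambda>n. y (r n)) \<longlonglongrightarrow> y u"
  proof -
    have "continuous (at u within {u..}) y"
      using y_right[of u] u by (simp add: continuous_within at_within_Ici_at_right)
    then show ?thesis
      by (rule continuous_within_tendsto_compose) (use ev r in \<open>auto elim: eventually_mono\<close>)
  qed
  have Xr: "(\<lambda>n. X (r n)) \<longlonglongrightarrow> X u"
  proof (rule continuous_on_tendsto_compose[OF X_cont r])
    show "\<forall>\<^sub>F n in sequentially. r n \<in> {0..}" using ev u by (auto elim: eventually_mono)
  qed (use u in auto)
  have Gc: "isCont G x" for x using G_cont by (simp add: continuous_on_eq_continuous_at)
  have "(\<lambda>n. G (X (r n) + y (r n)) - G (X (r n) + y (l n))) \<longlonglongrightarrow> G (X u + y u) - G (X u + left_value y u)"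
    by (intro tendsto_diff isCont_tendsto_compose[OF Gc] tendsto_add Xr yr yl)
  then show ?thesis by (simp add: grid_increment_def l_def r_def i_def)
qed

text \<open>Once the mesh is finer than the gaps between the points of \<open>J\<close>, these lie
  in different cells and their increments are different summands; all others are nonnegative and are
  dropped. A jump at time 0 is accounted for by the initial term of the grid sum.\<close>

lemma grid_sum_eventually_ge:
  assumes J: "finite J" "J \<subseteq> {0..t}" and e: "e > 0"
  shows "\<forall>\<^sub>F n in sequentially. (\<Sum>u\<in>J. c * jump y u - K (jump y u)) - e \<le> grid_sum G X y t n"
proof -
  let ?g = "\<lambda>u. c * jump y u - K (jump y u)"
  let ?i = "\<lambda>n u. nat (\<lceil>u * real n / t\<rceil> - 1)"
  let ?J = "J - {0}"
  have J': "finite ?J" "\<And>u. u \<in> ?J \<Longrightarrow> 0 < u \<and> u \<le> t" using J by force+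
  have lim: "(\<lambda>n. \<Sum>u\<in>?J. grid_increment G X y t n (?i n u)) \<longlonglongrightarrow>
      (\<Sum>u\<in>?J. G (X u + y u) - G (X u + left_value y u))"
    using J'(2) by (intro tendsto_sum grid_increment_limit) auto
  have gj: "?g u \<le> G (x + y u) - G (x + left_value y u)" if "u \<ge> 0" for u x
  proof (cases "jump y u = 0")
    case True
    then show ?thesis using K0 by (simp add: jump_def)
  next
    case False
    with jump_nonneg[OF that] have "x + left_value y u < x + y u" by (simp add: jump_def)
    from G_jump[OF this] show ?thesis by (simp add: jump_def)
  qed
  have "(\<Sum>u\<in>?J. ?g u) - e < (\<Sum>u\<in>?J. G (X u + y u) - G (X u + left_value y u))"
    using sum_mono[of ?J ?g "\<lambda>u. G (X u + y u) - G (X u + left_value y u)"] gj J'(2) e by fastforce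
  from order_tendstoD(1)[OF lim this]
  have ev1: "\<forall>\<^sub>F n in sequentially. (\<Sum>u\<in>?J. ?g u) - e < (\<Sum>u\<in>?J. grid_increment G X y t n (?i n u))" .
  have "\<forall>\<^sub>F n in sequentially. \<forall>u\<in>?J. \<forall>v\<in>?J. u \<noteq> v \<longrightarrow> t / real n < \<bar>u - v\<bar>"
  proof (intro eventually_ball_finite J' ballI)
    fix u v
    show "\<forall>\<^sub>F n in sequentially. u \<noteq> v \<longrightarrow> t / real n < \<bar>u - v\<bar>"
    proof (cases "u = v")
      case False
      then have "0 < \<bar>u - v\<bar>" by simp
      from order_tendstoD(2)[OF lim_const_over_n[of t] this] show ?thesis
        by (auto elim: eventually_mono)
    qed simp
  qed
  with ev1 eventually_gt_at_top[of 0] show ?thesis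
  proof eventually_elim
    case (elim n)
    have inj: "inj_on (?i n) ?J"
    proof (rule inj_onI, rule ccontr)
      fix u v assume uv: "u \<in> ?J" "v \<in> ?J" "?i n u = ?i n v" "u \<noteq> v"
      have "t * ?i n u / n < u" "u \<le> t * ?i n u / n + t / n" "t * ?i n v / n < v" "v \<le> t * ?i n v / n + t / n"
        using grid_indices[OF t, of u n] grid_indices[OF t, of v n] J'(2)[OF uv(1)] J'(2)[OF uv(2)] elim(2)
        by auto
      then have "\<bar>u - v\<bar> \<le> t / n" using uv(3) by auto
      then show False using elim(3) uv by force
    qed
    have sub: "?i n ` ?J \<subseteq> {..<n}"
      using grid_indices(1)[OF t] J'(2) elim(2) by auto
    have "(\<Sum>u\<in>?J. grid_increment G X y t n (?i n u)) = (\<Sum>i\<in>?i n ` ?J. grid_increment G X y t n i)"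
      using sum.reindex[OF inj, of "grid_increment G X y t n"] by (simp add: o_def)
    also have "\<dots> \<le> (\<Sum>i<n. grid_increment G X y t n i)"
      by (intro sum_mono2 sub grid_increment_nonneg) auto
    finally have 1: "(\<Sum>u\<in>?J. grid_increment G X y t n (?i n u)) \<le> (\<Sum>i<n. grid_increment G X y t n i)" .
    have 2: "(\<Sum>u\<in>J. ?g u) \<le> (\<Sum>u\<in>?J. ?g u) + (G (X 0 + y 0) - G (X 0))"
    proof (cases "0 \<in> J")
      case True
      have "?g 0 \<le> G (X 0 + y 0) - G (X 0)" using gj[of 0 "X 0"] by (simp add: left_value_def)
      then show ?thesis using sum.remove[OF J(1) True, of ?g] by simp
    next
      case False
      have "0 \<le> G (X 0 + y 0) - G (X 0)" using y_nonneg[of 0] G_mono[of "X 0" "X 0 + y 0"] by simp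
      then show ?thesis using False by simp
    qed
    show ?case using 1 2 elim(1) unfolding grid_sum_def by linarith
  qed
qed

text \<open>
  If the jumps are not summable, then \<^const>\<open>infsum\<close> and hence the jump part of \<^const>\<open>continuous_part\<close> is
  \<open>0\<close> by convention; the inequality holds in this case too.
\<close>

lemma liminf_grid_sum_ge:
  "ennreal (c * y t) \<le> liminf (\<lambda>n. ennreal (grid_sum G X y t n))
      + ((\<Sum>\<^sub>\<infinity>u\<in>{0..t}. ennreal (K (jump y u))) + ennreal c * ennreal (continuous_part y t))"
  (is "_ \<le> ?L + (?K + _)")
proof (cases "jump y summable_on {0..t}")
  case False
  then have "continuous_part y t = y t" by (simp add: continuous_part_def infsum_not_exists)
  then have "ennreal (c * y t) = ennreal c * ennreal (continuous_part y t)"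
    using c by (simp add: ennreal_mult')
  then show ?thesis by (simp add: add_increasing)
next
  case True
  have small: "ennreal (c * y t) \<le> (?L + (?K + ennreal c * ennreal (continuous_part y t))) + ennreal e" if e: "e > 0" for e
  proof -
    \<comment> \<open>The tolerance is split into \<open>e'\<close> for the limit of the grid sums
      and \<open>c * e'\<close> for the jumps outside the finite set \<open>J\<close>.\<close>
    define e' where "e' = e / (1 + c)"
    have "e' * (1 + c) = e" using c by (simp add: e'_def)
    then have "e' + c * e' = e" by (simp only: algebra_simps)
    moreover have "e' > 0" using e c by (simp add: e'_def)
    ultimately have e': "e' > 0" "e' + c * e' = e" by auto
    have "(jump y has_sum infsum (jump y) {0..t}) {0..t}" using True by (rule has_sum_infsum)
    then have ev: "\<forall>\<^sub>F J in finite_subsets_at_top {0..t}. infsum (jump y) {0..t} - e' < sum (jump y) J"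
      unfolding has_sum_def by (rule order_tendstoD(1)) (use e' in simp)
    have "\<forall>\<^sub>F J in finite_subsets_at_top {0..t}. finite J \<and> J \<subseteq> {0..t}"
      by (rule eventually_finite_subsets_at_top_weakI) auto
    with ev have "\<forall>\<^sub>F J in finite_subsets_at_top {0..t}. infsum (jump y) {0..t} - e' < sum (jump y) J \<and> finite J \<and> J \<subseteq> {0..t}"
      by eventually_elim auto
    then obtain J where J: "infsum (jump y) {0..t} - e' < sum (jump y) J" "finite J" "J \<subseteq> {0..t}"
      using eventually_happens'[OF finite_subsets_at_top_neq_bot] by blast
    let ?S = "(\<Sum>u\<in>J. c * jump y u - K (jump y u)) - e'"
    have Kp: "K (jump y u) \<ge> 0" if "u \<in> J" for u using J(3) that by (intro K_nonneg jump_nonneg) auto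
    have L: "ennreal ?S \<le> ?L"
      using grid_sum_eventually_ge[OF J(2,3) e'(1)]
      by (intro Liminf_bounded) (auto elim!: eventually_mono intro: ennreal_leI)
    have "ennreal (\<Sum>u\<in>J. K (jump y u)) = (\<Sum>u\<in>J. ennreal (K (jump y u)))"
      using Kp by (simp add: sum_ennreal)
    also have "\<dots> \<le> ?K"
      using J(2,3) by (subst nonneg_infsum_complete) (auto intro!: SUP_upper)
    finally have Kle: "ennreal (\<Sum>u\<in>J. K (jump y u)) \<le> ?K" .
    have "c * infsum (jump y) {0..t} \<le> c * (sum (jump y) J + e')"
      using J(1) c by (intro mult_left_mono) auto
    then have "c * y t \<le> (c * continuous_part y t + (\<Sum>u\<in>J. K (jump y u))) + (?S + e)"
      unfolding continuous_part_def using e'(2)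
      by (simp add: algebra_simps sum_subtractf sum_distrib_left)
    then have "ennreal (c * y t) \<le> ennreal ((c * continuous_part y t + (\<Sum>u\<in>J. K (jump y u))) + (?S + e))"
      by (rule ennreal_leI)
    also have "\<dots> \<le> (ennreal (c * continuous_part y t) + ennreal (\<Sum>u\<in>J. K (jump y u))) + (ennreal ?S + ennreal e)"
      by (intro order_trans[OF ennreal_add_le_add] add_mono ennreal_add_le_add)
    also have "\<dots> \<le> (ennreal c * ennreal (continuous_part y t) + ?K) + (?L + ennreal e)"
      using Kle L c by (intro add_mono) (auto simp: ennreal_mult')
    finally show ?thesis by (simp add: ac_simps)
  qed
  show ?thesis by (rule ennreal_le_epsilon) (rule small)
qed

end

section \<open>The inventory process\<close>

definition grid_up :: "nat \<Rightarrow> real \<Rightarrow> real" where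
  "grid_up n u = of_int \<lceil>u * real (Suc n)\<rceil> / real (Suc n)"

lemma grid_up_ge: "u \<le> grid_up n u"
proof -
  have "u * real (Suc n) \<le> of_int \<lceil>u * real (Suc n)\<rceil>" by linarith
  then show ?thesis unfolding grid_up_def by (simp add: field_simps)
qed

lemma grid_up_tendsto: "(\<lambda>n. grid_up n u) \<longlonglongrightarrow> u"
proof (rule tendsto_sandwich)
  show "\<forall>\<^sub>F n in sequentially. u \<le> grid_up n u" by (simp add: grid_up_ge)
  have "grid_up n u \<le> u + 1 / real (Suc n)" for n
  proof -
    have "of_int \<lceil>u * real (Suc n)\<rceil> \<le> u * real (Suc n) + 1" by linarith
    then have "of_int \<lceil>u * real (Suc n)\<rceil> / real (Suc n) \<le> (u * real (Suc n) + 1) / real (Suc n)"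
      by (intro divide_right_mono) auto
    also have "\<dots> = u + 1 / real (Suc n)" by (simp add: add_divide_distrib)
    finally show ?thesis by (simp add: grid_up_def)
  qed
  then show "\<forall>\<^sub>F n in sequentially. grid_up n u \<le> u + 1 / real (Suc n)" by simp
  show "(\<lambda>n. u + 1 / real (Suc n)) \<longlonglongrightarrow> u"
    using tendsto_add[OF tendsto_const LIMSEQ_Suc[OF lim_const_over_n[of "1::real"]], of u] by simp
qed simp

text \<open>
  The paths of the inventory process are right-continuous only almost surely. This limit along grid
  points is jointly measurable in any case and agrees with \<open>V\<close> along right-continuous paths.
\<close>

definition right_version :: "(real \<Rightarrow> 'a \<Rightarrow> real) \<Rightarrow> real \<Rightarrow> 'a \<Rightarrow> real" where
  "right_version V u \<omega> = lim (\<lambda>n. V (max 0 (grid_up n u)) \<omega>)"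

text \<open>For fixed \<open>n\<close> the rounded time takes countably many values, and at each of
  them the process is a random variable; \<open>max 0\<close> keeps to times where measurability is
  known.\<close>

lemma measurable_right_version:
  assumes V: "\<And>s. s \<ge> 0 \<Longrightarrow> V s \<in> borel_measurable M"
  shows "(\<lambda>p. right_version V (fst p) (snd p)) \<in> borel_measurable (lborel \<Otimes>\<^sub>M M)"
  unfolding right_version_def
proof (rule borel_measurable_lim_metric)
  fix n :: nat
  have "(\<lambda>p. V (max 0 (of_int \<lceil>fst p * real (Suc n)\<rceil> / real (Suc n))) (snd p))
      \<in> borel_measurable (lborel \<Otimes>\<^sub>M M)"
  proof (rule measurable_compose_countable[where f = "\<lambda>i p. V (max 0 (of_int i / real (Suc n))) (snd p)"
        and g = "\<lambda>p. \<lceil>fst p * real (Suc n)\<rceil>"])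
    show "(\<lambda>p. V (max 0 (of_int i / real (Suc n))) (snd p)) \<in> borel_measurable (lborel \<Otimes>\<^sub>M M)" for i :: int
      by (rule measurable_compose[OF measurable_snd V]) simp
    show "(\<lambda>p. \<lceil>fst p * real (Suc n)\<rceil>) \<in> lborel \<Otimes>\<^sub>M M \<rightarrow>\<^sub>M count_space UNIV" by measurable
  qed
  then show "(\<lambda>p. V (max 0 (grid_up n (fst p))) (snd p)) \<in> borel_measurable (lborel \<Otimes>\<^sub>M M)"
    by (simp add: grid_up_def)
qed

lemma right_version_eq:
  assumes "u \<ge> 0" "continuous (at_right u) (\<lambda>s. V s \<omega>)"
  shows "right_version V u \<omega> = V u \<omega>"
proof -
  have "continuous (at u within {u..}) (\<lambda>s. V s \<omega>)"
    using assms(2) by (simp add: continuous_within at_within_Ici_at_right)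
  then have "(\<lambda>n. V (max 0 (grid_up n u)) \<omega>) \<longlonglongrightarrow> V u \<omega>"
  proof (rule continuous_within_tendsto_compose)
    show "\<forall>\<^sub>F n in sequentially. max 0 (grid_up n u) \<in> {u..}"
      using grid_up_ge[of u] by (simp add: le_max_iff_disj)
    show "(\<lambda>n. max 0 (grid_up n u)) \<longlonglongrightarrow> u"
      using tendsto_max[OF tendsto_const grid_up_tendsto[of u], of 0] assms(1) by (simp add: max_def)
  qed
  then show ?thesis unfolding right_version_def by (rule limI)
qed

text \<open>The Riemann sum is the integral of a step function that takes the value at the right end
  of each cell. These step functions converge at every \<open>u > 0\<close> in the interval by right
  continuity, and the bound \<open>C\<close> permits dominated convergence.\<close>

lemma right_continuous_riemann_sum:
  fixes \<phi> :: "real \<Rightarrow> real" and t C :: real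
  assumes t: "t > 0" and meas[measurable]: "\<phi> \<in> borel_measurable borel"
    and bound: "\<And>u. u \<ge> 0 \<Longrightarrow> \<bar>\<phi> u\<bar> \<le> C"
    and right: "\<And>u. u > 0 \<Longrightarrow> continuous (at_right u) \<phi>"
  shows "(\<lambda>n. \<Sum>i<n. t / n * \<phi> (t * Suc i / n)) \<longlonglongrightarrow> (LINT u:{0..t}|lborel. \<phi> u)"
proof -
  define \<psi> where "\<psi> n u = (\<Sum>i<n. \<phi> (t * Suc i / n) * indicator {t * i / n<..t * Suc i / n} u)" for n :: nat and u
  have int: "(LINT u|lborel. \<psi> n u) = (\<Sum>i<n. t / n * \<phi> (t * Suc i / n))" for n
  proof -
    have le: "t * real i / n \<le> t * Suc i / n" for i
      using t by (intro divide_right_mono mult_left_mono) auto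
    have "(LINT u|lborel. \<psi> n u) = (\<Sum>i<n. LINT u|lborel. \<phi> (t * Suc i / n) * indicator {t * i / n<..t * Suc i / n} u)"
      unfolding \<psi>_def using le
      by (intro Bochner_Integration.integral_sum integrable_mult_right integrable_real_indicator) auto
    also have "\<dots> = (\<Sum>i<n. t / n * \<phi> (t * Suc i / n))"
    proof (rule sum.cong[OF refl])
      fix i assume "i \<in> {..<n}"
      have "t * Suc i / n - t * real i / n = t / n" by (simp add: field_simps add_divide_distrib)
      then have "measure lborel {t * real i / n<..t * Suc i / n} = t / n"
        using le[of i] by (simp add: measure_def)
      then show "(LINT u|lborel. \<phi> (t * Suc i / n) * indicator {t * i / n<..t * Suc i / n} u) = t / n * \<phi> (t * Suc i / n)"
        by simp
    qed
    finally show ?thesis .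
  qed
  have out: "\<psi> n u = 0" if u: "u \<le> 0 \<or> u > t" for n u
    unfolding \<psi>_def
  proof (rule sum.neutral, rule ballI)
    fix i assume i: "i \<in> {..<n}"
    have "t * Suc i \<le> t * n" using i t by (intro mult_left_mono) auto
    then have "t * Suc i / n \<le> t" using i by (simp add: divide_le_eq)
    moreover have "0 \<le> t * real i / n" using t by simp
    ultimately show "\<phi> (t * Suc i / n) * indicator {t * i / n<..t * Suc i / n} u = 0"
      using u by (auto simp: indicator_def)
  qed
  have ins: "\<psi> n u = \<phi> (t * Suc (nat (\<lceil>u * n / t\<rceil> - 1)) / n)" if u: "0 < u" "u \<le> t" and n: "n > 0" for n :: nat and u
  proof -
    let ?i = "nat (\<lceil>u * n / t\<rceil> - 1)"
    note g = grid_indices[OF t u n]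
    have "\<psi> n u = (\<Sum>i\<in>{?i}. \<phi> (t * Suc i / n) * indicator {t * i / n<..t * Suc i / n} u)"
      unfolding \<psi>_def
    proof (rule sum.mono_neutral_right)
      show "{?i} \<subseteq> {..<n}" using g(1) by simp
      show "\<forall>i\<in>{..<n} - {?i}. \<phi> (t * Suc i / n) * indicator {t * i / n<..t * Suc i / n} u = 0"
      proof
        fix i assume "i \<in> {..<n} - {?i}"
        then have "i < ?i \<or> ?i < i" by auto
        then show "\<phi> (t * Suc i / n) * indicator {t * i / n<..t * Suc i / n} u = 0"
        proof
          assume "i < ?i"
          then have "t * Suc i / n \<le> t * ?i / n" using t by (intro divide_right_mono mult_left_mono) auto
          then have "u \<notin> {t * i / n<..t * Suc i / n}" using g(2) by auto
          then show ?thesis by simp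
        next
          assume "?i < i"
          then have "t * Suc ?i / n \<le> t * i / n" using t by (intro divide_right_mono mult_left_mono) auto
          then have "u \<notin> {t * i / n<..t * Suc i / n}" using g(3) by auto
          then show ?thesis by simp
        qed
      qed
    qed simp
    also have "\<dots> = \<phi> (t * Suc ?i / n)" using g(2,3) by simp
    finally show ?thesis .
  qed
  have "(\<lambda>n. LINT u|lborel. \<psi> n u) \<longlonglongrightarrow> (LINT u|lborel. indicator {0..t} u * \<phi> u)"
  proof (rule integral_dominated_convergence[where w = "\<lambda>u. C * indicator {0..t} u"])
    show "(\<lambda>u. indicator {0..t} u * \<phi> u) \<in> borel_measurable lborel" by measurable
    show "\<psi> n \<in> borel_measurable lborel" for n unfolding \<psi>_def by measurable
    show "integrable lborel (\<lambda>u. C * indicator {0..t} u)"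
      using t by (intro integrable_mult_right integrable_real_indicator) auto
    have "AE u in lborel. u \<noteq> 0" by (rule AE_lborel_singleton)
    then show "AE u in lborel. (\<lambda>n. \<psi> n u) \<longlonglongrightarrow> indicator {0..t} u * \<phi> u"
    proof eventually_elim
      case (elim u)
      show ?case
      proof (cases "0 < u \<and> u \<le> t")
        case True
        then have u: "0 < u" "u \<le> t" by auto
        let ?r = "\<lambda>n. t * real (Suc (nat (\<lceil>u * real n / t\<rceil> - 1))) / real n"
        have ev: "\<forall>\<^sub>F n in sequentially. u \<le> ?r n \<and> ?r n \<le> u + t / real n"
          using eventually_gt_at_top[of 0] by eventually_elim (use grid_indices[OF t u] in auto)
        have r: "?r \<longlonglongrightarrow> u"
        proof (rule tendsto_sandwich)
          show "\<forall>\<^sub>F n in sequentially. u \<le> ?r n" "\<forall>\<^sub>F n in sequentially. ?r n \<le> u + t / n"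
            using ev by (auto elim: eventually_mono)
          show "(\<lambda>n. u + t / n) \<longlonglongrightarrow> u" using tendsto_add[OF tendsto_const lim_const_over_n[of t], of u] by simp
        qed auto
        have "continuous (at u within {u..}) \<phi>"
          using right[OF u(1)] by (simp add: continuous_within at_within_Ici_at_right)
        then have "(\<lambda>n. \<phi> (?r n)) \<longlonglongrightarrow> \<phi> u"
          by (rule continuous_within_tendsto_compose) (use ev r in \<open>auto elim: eventually_mono\<close>)
        moreover have "\<forall>\<^sub>F n in sequentially. \<phi> (?r n) = \<psi> n u"
          using eventually_gt_at_top[of 0] by eventually_elim (use ins[OF u] in auto)
        ultimately have "(\<lambda>n. \<psi> n u) \<longlonglongrightarrow> \<phi> u" by (rule Lim_transform_eventually)
        then show ?thesis using u by simp
      next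
        case False
        then show ?thesis using elim out[of u] by (auto simp: indicator_def)
      qed
    qed
    show "AE u in lborel. norm (\<psi> n u) \<le> C * indicator {0..t} u" for n
    proof (rule AE_I2)
      fix u
      show "norm (\<psi> n u) \<le> C * indicator {0..t} u"
      proof (cases "0 < u \<and> u \<le> t \<and> n > 0")
        case True
        then have "\<psi> n u = \<phi> (t * Suc (nat (\<lceil>u * n / t\<rceil> - 1)) / n)" by (intro ins) auto
        moreover have "0 \<le> t * Suc (nat (\<lceil>u * n / t\<rceil> - 1)) / n" using t by simp
        ultimately show ?thesis using bound True by simp
      next
        case False
        have "0 \<le> C" using bound[of 0] by simp
        moreover have "\<psi> n u = 0"
        proof (cases "n = 0")
          case True
          then show ?thesis by (simp add: \<psi>_def)
        qed (use False out[of u n] in auto)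
        ultimately show ?thesis by simp
      qed
    qed
  qed
  then show ?thesis unfolding int by (simp add: set_lebesgue_integral_def)
qed

lemma ennreal_integral_le_nn_integral:
  fixes f :: "'b \<Rightarrow> real"
  assumes "integrable M f"
  shows "ennreal (\<integral>\<omega>. f \<omega> \<partial>M) \<le> (\<integral>\<^sup>+\<omega>. ennreal (f \<omega>) \<partial>M)"
proof -
  have i: "integrable M (\<lambda>\<omega>. max 0 (f \<omega>))" using assms by simp
  have "ennreal (\<integral>\<omega>. f \<omega> \<partial>M) \<le> ennreal (\<integral>\<omega>. max 0 (f \<omega>) \<partial>M)"
    using assms i by (intro ennreal_leI integral_mono) auto
  also have "\<dots> = (\<integral>\<^sup>+\<omega>. ennreal (max 0 (f \<omega>)) \<partial>M)"
    using i by (intro nn_integral_eq_integral[symmetric]) auto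
  also have "\<dots> = (\<integral>\<^sup>+\<omega>. ennreal (f \<omega>) \<partial>M)"
    by (intro nn_integral_cong) (simp add: max_def ennreal_neg)
  finally show ?thesis .
qed

text \<open>Reduces absolute moments of any order to even ones, which are explicit for normal
  increments.\<close>

lemma power_le_one_add_even:
  fixes p :: real
  shows "\<bar>p\<bar> ^ a \<le> 1 + p ^ (2 * a)"
proof -
  have "0 \<le> (\<bar>p\<bar> ^ a - 1)\<^sup>2 + (\<bar>p\<bar> ^ a)\<^sup>2" by simp
  then have "2 * \<bar>p\<bar> ^ a \<le> 1 + 2 * (\<bar>p\<bar> ^ a)\<^sup>2" by (simp add: power2_eq_square algebra_simps)
  moreover have "(\<bar>p\<bar> ^ a)\<^sup>2 = p ^ (2 * a)" by (simp add: power_mult[symmetric] mult.commute power_even_abs)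
  moreover have "0 \<le> p ^ (2 * a)" by simp
  ultimately show ?thesis by linarith
qed

section \<open>Measurability, path regularity and increments in the model\<close>

locale inventory_model = prob_space M
  for M :: "'a measure" +
  fixes F :: "real \<Rightarrow> 'a measure" and B Y :: "real \<Rightarrow> 'a \<Rightarrow> real" and \<mu> \<sigma> x :: real
  assumes mu: "\<mu> > 0" and sigma: "\<sigma> > 0"
    and filtered: "filtered_prob_space M F" and bm: "brownian_motion M F B"
    and policy: "admissible_policy M F Y"
begin

definition X :: "real \<Rightarrow> 'a \<Rightarrow> real" where
  "X t \<omega> = x - \<mu> * t + \<sigma> * B t \<omega>"

definition Z :: "real \<Rightarrow> 'a \<Rightarrow> real" where
  "Z t \<omega> = X t \<omega> + Y t \<omega>"

lemma inventory_eq_Z: "inventory \<mu> \<sigma> B x Y t \<omega> = Z t \<omega>"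
  by (simp add: inventory_def Z_def X_def)

lemma subalg: "t \<ge> 0 \<Longrightarrow> subalgebra M (F t)"
  using filtered by (simp add: filtered_prob_space_def)

lemma B_adapted: "t \<ge> 0 \<Longrightarrow> B t \<in> borel_measurable (F t)"
  using bm by (simp add: brownian_motion_def adapted_def)

lemma Y_adapted: "t \<ge> 0 \<Longrightarrow> Y t \<in> borel_measurable (F t)"
  using policy by (simp add: admissible_policy_def adapted_def)

lemma Z_adapted: "t \<ge> 0 \<Longrightarrow> Z t \<in> borel_measurable (F t)"
  unfolding Z_def[abs_def] X_def[abs_def] using B_adapted[of t] Y_adapted[of t] by measurable

lemma B_measurable: "t \<ge> 0 \<Longrightarrow> B t \<in> borel_measurable M"
  using measurable_from_subalg[OF subalg B_adapted] .

lemma Y_measurable: "t \<ge> 0 \<Longrightarrow> Y t \<in> borel_measurable M"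
  using measurable_from_subalg[OF subalg Y_adapted] .

lemma Z_measurable: "t \<ge> 0 \<Longrightarrow> Z t \<in> borel_measurable M"
  using measurable_from_subalg[OF subalg Z_adapted] .

lemma X_measurable: "t \<ge> 0 \<Longrightarrow> X t \<in> borel_measurable M"
  unfolding X_def[abs_def] using B_measurable[of t] by measurable

lemma Y_props:
  assumes "\<omega> \<in> space M"
  shows "mono_on {0..} (\<lambda>t. Y t \<omega>)" "\<And>t. t \<ge> 0 \<Longrightarrow> 0 \<le> Y t \<omega>"
    "\<And>t. t \<ge> 0 \<Longrightarrow> continuous (at_right t) (\<lambda>s. Y s \<omega>)"
    "\<And>t. t > 0 \<Longrightarrow> \<exists>l. ((\<lambda>s. Y s \<omega>) \<longlongrightarrow> l) (at_left t)"
  using policy assms by (auto simp: admissible_policy_def)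

lemma AE_good: "AE \<omega> in M. X 0 \<omega> = x \<and> continuous_on {0..} (\<lambda>t. B t \<omega>)"
proof -
  have "AE \<omega> in M. B 0 \<omega> = 0" "AE \<omega> in M. continuous_on {0..} (\<lambda>t. B t \<omega>)"
    using bm by (simp_all add: brownian_motion_def)
  then show ?thesis by eventually_elim (simp add: X_def)
qed

lemma B_right_continuous:
  assumes "continuous_on {0..} (\<lambda>t. B t \<omega>)" "t \<ge> 0"
  shows "continuous (at_right t) (\<lambda>t. B t \<omega>)"
proof -
  have "continuous (at t within {0..}) (\<lambda>t. B t \<omega>)"
    using assms by (simp add: continuous_on_eq_continuous_within)
  then show ?thesis by (rule continuous_within_subset) (use assms(2) in auto)
qed

lemma Z_right_continuous:
  assumes "continuous_on {0..} (\<lambda>t. B t \<omega>)" "t \<ge> 0" "\<omega> \<in> space M"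
  shows "continuous (at_right t) (\<lambda>t. Z t \<omega>)"
  unfolding Z_def X_def
  by (intro continuous_intros B_right_continuous assms Y_props)

lemma increment_distributed:
  assumes "0 \<le> s" "s < t"
  shows "distributed M lborel (\<lambda>\<omega>. B t \<omega> - B s \<omega>) (normal_density 0 (sqrt (t - s)))"
  using bm assms by (simp add: brownian_motion_def)

lemma increment_even_moment:
  assumes st: "0 \<le> s" "s < t"
  shows "integrable M (\<lambda>\<omega>. (B t \<omega> - B s \<omega>) ^ (2 * k))"
    and "expectation (\<lambda>\<omega>. (B t \<omega> - B s \<omega>) ^ (2 * k)) = fact (2 * k) / (2 ^ k * fact k) * (t - s) ^ k"
proof -
  note D = increment_distributed[OF st]
  have pos: "sqrt (t - s) > 0" using st by simp
  have m: "has_bochner_integral lborel (\<lambda>x. normal_density 0 (sqrt (t - s)) x * x ^ (2 * k))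
      (fact (2 * k) / ((2 / (sqrt (t - s))\<^sup>2) ^ k * fact k))"
    using normal_moment_even[OF pos, of 0 k] by simp
  show "integrable M (\<lambda>\<omega>. (B t \<omega> - B s \<omega>) ^ (2 * k))"
    using distributed_integrable[OF D, of "\<lambda>x. x ^ (2 * k)"] m by (auto simp: has_bochner_integral_iff)
  have "expectation (\<lambda>\<omega>. (B t \<omega> - B s \<omega>) ^ (2 * k)) = fact (2 * k) / ((2 / (sqrt (t - s))\<^sup>2) ^ k * fact k)"
    using distributed_integral[OF D, of "\<lambda>x. x ^ (2 * k)"] m by (simp add: has_bochner_integral_iff)
  also have "\<dots> = fact (2 * k) / (2 ^ k * fact k) * (t - s) ^ k"
    using st by (simp add: power_divide)
  finally show "expectation (\<lambda>\<omega>. (B t \<omega> - B s \<omega>) ^ (2 * k)) = fact (2 * k) / (2 ^ k * fact k) * (t - s) ^ k" .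
qed

lemma increment_mean:
  assumes st: "0 \<le> s" "s < t"
  shows "integrable M (\<lambda>\<omega>. B t \<omega> - B s \<omega>)" "expectation (\<lambda>\<omega>. B t \<omega> - B s \<omega>) = 0"
proof -
  note D = increment_distributed[OF st]
  have pos: "sqrt (t - s) > 0" using st by simp
  show "integrable M (\<lambda>\<omega>. B t \<omega> - B s \<omega>)"
    using distributed_integrable[OF D, of "\<lambda>x. x"] integrable_normal_moment_nz_1[OF pos, of 0] by auto
  show "expectation (\<lambda>\<omega>. B t \<omega> - B s \<omega>) = 0"
    using distributed_integral[OF D, of "\<lambda>x. x"] integral_normal_moment_nz_1[OF pos, of 0] by auto
qed

lemma increment_indep:
  fixes W :: "'a \<Rightarrow> real"
  assumes st: "0 \<le> s" "s < t" and W: "W \<in> borel_measurable (F s)"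
  shows "indep_var borel (\<lambda>\<omega>. B t \<omega> - B s \<omega>) borel W"
  unfolding indep_var_def indep_vars_def2
proof (intro conjI ballI)
  let ?D = "\<lambda>\<omega>. B t \<omega> - B s \<omega>"
  have "?D \<in> borel_measurable M"
    using st by (intro borel_measurable_diff B_measurable) auto
  moreover have "W \<in> borel_measurable M" using measurable_from_subalg[OF subalg W] st by simp
  ultimately show "random_variable (case i of True \<Rightarrow> borel | False \<Rightarrow> borel) (case i of True \<Rightarrow> ?D | False \<Rightarrow> W)" for i
    by (auto split: bool.split)
  have ind: "indep_set {?D -` A \<inter> space M | A. A \<in> sets borel} (sets (F s))"
    using bm st by (simp add: brownian_motion_def)
  have sp: "space (F s) = space M" using subalg[OF st(1)] by (simp add: subalgebra_def)
  have "{W -` A \<inter> space M | A. A \<in> sets borel} \<subseteq> sets (F s)"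
    using measurable_sets[OF W] sp by auto
  then show "indep_sets (\<lambda>i. {(case i of True \<Rightarrow> ?D | False \<Rightarrow> W) -` A \<inter> space M |A.
       A \<in> sets (case i of True \<Rightarrow> borel | False \<Rightarrow> borel)}) UNIV"
    by (intro indep_sets_mono_sets[OF ind[unfolded indep_set_def]]) (auto split: bool.splits)
qed

lemma expectation_mult_increment:
  fixes W :: "'a \<Rightarrow> real" and C :: real and p :: "real \<Rightarrow> real"
  assumes st: "0 \<le> s" "s < t" and W: "W \<in> borel_measurable (F s)" and bd: "\<And>\<omega>. \<bar>W \<omega>\<bar> \<le> C"
    and p: "p \<in> borel_measurable borel" and int: "integrable M (\<lambda>\<omega>. p (B t \<omega> - B s \<omega>))"
  shows "integrable M (\<lambda>\<omega>. p (B t \<omega> - B s \<omega>) * W \<omega>)"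
    "expectation (\<lambda>\<omega>. p (B t \<omega> - B s \<omega>) * W \<omega>) = expectation (\<lambda>\<omega>. p (B t \<omega> - B s \<omega>)) * expectation W"
proof -
  have "W \<in> borel_measurable M" using measurable_from_subalg[OF subalg W] st by simp
  then have Wi: "integrable M W" using bd by (intro integrable_const_bound[where B = C]) auto
  have ind: "indep_var borel (\<lambda>\<omega>. p (B t \<omega> - B s \<omega>)) borel W"
    using indep_var_compose[OF increment_indep[OF st W] p measurable_ident] by (simp add: comp_def)
  show "integrable M (\<lambda>\<omega>. p (B t \<omega> - B s \<omega>) * W \<omega>)"
    by (rule indep_var_integrable[OF ind int Wi])
  show "expectation (\<lambda>\<omega>. p (B t \<omega> - B s \<omega>) * W \<omega>) = expectation (\<lambda>\<omega>. p (B t \<omega> - B s \<omega>)) * expectation W"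
    by (rule indep_var_lebesgue_integral[OF ind int Wi])
qed

end

section \<open>One step of the uncontrolled process\<close>

text \<open>The Lipschitz condition bounds the second derivative of the Taylor remainder, and the
  mean value inequality is applied twice; the constant is not sharp.\<close>

lemma second_order_lower_bound:
  fixes G G' G'' :: "real \<Rightarrow> real"
  assumes dG: "\<And>z. (G has_real_derivative G' z) (at z)"
    and dG': "\<And>z. (G' has_real_derivative G'' z) (at z)"
    and lip: "\<And>x y. \<bar>G'' x - G'' y\<bar> \<le> L * \<bar>x - y\<bar>"
  shows "G (z + d) - G z \<ge> G' z * d + G'' z * d\<^sup>2 / 2 - L * \<bar>d\<bar> ^ 3"
proof -
  have L: "L \<ge> 0" using lip[of 0 1] by (simp add: order_trans[OF abs_ge_zero])
  define g where "g u = G (z + u) - G z - G' z * u - G'' z * u\<^sup>2 / 2" for u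
  define g' where "g' u = G' (z + u) - G' z - G'' z * u" for u
  have sh: "((\<lambda>u. G (z + u)) has_real_derivative G' (z + u)) (at u)"
    "((\<lambda>u. G' (z + u)) has_real_derivative G'' (z + u)) (at u)" for u
    using dG[of "u + z"] dG'[of "u + z"] DERIV_shift[of G "G' (u + z)" u z] DERIV_shift[of G' "G'' (u + z)" u z]
    by (simp_all add: add.commute)
  have dg: "(g has_real_derivative g' u) (at u)" for u
    unfolding g_def g'_def by (auto intro!: derivative_eq_intros sh)
  have dg': "(g' has_real_derivative (G'' (z + u) - G'' z)) (at u)" for u
    unfolding g'_def by (auto intro!: derivative_eq_intros sh)
  have b1: "\<bar>g' u\<bar> \<le> L * \<bar>u\<bar> * \<bar>u\<bar>" for u
  proof -
    have "norm (g' u - g' 0) \<le> (L * \<bar>u\<bar>) * norm (u - 0)"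
    proof (rule field_differentiable_bound[of "{-\<bar>u\<bar>..\<bar>u\<bar>}"])
      fix v assume v: "v \<in> {-\<bar>u\<bar>..\<bar>u\<bar>}"
      show "(g' has_field_derivative (G'' (z + v) - G'' z)) (at v within {-\<bar>u\<bar>..\<bar>u\<bar>})"
        using dg' by (rule has_field_derivative_at_within)
      have "\<bar>G'' (z + v) - G'' z\<bar> \<le> L * \<bar>v\<bar>" using lip[of "z + v" z] by simp
      also have "\<dots> \<le> L * \<bar>u\<bar>" using v L by (intro mult_left_mono) auto
      finally show "norm (G'' (z + v) - G'' z) \<le> L * \<bar>u\<bar>" by simp
    qed auto
    then show ?thesis by (simp add: g'_def)
  qed
  have "norm (g d - g 0) \<le> (L * \<bar>d\<bar> * \<bar>d\<bar>) * norm (d - 0)"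
  proof (rule field_differentiable_bound[of "{-\<bar>d\<bar>..\<bar>d\<bar>}"])
    fix v assume v: "v \<in> {-\<bar>d\<bar>..\<bar>d\<bar>}"
    show "(g has_field_derivative g' v) (at v within {-\<bar>d\<bar>..\<bar>d\<bar>})"
      using dg by (rule has_field_derivative_at_within)
    have "\<bar>g' v\<bar> \<le> L * \<bar>v\<bar> * \<bar>v\<bar>" by (rule b1)
    also have "\<dots> \<le> L * \<bar>d\<bar> * \<bar>d\<bar>" using v L by (intro mult_mono) auto
    finally show "norm (g' v) \<le> L * \<bar>d\<bar> * \<bar>d\<bar>" by simp
  qed auto
  then have "\<bar>g d\<bar> \<le> L * \<bar>d\<bar> ^ 3" by (simp add: g_def power3_eq_cube)
  then show ?thesis unfolding g_def by (simp add: abs_le_iff)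
qed

text \<open>The arithmetic-geometric mean inequality replaces the third absolute moment by the
  second and the fourth. With \<open>r\<close> the square root of the step length both terms have
  mean of order 3/2 in that length.\<close>

lemma cube_le_interpolation:
  fixes d r :: real
  assumes "r > 0"
  shows "\<bar>d\<bar> ^ 3 \<le> (r * d\<^sup>2 + d ^ 4 / r) / 2"
proof -
  have "0 \<le> (r - \<bar>d\<bar>)\<^sup>2" by simp
  then have "2 * r * \<bar>d\<bar> \<le> r\<^sup>2 + d\<^sup>2" by (simp add: power2_eq_square algebra_simps)
  then have "d\<^sup>2 * (2 * r * \<bar>d\<bar>) \<le> d\<^sup>2 * (r\<^sup>2 + d\<^sup>2)" by (intro mult_left_mono) auto
  then have "2 * r * (\<bar>d\<bar> ^ 3) \<le> r\<^sup>2 * d\<^sup>2 + d ^ 4"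
    by (simp add: power3_eq_cube power2_eq_square power4_eq_xxxx algebra_simps)
  then show ?thesis using assms by (simp add: field_simps power2_eq_square)
qed

text \<open>The alternating moves of \<open>X\<close> and \<open>y\<close> telescope to the total
  increment of \<open>G\<close>. The linear term sees only the moves of \<open>y\<close>, since
  those of \<open>X\<close> are not part of the grid sum, and the values at \<open>y 0\<close>
  cancel against the initial term.\<close>

lemma grid_sum_telescope:
  fixes G X y :: "real \<Rightarrow> real" and c t :: real
  assumes n: "n > 0"
  shows "grid_sum (\<lambda>z. G z + c * z) X y t n = G (X t + y t) - G (X 0) + c * y t
    - (\<Sum>i<n. G (X (t * i / n) + y (t * i / n) + (X (t * Suc i / n) - X (t * i / n))) - G (X (t * i / n) + y (t * i / n)))"
proof -
  let ?f = "\<lambda>i. G (X (t * real i / n) + y (t * real i / n)) + c * y (t * real i / n)"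
  let ?D = "\<lambda>i. G (X (t * i / n) + y (t * i / n) + (X (t * Suc i / n) - X (t * i / n))) - G (X (t * i / n) + y (t * i / n))"
  have "grid_increment (\<lambda>z. G z + c * z) X y t n i = (?f (Suc i) - ?f i) - ?D i" for i
    by (simp add: grid_increment_def algebra_simps)
  then have "(\<Sum>i<n. grid_increment (\<lambda>z. G z + c * z) X y t n i) = (\<Sum>i<n. ?f (Suc i) - ?f i) - (\<Sum>i<n. ?D i)"
    by (simp only: sum_subtractf)
  also have "(\<Sum>i<n. ?f (Suc i) - ?f i) = ?f n - ?f 0" by (rule sum_lessThan_telescope)
  finally show ?thesis using n by (simp add: grid_sum_def algebra_simps)
qed

section \<open>Moments of the Brownian motion\<close>

context inventory_model
begin

lemma X_increment: "X t \<omega> - X s \<omega> = - \<mu> * (t - s) + \<sigma> * (B t \<omega> - B s \<omega>)"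
  by (simp add: X_def algebra_simps)

lemma AE_B_0: "AE \<omega> in M. B 0 \<omega> = 0"
  using bm by (simp add: brownian_motion_def)

lemma B_moments:
  assumes t: "t > 0"
  shows "integrable M (\<lambda>\<omega>. (B t \<omega>) ^ (2 * k))"
    and "expectation (\<lambda>\<omega>. (B t \<omega>) ^ (2 * k)) = fact (2 * k) / (2 ^ k * fact k) * t ^ k"
    and "integrable M (B t)" and "expectation (B t) = 0"
proof -
  have [measurable]: "B 0 \<in> borel_measurable M" "B t \<in> borel_measurable M"
    using t B_measurable by auto
  have eq: "AE \<omega> in M. (B t \<omega> - B 0 \<omega>) ^ (2 * k) = (B t \<omega>) ^ (2 * k)"
    using AE_B_0 by eventually_elim simp
  have eq1: "AE \<omega> in M. B t \<omega> - B 0 \<omega> = B t \<omega>" using AE_B_0 by eventually_elim simp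
  show "integrable M (\<lambda>\<omega>. (B t \<omega>) ^ (2 * k))"
    by (rule iffD1[OF integrable_cong_AE[OF _ _ eq] increment_even_moment(1)]) (use t in auto)
  show "integrable M (B t)"
    by (rule iffD1[OF integrable_cong_AE[OF _ _ eq1] increment_mean(1)]) (use t in auto)
  have "expectation (\<lambda>\<omega>. (B t \<omega>) ^ (2 * k)) = expectation (\<lambda>\<omega>. (B t \<omega> - B 0 \<omega>) ^ (2 * k))"
    by (rule integral_cong_AE[OF _ _ eq, symmetric]) auto
  then show "expectation (\<lambda>\<omega>. (B t \<omega>) ^ (2 * k)) = fact (2 * k) / (2 ^ k * fact k) * t ^ k"
    using increment_even_moment(2)[of 0 t k] t by simp
  have "expectation (B t) = expectation (\<lambda>\<omega>. B t \<omega> - B 0 \<omega>)"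
    by (rule integral_cong_AE[OF _ _ eq1, symmetric]) auto
  then show "expectation (B t) = 0" using increment_mean(2)[of 0 t] t by simp
qed

lemma integrable_B:
  assumes "t \<ge> 0"
  shows "integrable M (B t)"
proof (cases "t = 0")
  case True
  have "AE \<omega> in M. 0 = B 0 \<omega>" using AE_B_0 by eventually_elim simp
  then have "integrable M (B 0)"
    by (rule iffD1[OF integrable_cong_AE integrable_zero, rotated 2]) (auto simp: B_measurable)
  with True show ?thesis by simp
qed (use assms B_moments(3) in auto)

lemma integrable_X: "t \<ge> 0 \<Longrightarrow> integrable M (X t)"
  unfolding X_def[abs_def] using integrable_B[of t] by simp

end

section \<open>The Taylor estimate for one grid step\<close>

locale smooth_potential = inventory_model +
  fixes G G' G'' :: "real \<Rightarrow> real" and L1 L2 A :: real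
  assumes dG: "\<And>z. (G has_real_derivative G' z) (at z)"
    and dG': "\<And>z. (G' has_real_derivative G'' z) (at z)"
    and lip: "\<And>x y. \<bar>G'' x - G'' y\<bar> \<le> L2 * \<bar>x - y\<bar>"
    and G''_bound: "\<And>z. \<bar>G'' z\<bar> \<le> L1" and G'_bound: "\<And>z. \<bar>G' z\<bar> \<le> A"
begin

definition gen :: "real \<Rightarrow> real" where
  "gen z = \<sigma>\<^sup>2 / 2 * G'' z - \<mu> * G' z"

text \<open>
  The first term bounds the squared drift in the quadratic Taylor term, the second one the cubic
  remainder, interpolated between the second and the fourth moment of the increment.
\<close>

definition step_error :: "real \<Rightarrow> real" where
  "step_error \<delta> = L1 * \<mu>\<^sup>2 * \<delta>\<^sup>2 / 2
     + L2 * (sqrt \<delta> * (\<mu>\<^sup>2 * \<delta>\<^sup>2 + \<sigma>\<^sup>2 * \<delta>) + (4 * \<mu> ^ 4 * \<delta> ^ 4 + 12 * \<sigma> ^ 4 * \<delta>\<^sup>2) / sqrt \<delta>)"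

lemma continuous_G: "continuous_on S G" "continuous_on S G'" "continuous_on S G''"
proof -
  show "continuous_on S G" "continuous_on S G'"
    using dG dG' by (meson DERIV_isCont continuous_at_imp_continuous_on)+
  have "L2-lipschitz_on UNIV G''"
    using lip order_trans[OF abs_ge_zero lip[of 0 1]] by (intro lipschitz_onI) (auto simp: dist_real_def)
  then show "continuous_on S G''"
    using lipschitz_on_continuous_on continuous_on_subset by blast
qed

lemma measurable_G[measurable]: "G \<in> borel_measurable borel" "G' \<in> borel_measurable borel"
  "G'' \<in> borel_measurable borel" "gen \<in> borel_measurable borel"
proof -
  show [measurable]: "G \<in> borel_measurable borel" "G' \<in> borel_measurable borel" "G'' \<in> borel_measurable borel"
    using continuous_G[of UNIV] by (auto intro: borel_measurable_continuous_onI)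
  show "gen \<in> borel_measurable borel" unfolding gen_def[abs_def] by measurable
qed

lemma continuous_gen: "continuous_on S gen"
  unfolding gen_def[abs_def] by (intro continuous_intros continuous_G)

lemma gen_bound: "\<bar>gen z\<bar> \<le> \<sigma>\<^sup>2 / 2 * L1 + \<mu> * A"
proof -
  have "\<bar>gen z\<bar> \<le> \<bar>\<sigma>\<^sup>2 / 2 * G'' z\<bar> + \<bar>\<mu> * G' z\<bar>" unfolding gen_def by linarith
  also have "\<dots> = \<sigma>\<^sup>2 / 2 * \<bar>G'' z\<bar> + \<mu> * \<bar>G' z\<bar>" using mu by (simp add: abs_mult)
  also have "\<dots> \<le> \<sigma>\<^sup>2 / 2 * L1 + \<mu> * A"
    using mu G''_bound G'_bound by (intro add_mono mult_left_mono) auto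
  finally show ?thesis .
qed

lemma G_lipschitz: "\<bar>G a - G b\<bar> \<le> A * \<bar>a - b\<bar>"
  using field_differentiable_bound[of UNIV G G' A a b] dG G'_bound by auto

lemma integrable_G:
  assumes "integrable M W"
  shows "integrable M (\<lambda>\<omega>. G (W \<omega>))"
proof (rule Bochner_Integration.integrable_bound)
  show "integrable M (\<lambda>\<omega>. \<bar>G 0\<bar> + A * \<bar>W \<omega>\<bar>)" using assms by simp
  show "(\<lambda>\<omega>. G (W \<omega>)) \<in> borel_measurable M" using borel_measurable_integrable[OF assms] by measurable
  have "\<bar>G (W \<omega>)\<bar> \<le> \<bar>G 0\<bar> + A * \<bar>W \<omega>\<bar>" for \<omega> using G_lipschitz[of "W \<omega>" 0] by simp
  then show "AE \<omega> in M. norm (G (W \<omega>)) \<le> norm (\<bar>G 0\<bar> + A * \<bar>W \<omega>\<bar>)" by (intro AE_I2) (smt (verit) real_norm_def)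
qed

lemma integrable_gen: "W \<in> borel_measurable M \<Longrightarrow> integrable M (\<lambda>\<omega>. gen (W \<omega>))"
  using gen_bound by (intro integrable_const_bound[where B = "\<sigma>\<^sup>2 / 2 * L1 + \<mu> * A"]) auto

text \<open>\<open>Z s\<close> is known at time \<open>s\<close> and the increment of
  \<open>B\<close> is independent of it. So the Taylor terms linear in that increment have mean
  zero, and the quadratic one yields \<open>\<delta>\<close> times the second-order part of the
  generator.\<close>

lemma one_step:
  assumes s: "s \<ge> 0" and delta: "\<delta> > 0"
  shows "integrable M (\<lambda>\<omega>. G (Z s \<omega> + (X (s + \<delta>) \<omega> - X s \<omega>)) - G (Z s \<omega>))"
    and "expectation (\<lambda>\<omega>. G (Z s \<omega> + (X (s + \<delta>) \<omega> - X s \<omega>)) - G (Z s \<omega>))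
      \<ge> \<delta> * expectation (\<lambda>\<omega>. gen (Z s \<omega>)) - step_error \<delta>"
proof -
  define b where "b \<omega> = B (s + \<delta>) \<omega> - B s \<omega>" for \<omega>
  define d where "d \<omega> = - \<mu> * \<delta> + \<sigma> * b \<omega>" for \<omega>
  have st: "0 \<le> s" "s < s + \<delta>" using s delta by auto
  have Zm[measurable]: "Z s \<in> borel_measurable M" and Bm[measurable]: "B s \<in> borel_measurable M" "B (s + \<delta>) \<in> borel_measurable M"
    using Z_measurable B_measurable s delta by auto
  have bm[measurable]: "b \<in> borel_measurable M" unfolding b_def by measurable
  have dX: "X (s + \<delta>) \<omega> - X s \<omega> = d \<omega>" for \<omega> by (simp add: X_increment d_def b_def)
  have b1: "integrable M b" "expectation b = 0"
    using increment_mean[OF st] by (simp_all add: b_def[abs_def])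
  have b2: "integrable M (\<lambda>\<omega>. (b \<omega>)\<^sup>2)" "expectation (\<lambda>\<omega>. (b \<omega>)\<^sup>2) = \<delta>"
    using increment_even_moment[OF st, of 1] by (simp_all add: b_def numeral_eq_Suc)
  have b4: "integrable M (\<lambda>\<omega>. (b \<omega>) ^ 4)" "expectation (\<lambda>\<omega>. (b \<omega>) ^ 4) = 3 * \<delta>\<^sup>2"
    using increment_even_moment[OF st, of 2] by (simp_all add: b_def fact_numeral)
  show int: "integrable M (\<lambda>\<omega>. G (Z s \<omega> + (X (s + \<delta>) \<omega> - X s \<omega>)) - G (Z s \<omega>))"
    unfolding dX
  proof (rule Bochner_Integration.integrable_bound)
    show "integrable M (\<lambda>\<omega>. A * (- \<mu> * \<delta> + \<sigma> * b \<omega>))" using b1 by simp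
    show "(\<lambda>\<omega>. G (Z s \<omega> + d \<omega>) - G (Z s \<omega>)) \<in> borel_measurable M" unfolding d_def by measurable
    have "\<bar>G (Z s \<omega> + d \<omega>) - G (Z s \<omega>)\<bar> \<le> A * \<bar>d \<omega>\<bar>" for \<omega> using G_lipschitz[of "Z s \<omega> + d \<omega>" "Z s \<omega>"] by simp
    moreover have "A \<ge> 0" using G'_bound[of 0] by linarith
    ultimately show "AE \<omega> in M. norm (G (Z s \<omega> + d \<omega>) - G (Z s \<omega>)) \<le> norm (A * (- \<mu> * \<delta> + \<sigma> * b \<omega>))"
      by (intro AE_I2) (simp add: abs_mult d_def)
  qed
  have m1: "(\<lambda>\<omega>. G' (Z s \<omega>)) \<in> borel_measurable (F s)" "(\<lambda>\<omega>. G'' (Z s \<omega>)) \<in> borel_measurable (F s)"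
    using Z_adapted[OF s] by measurable
  note i1 = expectation_mult_increment[OF st m1(1) G'_bound, of "\<lambda>x. x", folded b_def]
  note i2 = expectation_mult_increment[OF st m1(2) G''_bound, of "\<lambda>x. x", folded b_def]
  note i3 = expectation_mult_increment[OF st m1(2) G''_bound, of "\<lambda>x. x\<^sup>2", folded b_def]
  have j1: "integrable M (\<lambda>\<omega>. b \<omega> * G' (Z s \<omega>))" "expectation (\<lambda>\<omega>. b \<omega> * G' (Z s \<omega>)) = 0"
    using i1 b1 by (auto simp: b_def[abs_def])
  have j2: "integrable M (\<lambda>\<omega>. b \<omega> * G'' (Z s \<omega>))" "expectation (\<lambda>\<omega>. b \<omega> * G'' (Z s \<omega>)) = 0"
    using i2 b1 by (auto simp: b_def[abs_def])
  have j3: "integrable M (\<lambda>\<omega>. (b \<omega>)\<^sup>2 * G'' (Z s \<omega>))"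
    "expectation (\<lambda>\<omega>. (b \<omega>)\<^sup>2 * G'' (Z s \<omega>)) = \<delta> * expectation (\<lambda>\<omega>. G'' (Z s \<omega>))"
    using i3 b2 by (auto simp: b_def[abs_def])
  have k1: "integrable M (\<lambda>\<omega>. G' (Z s \<omega>))" "integrable M (\<lambda>\<omega>. G'' (Z s \<omega>))"
    by (rule integrable_const_bound[where B = A]; use G'_bound in simp)
      (rule integrable_const_bound[where B = L1]; use G''_bound in simp)
  let ?r = "sqrt \<delta>"
  have r: "?r > 0" using delta by simp
  have L2: "L2 \<ge> 0" using order_trans[OF abs_ge_zero lip[of 0 1]] by simp
  \<comment> \<open>This lower bound contains only terms with known means: bounded functions of
    \<open>Z s\<close> times powers of the increment, and pure powers from the remainder.\<close>
  let ?T = "\<lambda>\<omega>. - \<mu> * \<delta> * G' (Z s \<omega>) + \<sigma> * (b \<omega> * G' (Z s \<omega>)) - L1 * \<mu>\<^sup>2 * \<delta>\<^sup>2 / 2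
      - \<mu> * \<delta> * \<sigma> * (b \<omega> * G'' (Z s \<omega>)) + \<sigma>\<^sup>2 / 2 * ((b \<omega>)\<^sup>2 * G'' (Z s \<omega>))
      - L2 * (?r * (\<mu>\<^sup>2 * \<delta>\<^sup>2 + \<sigma>\<^sup>2 * (b \<omega>)\<^sup>2) + (4 * \<mu> ^ 4 * \<delta> ^ 4 + 4 * \<sigma> ^ 4 * (b \<omega>) ^ 4) / ?r)"
  have point: "?T \<omega> \<le> G (Z s \<omega> + d \<omega>) - G (Z s \<omega>)" for \<omega>
  proof -
    let ?z = "Z s \<omega>" and ?b = "b \<omega>" and ?d = "d \<omega>"
    have sq: "?d\<^sup>2 \<le> 2 * (\<mu>\<^sup>2 * \<delta>\<^sup>2 + \<sigma>\<^sup>2 * ?b\<^sup>2)"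
      using zero_le_power2[of "\<mu> * \<delta> + \<sigma> * ?b"] by (simp add: d_def power2_eq_square algebra_simps)
    \<comment> \<open>The inequality \<open>(p + q)^2 \<le> 2 * (p^2 + q^2)\<close> is used twice,
      for drift and noise and then for their squares. One factor 2 stays outside to cancel the
      division by 2 in the interpolation.\<close>
    have "?d ^ 4 = (?d\<^sup>2)\<^sup>2" by simp
    also have "\<dots> \<le> (2 * (\<mu>\<^sup>2 * \<delta>\<^sup>2 + \<sigma>\<^sup>2 * ?b\<^sup>2))\<^sup>2" using sq by (intro power_mono) auto
    also have "\<dots> \<le> 2 * (4 * \<mu> ^ 4 * \<delta> ^ 4 + 4 * \<sigma> ^ 4 * ?b ^ 4)"
      using zero_le_power2[of "\<mu>\<^sup>2 * \<delta>\<^sup>2 - \<sigma>\<^sup>2 * ?b\<^sup>2"] by (simp add: power2_eq_square power4_eq_xxxx algebra_simps)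
    finally have q: "?d ^ 4 \<le> 2 * (4 * \<mu> ^ 4 * \<delta> ^ 4 + 4 * \<sigma> ^ 4 * ?b ^ 4)" .
    have half: "(?r * (2 * P) + 2 * Q / ?r) / 2 = ?r * P + Q / ?r" for P Q
      by (simp add: add_divide_distrib)
    have "\<bar>?d\<bar> ^ 3 \<le> (?r * ?d\<^sup>2 + ?d ^ 4 / ?r) / 2" by (rule cube_le_interpolation[OF r])
    also have "\<dots> \<le> (?r * (2 * (\<mu>\<^sup>2 * \<delta>\<^sup>2 + \<sigma>\<^sup>2 * ?b\<^sup>2)) + 2 * (4 * \<mu> ^ 4 * \<delta> ^ 4 + 4 * \<sigma> ^ 4 * ?b ^ 4) / ?r) / 2"
      using sq q r by (intro divide_right_mono add_mono mult_left_mono) auto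
    also have "\<dots> = ?r * (\<mu>\<^sup>2 * \<delta>\<^sup>2 + \<sigma>\<^sup>2 * ?b\<^sup>2) + (4 * \<mu> ^ 4 * \<delta> ^ 4 + 4 * \<sigma> ^ 4 * ?b ^ 4) / ?r"
      by (rule half)
    finally have c: "L2 * \<bar>?d\<bar> ^ 3 \<le> L2 * (?r * (\<mu>\<^sup>2 * \<delta>\<^sup>2 + \<sigma>\<^sup>2 * ?b\<^sup>2) + (4 * \<mu> ^ 4 * \<delta> ^ 4 + 4 * \<sigma> ^ 4 * ?b ^ 4) / ?r)"
      using L2 by (intro mult_left_mono)
    have "- (L1 * (\<mu>\<^sup>2 * \<delta>\<^sup>2)) \<le> G'' ?z * (\<mu>\<^sup>2 * \<delta>\<^sup>2)"
    proof -
      have "- L1 \<le> G'' ?z" using G''_bound[of ?z] by (simp add: abs_le_iff)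
      then have "- L1 * (\<mu>\<^sup>2 * \<delta>\<^sup>2) \<le> G'' ?z * (\<mu>\<^sup>2 * \<delta>\<^sup>2)" by (intro mult_right_mono) auto
      then show ?thesis by simp
    qed
    moreover have "G' ?z * ?d + G'' ?z * ?d\<^sup>2 / 2 = - \<mu> * \<delta> * G' ?z + \<sigma> * (?b * G' ?z) + G'' ?z * (\<mu>\<^sup>2 * \<delta>\<^sup>2) / 2
        - \<mu> * \<delta> * \<sigma> * (?b * G'' ?z) + \<sigma>\<^sup>2 / 2 * (?b\<^sup>2 * G'' ?z)"
      by (simp add: d_def power2_eq_square algebra_simps add_divide_distrib diff_divide_distrib)
    ultimately show ?thesis
      using second_order_lower_bound[OF dG dG' lip, of ?z ?d] c by (simp add: mult.assoc)
  qed
  have Tint: "integrable M ?T"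
    using j1 j2 j3 k1 b2 b4
    by (intro Bochner_Integration.integrable_add Bochner_Integration.integrable_diff integrable_mult_right
        integrable_divide integrable_const) auto
  have "expectation ?T = - \<mu> * \<delta> * expectation (\<lambda>\<omega>. G' (Z s \<omega>)) - L1 * \<mu>\<^sup>2 * \<delta>\<^sup>2 / 2
      + \<sigma>\<^sup>2 / 2 * (\<delta> * expectation (\<lambda>\<omega>. G'' (Z s \<omega>)))
      - L2 * (?r * (\<mu>\<^sup>2 * \<delta>\<^sup>2 + \<sigma>\<^sup>2 * \<delta>) + (4 * \<mu> ^ 4 * \<delta> ^ 4 + 4 * \<sigma> ^ 4 * (3 * \<delta>\<^sup>2)) / ?r)"
    using j1 j2 j3 k1 b2 b4 by (simp add: prob_space)
  also have "\<dots> = \<delta> * expectation (\<lambda>\<omega>. gen (Z s \<omega>)) - step_error \<delta>"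
    using k1 by (simp add: gen_def step_error_def algebra_simps)
  finally have "\<delta> * expectation (\<lambda>\<omega>. gen (Z s \<omega>)) - step_error \<delta> = expectation ?T" ..
  also have "\<dots> \<le> expectation (\<lambda>\<omega>. G (Z s \<omega> + (X (s + \<delta>) \<omega> - X s \<omega>)) - G (Z s \<omega>))"
    unfolding dX using point Tint int[unfolded dX] by (intro integral_mono)
  finally show "expectation (\<lambda>\<omega>. G (Z s \<omega> + (X (s + \<delta>) \<omega> - X s \<omega>)) - G (Z s \<omega>))
      \<ge> \<delta> * expectation (\<lambda>\<omega>. gen (Z s \<omega>)) - step_error \<delta>" .
qed

text \<open>In terms of \<open>r = sqrt (t / n)\<close> the error of one step is \<open>r^2\<close>
  times a polynomial in \<open>r\<close> without constant term, and
  \<open>n * r^2 = t\<close>.\<close>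

lemma step_error_vanishes:
  assumes t: "t > 0"
  shows "(\<lambda>n. real n * step_error (t / real n)) \<longlonglongrightarrow> 0"
proof -
  let ?p = "\<lambda>r. t * (L1 * \<mu>\<^sup>2 * r\<^sup>2 / 2 + L2 * (r * (\<mu>\<^sup>2 * r\<^sup>2 + \<sigma>\<^sup>2) + (4 * \<mu> ^ 4 * r ^ 5 + 12 * \<sigma> ^ 4 * r)))"
  have "(\<lambda>n. t / real n) \<longlonglongrightarrow> 0" by (rule lim_const_over_n)
  then have "(\<lambda>n. sqrt (t / real n)) \<longlonglongrightarrow> sqrt 0" by (rule tendsto_real_sqrt)
  then have "(\<lambda>n. ?p (sqrt (t / real n))) \<longlonglongrightarrow> ?p (sqrt 0)"
    by (intro tendsto_intros) simp_all
  moreover have "\<forall>\<^sub>F n in sequentially. ?p (sqrt (t / real n)) = real n * step_error (t / real n)"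
    using eventually_gt_at_top[of 0]
  proof eventually_elim
    case (elim n)
    define r where "r = sqrt (t / real n)"
    have r: "r > 0" "t / real n = r\<^sup>2" using t elim by (simp_all add: r_def)
    have nr: "real n * r\<^sup>2 = t" using r(2)[symmetric] elim by simp
    have q: "(4 * \<mu> ^ 4 * (r\<^sup>2) ^ 4 + 12 * \<sigma> ^ 4 * (r\<^sup>2)\<^sup>2) / r = r\<^sup>2 * (4 * \<mu> ^ 4 * r ^ 5 + 12 * \<sigma> ^ 4 * r)"
      using r(1) by (simp add: field_simps eval_nat_numeral)
    have sq: "sqrt (r\<^sup>2) = r" using r(1) by simp
    have "step_error (r\<^sup>2) = r\<^sup>2 * (L1 * \<mu>\<^sup>2 * r\<^sup>2 / 2 + L2 * (r * (\<mu>\<^sup>2 * r\<^sup>2 + \<sigma>\<^sup>2) + (4 * \<mu> ^ 4 * r ^ 5 + 12 * \<sigma> ^ 4 * r)))"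
      unfolding step_error_def sq q by (simp add: algebra_simps power2_eq_square)
    then have "real n * step_error (r\<^sup>2) = ?p r"
      by (simp only: mult.assoc[symmetric] nr)
    then show ?case unfolding r(2) r_def[symmetric] using r by simp
  qed
  ultimately show ?thesis by (auto intro: Lim_transform_eventually)
qed

end

section \<open>The integrated inequality for smooth potentials\<close>

context inventory_model
begin

lemma right_version_Z:
  assumes "continuous_on {0..} (\<lambda>t. B t \<omega>)" "\<omega> \<in> space M" "u \<ge> 0"
  shows "right_version Z u \<omega> = Z u \<omega>"
  using assms by (intro right_version_eq Z_right_continuous)

lemma AE_right_version_Z: "AE \<omega> in M. \<forall>u\<ge>0. right_version Z u \<omega> = Z u \<omega>"
  using AE_good AE_space by eventually_elim (simp add: right_version_Z)

lemma measurable_right_version_Z[measurable]: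
  "(\<lambda>p. right_version Z (fst p) (snd p)) \<in> borel_measurable (lborel \<Otimes>\<^sub>M M)"
  by (intro measurable_right_version Z_measurable)

lemma nn_integral_Z_Fubini:
  assumes [measurable]: "g \<in> borel_measurable borel"
  shows "(\<integral>\<^sup>+\<omega>. (\<integral>\<^sup>+u\<in>{0..t}. ennreal (g (right_version Z u \<omega>)) \<partial>lborel) \<partial>M)
       = (\<integral>\<^sup>+u\<in>{0..t}. (\<integral>\<^sup>+\<omega>. ennreal (g (Z u \<omega>)) \<partial>M) \<partial>lborel)"
proof -
  interpret P: pair_sigma_finite lborel M ..
  have m: "(\<lambda>(u, \<omega>). ennreal (g (right_version Z u \<omega>)) * indicator {0..t} u) \<in> borel_measurable (lborel \<Otimes>\<^sub>M M)"
    unfolding case_prod_beta by measurable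
  have "(\<integral>\<^sup>+\<omega>. (\<integral>\<^sup>+u\<in>{0..t}. ennreal (g (right_version Z u \<omega>)) \<partial>lborel) \<partial>M)
      = (\<integral>\<^sup>+u. \<integral>\<^sup>+\<omega>. ennreal (g (right_version Z u \<omega>)) * indicator {0..t} u \<partial>M \<partial>lborel)"
    using P.Fubini'[OF m] by simp
  also have "\<dots> = (\<integral>\<^sup>+u. (\<integral>\<^sup>+\<omega>. ennreal (g (Z u \<omega>)) \<partial>M) * indicator {0..t} u \<partial>lborel)"
  proof (rule nn_integral_cong)
    fix u :: real
    show "(\<integral>\<^sup>+\<omega>. ennreal (g (right_version Z u \<omega>)) * indicator {0..t} u \<partial>M)
        = (\<integral>\<^sup>+\<omega>. ennreal (g (Z u \<omega>)) \<partial>M) * indicator {0..t} u"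
    proof (cases "u \<in> {0..t}")
      case True
      have "(\<integral>\<^sup>+\<omega>. ennreal (g (right_version Z u \<omega>)) \<partial>M) = (\<integral>\<^sup>+\<omega>. ennreal (g (Z u \<omega>)) \<partial>M)"
        using AE_right_version_Z by (intro nn_integral_cong_AE) (use True in \<open>auto elim: eventually_mono\<close>)
      then show ?thesis using True by simp
    qed simp
  qed
  finally show ?thesis .
qed

end

context smooth_potential
begin

text \<open>Taken along the version of \<open>Z\<close>, whose joint measurability makes the mean
  measurable in \<open>u\<close>.\<close>

definition mean_gen :: "real \<Rightarrow> real" where
  "mean_gen u = expectation (\<lambda>\<omega>. gen (right_version Z u \<omega>))"

lemma mean_gen_eq: "u \<ge> 0 \<Longrightarrow> mean_gen u = expectation (\<lambda>\<omega>. gen (Z u \<omega>))"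
proof -
  assume u: "u \<ge> 0"
  have [measurable]: "right_version Z u \<in> borel_measurable M"
    using measurable_compose_Pair1[OF _ measurable_right_version_Z, of u] by simp
  have [measurable]: "Z u \<in> borel_measurable M" using u by (rule Z_measurable)
  show ?thesis
    unfolding mean_gen_def using AE_right_version_Z
    by (intro integral_cong_AE) (use u in \<open>auto elim: eventually_mono\<close>)
qed

lemma measurable_mean_gen[measurable]: "mean_gen \<in> borel_measurable borel"
proof -
  have "(\<lambda>u. expectation (\<lambda>\<omega>. gen (right_version Z u \<omega>))) \<in> borel_measurable lborel"
    by (rule borel_measurable_lebesgue_integral) (simp add: case_prod_beta)
  then show ?thesis by (simp add: mean_gen_def[abs_def])
qed

lemma mean_gen_bound: "u \<ge> 0 \<Longrightarrow> \<bar>mean_gen u\<bar> \<le> \<sigma>\<^sup>2 / 2 * L1 + \<mu> * A"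
proof -
  assume u: "u \<ge> 0"
  have "\<bar>mean_gen u\<bar> \<le> expectation (\<lambda>\<omega>. \<bar>gen (Z u \<omega>)\<bar>)"
    unfolding mean_gen_eq[OF u] by (rule integral_abs_bound)
  also have "\<dots> \<le> expectation (\<lambda>\<omega>. \<sigma>\<^sup>2 / 2 * L1 + \<mu> * A)"
    using gen_bound integrable_gen[OF Z_measurable[OF u]] by (intro integral_mono) auto
  finally show ?thesis by (simp add: prob_space)
qed

lemma mean_gen_right_continuous:
  assumes u: "u \<ge> 0"
  shows "continuous (at_right u) mean_gen"
  unfolding continuous_within
proof (rule tendsto_at_right_sequentially[where b = "u + 1"])
  fix S :: "nat \<Rightarrow> real"
  assume S: "\<And>n. u < S n" "\<And>n. S n < u + 1" "decseq S" "S \<longlonglongrightarrow> u"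
  have "(\<lambda>n. expectation (\<lambda>\<omega>. gen (Z (S n) \<omega>))) \<longlonglongrightarrow> expectation (\<lambda>\<omega>. gen (Z u \<omega>))"
  proof (rule integral_dominated_convergence[where w = "\<lambda>_. \<sigma>\<^sup>2 / 2 * L1 + \<mu> * A"])
    show "(\<lambda>\<omega>. gen (Z u \<omega>)) \<in> borel_measurable M" using Z_measurable[OF u] by measurable
    show "(\<lambda>\<omega>. gen (Z (S n) \<omega>)) \<in> borel_measurable M" for n
    proof -
      have [measurable]: "Z (S n) \<in> borel_measurable M" using S(1)[of n] u by (intro Z_measurable) linarith
      show ?thesis by measurable
    qed
    show "AE \<omega> in M. (\<lambda>n. gen (Z (S n) \<omega>)) \<longlonglongrightarrow> gen (Z u \<omega>)"
      using AE_good AE_space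
    proof eventually_elim
      case (elim \<omega>)
      have "((\<lambda>s. Z s \<omega>) \<longlongrightarrow> Z u \<omega>) (at_right u)"
        using Z_right_continuous[OF _ u, of \<omega>] elim by (simp add: continuous_within)
      moreover have "filterlim S (at_right u) sequentially"
        using S by (intro tendsto_imp_filterlim_at_right) auto
      ultimately have "(\<lambda>n. Z (S n) \<omega>) \<longlonglongrightarrow> Z u \<omega>" by (rule filterlim_compose)
      moreover have "isCont gen (Z u \<omega>)" using continuous_gen[of UNIV] by (simp add: continuous_on_eq_continuous_at)
      ultimately show ?case by (rule isCont_tendsto_compose[rotated])
    qed
    show "AE \<omega> in M. norm (gen (Z (S n) \<omega>)) \<le> \<sigma>\<^sup>2 / 2 * L1 + \<mu> * A" for n using gen_bound by simp
  qed simp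
  moreover have "0 \<le> S n" for n using S(1)[of n] u by linarith
  ultimately show "(\<lambda>n. mean_gen (S n)) \<longlonglongrightarrow> mean_gen u"
    using u by (simp add: mean_gen_eq)
qed simp

text \<open>The Taylor step has the generator at the left end of a cell, while right continuity
  gives convergence of sums over right ends. The two sums differ by an index shift, hence by two
  boundary values times \<open>t / n\<close>.\<close>

lemma mean_gen_riemann_sum:
  fixes t :: real
  assumes t: "t > 0"
  shows "(\<lambda>n :: nat. \<Sum>i<n. t / n * expectation (\<lambda>\<omega>. gen (Z (t * real i / n) \<omega>))) \<longlonglongrightarrow> (LINT u:{0..t}|lborel. mean_gen u)"
proof -
  have 1: "(\<lambda>n. \<Sum>i<n. t / n * mean_gen (t * Suc i / n)) \<longlonglongrightarrow> (LINT u:{0..t}|lborel. mean_gen u)"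
    by (rule right_continuous_riemann_sum[OF t measurable_mean_gen mean_gen_bound mean_gen_right_continuous]) auto
  have 2: "(\<lambda>n. t / real n * (mean_gen 0 - mean_gen t)) \<longlonglongrightarrow> 0"
    using tendsto_mult_right[OF lim_const_over_n[of t], of "mean_gen 0 - mean_gen t"] by simp
  have shift: "(\<Sum>i<n. t / n * mean_gen (t * Suc i / n)) + t / n * (mean_gen 0 - mean_gen t)
      = (\<Sum>i<n. t / n * expectation (\<lambda>\<omega>. gen (Z (t * real i / n) \<omega>)))" if "n > 0" for n :: nat
  proof -
    let ?f = "\<lambda>i. t / n * mean_gen (t * real i / n)"
    have "(\<Sum>i<n. ?f (Suc i)) - (\<Sum>i<n. ?f i) = ?f n - ?f 0"
      using sum_lessThan_telescope[of ?f n] by (simp add: sum_subtractf)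
    moreover have "(\<Sum>i<n. ?f i) = (\<Sum>i<n. t / n * expectation (\<lambda>\<omega>. gen (Z (t * real i / n) \<omega>)))"
      using t by (intro sum.cong refl) (simp add: mean_gen_eq)
    ultimately show ?thesis using that by (simp add: algebra_simps)
  qed
  have "\<forall>\<^sub>F n in sequentially. (\<Sum>i<n. t / n * mean_gen (t * Suc i / n)) + t / n * (mean_gen 0 - mean_gen t)
      = (\<Sum>i<n. t / n * expectation (\<lambda>\<omega>. gen (Z (t * real i / n) \<omega>)))"
    by (rule eventually_mono[OF eventually_gt_at_top[of 0] shift])
  with tendsto_add[OF 1 2] show ?thesis by (auto intro: Lim_transform_eventually)
qed

lemma expected_grid_sum:
  fixes c t :: real and n :: nat
  assumes t: "t > 0" and Y: "integrable M (Y t)" and n: "n > 0"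
  defines "S \<equiv> \<lambda>\<omega>. grid_sum (\<lambda>z. G z + c * z) (\<lambda>s. X s \<omega>) (\<lambda>s. Y s \<omega>) t n"
  shows "integrable M S"
    and "expectation S \<le> expectation (\<lambda>\<omega>. G (Z t \<omega>)) - G x + c * expectation (Y t)
      - (\<Sum>i<n. t / n * expectation (\<lambda>\<omega>. gen (Z (t * real i / n) \<omega>))) + n * step_error (t / n)"
proof -
  let ?s = "\<lambda>i. t * real i / n"
  let ?D = "\<lambda>i \<omega>. G (Z (?s i) \<omega> + (X (?s (Suc i)) \<omega> - X (?s i) \<omega>)) - G (Z (?s i) \<omega>)"
  have tn: "t / n > 0" using t n by simp
  have s0: "?s i \<ge> 0" for i using t by simp
  have sS: "?s (Suc i) = ?s i + t / n" for i by (simp add: field_simps add_divide_distrib)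
  have D: "integrable M (?D i)" "expectation (?D i) \<ge> t / n * expectation (\<lambda>\<omega>. gen (Z (?s i) \<omega>)) - step_error (t / n)" for i
    using one_step[OF s0 tn, of i] unfolding sS by auto
  have Zt: "integrable M (Z t)"
    unfolding Z_def[abs_def] using integrable_X[of t] t Y by simp
  let ?R = "\<lambda>\<omega>. G (Z t \<omega>) - G x + c * Y t \<omega> - (\<Sum>i<n. ?D i \<omega>)"
  have R: "integrable M ?R" using integrable_G[OF Zt] Y D(1) by simp
  have "AE \<omega> in M. ?R \<omega> = S \<omega>"
    using AE_good
  proof eventually_elim
    case (elim \<omega>)
    then show ?case unfolding S_def Z_def
      by (subst grid_sum_telescope[OF n, of G c "\<lambda>s. X s \<omega>" "\<lambda>s. Y s \<omega>" t]) simp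
  qed
  moreover have Sm: "S \<in> borel_measurable M"
  proof -
    have [measurable]: "X (?s i) \<in> borel_measurable M" "Y (?s i) \<in> borel_measurable M" for i
      using X_measurable Y_measurable s0 by auto
    have [measurable]: "X 0 \<in> borel_measurable M" "Y 0 \<in> borel_measurable M"
      using X_measurable Y_measurable by auto
    show ?thesis unfolding S_def grid_sum_def grid_increment_def by measurable
  qed
  ultimately show "integrable M S"
    using R by (intro iffD1[OF integrable_cong_AE R]) auto
  have "expectation S = expectation ?R"
    using \<open>AE \<omega> in M. ?R \<omega> = S \<omega>\<close> Sm R by (intro integral_cong_AE) (auto elim: eventually_mono)
  also have "\<dots> = expectation (\<lambda>\<omega>. G (Z t \<omega>)) - G x + c * expectation (Y t) - (\<Sum>i<n. expectation (?D i))"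
    using integrable_G[OF Zt] Y D(1) by (simp add: prob_space)
  also have "\<dots> \<le> expectation (\<lambda>\<omega>. G (Z t \<omega>)) - G x + c * expectation (Y t)
      - (\<Sum>i<n. t / n * expectation (\<lambda>\<omega>. gen (Z (?s i) \<omega>)) - step_error (t / n))"
    using D(2) by (intro diff_left_mono sum_mono) auto
  finally show "expectation S \<le> expectation (\<lambda>\<omega>. G (Z t \<omega>)) - G x + c * expectation (Y t)
      - (\<Sum>i<n. t / n * expectation (\<lambda>\<omega>. gen (Z (t * real i / n) \<omega>))) + n * step_error (t / n)"
    by (simp add: sum_subtractf)
qed

text \<open>As \<open>G z + c * z\<close> is nondecreasing, the grid sums are nonnegative and Fatou
  bounds the mean of their lower limit by the limit \<open>R\<close> of the bounds on their means.
  Path by path, this lower limit together with the jump costs and the cost of the continuous part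
  dominates \<open>c * Y t\<close>, and the mean of \<open>c * Y t\<close> also occurs in
  \<open>R\<close>, so it cancels.\<close>

lemma expected_cost_lower_bound:
  fixes t c k :: real
  assumes t: "t > 0" and Y: "integrable M (Y t)" and c: "c \<ge> 0" and k: "k \<ge> 0"
    and G'_ge: "\<And>z. G' z \<ge> - c" and c_slope: "ennreal c \<le> slope_at_zero K"
    and G_jump: "\<And>z1 z2. z1 > z2 \<Longrightarrow> G z1 - G z2 \<ge> - K (z1 - z2)"
    and K0: "K 0 = 0" and K_nonneg: "\<And>\<xi>. \<xi> \<ge> 0 \<Longrightarrow> K \<xi> \<ge> 0"
    and h[measurable]: "h \<in> borel_measurable borel"
    and h_fin: "(\<integral>\<^sup>+\<omega>. (\<integral>\<^sup>+u\<in>{0..t}. ennreal (h (right_version Z u \<omega>)) \<partial>lborel) \<partial>M) < \<infinity>"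
  shows "ennreal (enn2real (\<integral>\<^sup>+\<omega>. (\<integral>\<^sup>+u\<in>{0..t}. ennreal (h (right_version Z u \<omega>)) \<partial>lborel) \<partial>M)
      + k * expectation (Y t) + (LINT u:{0..t}|lborel. mean_gen u) + G x - expectation (\<lambda>\<omega>. G (Z t \<omega>)))
    \<le> (\<integral>\<^sup>+\<omega>. path_cost h K k (\<lambda>u. inventory \<mu> \<sigma> B x Y u \<omega>) (\<lambda>u. Y u \<omega>) t \<partial>M)"
proof -
  define H where "H \<omega> = (\<integral>\<^sup>+u\<in>{0..t}. ennreal (h (right_version Z u \<omega>)) \<partial>lborel)" for \<omega>
  define Gc where "Gc z = G z + c * z" for z
  define S where "S n \<omega> = grid_sum Gc (\<lambda>s. X s \<omega>) (\<lambda>s. Y s \<omega>) t n" for n \<omega>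
  define LL where "LL \<omega> = liminf (\<lambda>n. ennreal (S n \<omega>))" for \<omega>
  have Hm[measurable]: "H \<in> borel_measurable M"
  proof -
    have "(\<lambda>(\<omega>, u). ennreal (h (right_version Z u \<omega>)) * indicator {0..t} u) \<in> borel_measurable (M \<Otimes>\<^sub>M lborel)"
      unfolding case_prod_beta
      using measurable_compose[OF measurable_pair_swap' measurable_right_version_Z]
      by (auto simp: case_prod_beta intro!: borel_measurable_times_ennreal)
    then show ?thesis unfolding H_def by (rule lborel.borel_measurable_nn_integral)
  qed
  have Si: "integrable M (S n)" if "n > 0" for n
    using expected_grid_sum(1)[OF t Y that, of c] by (simp add: S_def[abs_def] Gc_def[abs_def])
  have S0: "S 0 = (\<lambda>\<omega>. Gc (X 0 \<omega> + Y 0 \<omega>) - Gc (X 0 \<omega>))"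
    by (simp add: S_def[abs_def] grid_sum_def)
  have Sm[measurable]: "S n \<in> borel_measurable M" for n
  proof (cases "n = 0")
    case True
    have [measurable]: "X 0 \<in> borel_measurable M" "Y 0 \<in> borel_measurable M"
      using X_measurable Y_measurable by auto
    show ?thesis unfolding True S0 Gc_def by measurable
  qed (use Si borel_measurable_integrable in auto)
  have Gc_cont: "continuous_on UNIV Gc" unfolding Gc_def by (intro continuous_intros continuous_G)
  have Gc_mono: "Gc a \<le> Gc b" if "a \<le> b" for a b
  proof (rule DERIV_nonneg_imp_nondecreasing[OF that])
    fix z
    have "(Gc has_real_derivative G' z + c) (at z)" unfolding Gc_def by (auto intro!: derivative_eq_intros dG)
    moreover have "0 \<le> G' z + c" using G'_ge[of z] by simp
    ultimately show "\<exists>y. (Gc has_real_derivative y) (at z) \<and> 0 \<le> y" by blast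
  qed
  have Gc_jump: "Gc b - Gc a \<ge> c * (b - a) - K (b - a)" if "a < b" for a b
    using G_jump[OF that] by (simp add: Gc_def algebra_simps)
  have X_cont: "continuous_on {0..} (\<lambda>s. X s \<omega>)" if "continuous_on {0..} (\<lambda>t. B t \<omega>)" for \<omega>
    unfolding X_def by (intro continuous_intros that)
  let ?T = "\<lambda>\<omega>. (\<Sum>\<^sub>\<infinity>u\<in>{0..t}. ennreal (K (jump (\<lambda>u. Y u \<omega>) u))) + slope_at_zero K * ennreal (continuous_part (\<lambda>u. Y u \<omega>) t)"
  have pathwise: "AE \<omega> in M. (\<forall>n. 0 \<le> S n \<omega>) \<and> ennreal (c * Y t \<omega>) \<le> LL \<omega> + ?T \<omega>"
    using AE_good AE_space
  proof eventually_elim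
    case (elim \<omega>)
    note Yp = Y_props[of \<omega>] and Xc = X_cont[of \<omega>]
    have S_nonneg: "0 \<le> S n \<omega>" for n
      unfolding S_def
      by (rule grid_sum_nonneg[OF t c _ _ _ _ _ Gc_cont Gc_mono Gc_jump K0 K_nonneg]) (use elim Yp Xc in auto)
    have "ennreal (c * Y t \<omega>) \<le> LL \<omega> + ((\<Sum>\<^sub>\<infinity>u\<in>{0..t}. ennreal (K (jump (\<lambda>u. Y u \<omega>) u)))
        + ennreal c * ennreal (continuous_part (\<lambda>u. Y u \<omega>) t))"
      unfolding S_def LL_def
      by (rule liminf_grid_sum_ge[OF t c _ _ _ _ _ Gc_cont Gc_mono Gc_jump K0 K_nonneg]) (use elim Yp Xc in auto)
    also have "\<dots> \<le> LL \<omega> + ?T \<omega>"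
      using c_slope by (intro add_left_mono mult_right_mono) auto
    finally show ?case using S_nonneg by blast
  qed
  define I where "I = (LINT u:{0..t}|lborel. mean_gen u)"
  define R where "R = expectation (\<lambda>\<omega>. G (Z t \<omega>)) - G x + c * expectation (Y t) - I"
  define Rn where "Rn n = expectation (\<lambda>\<omega>. G (Z t \<omega>)) - G x + c * expectation (Y t)
      - (\<Sum>i<n. t / n * expectation (\<lambda>\<omega>. gen (Z (t * real i / n) \<omega>))) + n * step_error (t / n)" for n :: nat
  have Rn: "Rn \<longlonglongrightarrow> R"
    unfolding Rn_def R_def I_def
    using tendsto_add[OF tendsto_diff[OF tendsto_const mean_gen_riemann_sum[OF t]] step_error_vanishes[OF t]] by simp
  have ES: "expectation (S n) \<le> Rn n" if "n > 0" for n
    using expected_grid_sum(2)[OF t Y that, of c] by (simp add: S_def[abs_def] Gc_def[abs_def] Rn_def)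
  have nS: "(\<integral>\<^sup>+\<omega>. ennreal (S n \<omega>) \<partial>M) = ennreal (expectation (S n))" if "n > 0" for n
    using Si[OF that] pathwise by (intro nn_integral_eq_integral) (auto elim: eventually_mono)
  have LLm[measurable]: "LL \<in> borel_measurable M" unfolding LL_def by measurable
  have "(\<integral>\<^sup>+\<omega>. LL \<omega> \<partial>M) \<le> liminf (\<lambda>n. \<integral>\<^sup>+\<omega>. ennreal (S n \<omega>) \<partial>M)"
    unfolding LL_def by (intro nn_integral_liminf) measurable
  also have "\<dots> \<le> liminf (\<lambda>n. ennreal (Rn n))"
  proof (rule Liminf_mono)
    have le: "(\<integral>\<^sup>+\<omega>. ennreal (S n \<omega>) \<partial>M) \<le> ennreal (Rn n)" if "0 < n" for n
      unfolding nS[OF that] by (rule ennreal_leI[OF ES[OF that]])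
    show "\<forall>\<^sub>F n in sequentially. (\<integral>\<^sup>+\<omega>. ennreal (S n \<omega>) \<partial>M) \<le> ennreal (Rn n)"
      by (rule eventually_mono[OF eventually_gt_at_top[of 0] le])
  qed
  also have "\<dots> = ennreal R"
    using tendsto_ennrealI[OF Rn] by (intro lim_imp_Liminf) auto
  finally have LL_le: "(\<integral>\<^sup>+\<omega>. LL \<omega> \<partial>M) \<le> ennreal R" .
  have R0: "R \<ge> 0"
  proof (rule LIMSEQ_le_const[OF Rn])
    have "0 \<le> Rn n" if "n \<ge> 1" for n
    proof -
      have "0 \<le> expectation (S n)" using pathwise by (intro integral_nonneg_AE) (auto elim: eventually_mono)
      then show ?thesis using ES[of n] that by simp
    qed
    then show "\<exists>N. \<forall>n\<ge>N. 0 \<le> Rn n" by blast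
  qed
  have LL_fin: "(\<integral>\<^sup>+\<omega>. LL \<omega> \<partial>M) \<noteq> \<infinity>" using LL_le by (auto simp: top_unique)
  have AE_LL: "AE \<omega> in M. LL \<omega> \<noteq> \<infinity>" by (rule nn_integral_noteq_infinite[OF LLm LL_fin])
  define L where "L \<omega> = enn2real (LL \<omega>)" for \<omega>
  have Lm[measurable]: "L \<in> borel_measurable M" unfolding L_def by measurable
  have L_eq: "AE \<omega> in M. ennreal (L \<omega>) = LL \<omega>"
    using AE_LL by eventually_elim (simp add: L_def less_top)
  have nL: "(\<integral>\<^sup>+\<omega>. ennreal (L \<omega>) \<partial>M) \<le> ennreal R"
    using LL_le nn_integral_cong_AE[OF L_eq] by simp
  have Li: "integrable M L"
    using nL by (intro integrableI_nonneg) (auto simp: L_def intro: order.strict_trans1)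
  have "ennreal (expectation L) \<le> ennreal R"
    using nL nn_integral_eq_integral[OF Li] by (simp add: L_def)
  then have EL: "expectation L \<le> R" using R0 by simp
  have Hfin: "integral\<^sup>N M H < \<infinity>" using h_fin by (simp add: H_def[abs_def])
  then have AE_H: "AE \<omega> in M. H \<omega> \<noteq> \<infinity>" by (intro nn_integral_noteq_infinite) auto
  define Hr where "Hr \<omega> = enn2real (H \<omega>)" for \<omega>
  have Hrm[measurable]: "Hr \<in> borel_measurable M" unfolding Hr_def by measurable
  have H_eq: "AE \<omega> in M. ennreal (Hr \<omega>) = H \<omega>"
    using AE_H by eventually_elim (simp add: Hr_def less_top)
  have nH: "(\<integral>\<^sup>+\<omega>. ennreal (Hr \<omega>) \<partial>M) = integral\<^sup>N M H" using nn_integral_cong_AE[OF H_eq] .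
  have Hri: "integrable M Hr"
    using nH Hfin by (intro integrableI_nonneg) (auto simp: Hr_def)
  have EH: "expectation Hr = enn2real (integral\<^sup>N M H)"
    unfolding nH[symmetric] by (rule integral_eq_nn_integral) (auto simp: Hr_def)
  \<comment> \<open>Bounding the mean of \<open>L\<close> by \<open>R\<close> cancels
    \<open>c * expectation (Y t)\<close> and leaves the integral of the generator and the boundary
    values of \<open>G\<close>.\<close>
  let ?V = "\<lambda>\<omega>. Hr \<omega> + k * Y t \<omega> + (c * Y t \<omega> - L \<omega>)"
  have Vi: "integrable M ?V" using Hri Li Y by simp
  have "enn2real (integral\<^sup>N M H) + k * expectation (Y t) + I + G x - expectation (\<lambda>\<omega>. G (Z t \<omega>)) \<le> expectation ?V"
    using EL EH Hri Li Y by (simp add: R_def)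
  then have "ennreal (enn2real (integral\<^sup>N M H) + k * expectation (Y t) + I + G x - expectation (\<lambda>\<omega>. G (Z t \<omega>)))
      \<le> ennreal (expectation ?V)" by (rule ennreal_leI)
  also have "\<dots> \<le> (\<integral>\<^sup>+\<omega>. ennreal (?V \<omega>) \<partial>M)" by (rule ennreal_integral_le_nn_integral[OF Vi])
  also have "\<dots> \<le> (\<integral>\<^sup>+\<omega>. path_cost h K k (\<lambda>u. inventory \<mu> \<sigma> B x Y u \<omega>) (\<lambda>u. Y u \<omega>) t \<partial>M)"
  proof (rule nn_integral_mono_AE)
    show "AE \<omega> in M. ennreal (?V \<omega>) \<le> path_cost h K k (\<lambda>u. inventory \<mu> \<sigma> B x Y u \<omega>) (\<lambda>u. Y u \<omega>) t"
      using pathwise L_eq H_eq AE_right_version_Z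
    proof eventually_elim
      case (elim \<omega>)
      have "(\<integral>\<^sup>+u\<in>{0..t}. ennreal (h (inventory \<mu> \<sigma> B x Y u \<omega>)) \<partial>lborel) = H \<omega>"
        unfolding H_def using elim(4) by (intro nn_integral_cong) (auto simp: inventory_eq_Z indicator_def)
      then have 1: "(\<integral>\<^sup>+u\<in>{0..t}. ennreal (h (inventory \<mu> \<sigma> B x Y u \<omega>)) \<partial>lborel) = ennreal (Hr \<omega>)"
        using elim(3) by simp
      have "ennreal (c * Y t \<omega>) \<le> ennreal (L \<omega>) + ?T \<omega>" using elim(1,2) by simp
      \<comment> \<open>The cost term on the right may be infinite, so the finite \<open>L\<close>
        is moved over by truncated subtraction.\<close>
      then have "ennreal (c * Y t \<omega>) - ennreal (L \<omega>) \<le> ?T \<omega>"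
        by (simp add: ennreal_minus_le_iff)
      then have 2: "ennreal (c * Y t \<omega> - L \<omega>) \<le> ?T \<omega>"
        by (simp add: ennreal_minus L_def)
      have "ennreal (?V \<omega>) \<le> ennreal (Hr \<omega>) + ennreal (k * Y t \<omega>) + ennreal (c * Y t \<omega> - L \<omega>)"
        by (intro order_trans[OF ennreal_add_le_add] add_mono ennreal_add_le_add order_refl)
      also have "\<dots> \<le> ennreal (Hr \<omega>) + ennreal (k * Y t \<omega>) + ?T \<omega>" using 2 by (intro add_left_mono)
      also have "\<dots> = path_cost h K k (\<lambda>u. inventory \<mu> \<sigma> B x Y u \<omega>) (\<lambda>u. Y u \<omega>) t"
        unfolding path_cost_def 1 by (simp add: ac_simps)
      finally show ?case .
    qed
  qed
  finally show ?thesis unfolding I_def H_def .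
qed

end

section \<open>The cost bound\<close>

text \<open>Dividing the jump inequality by the jump size bounds the difference quotient below by
  \<open>- K \<xi> / \<xi>\<close>. If \<open>- D\<close> exceeded \<open>l\<close>, then
  \<open>K \<xi> / \<xi>\<close> would stay above the midpoint \<open>r\<close> near zero, against
  the lower limit \<open>l\<close>.\<close>

lemma neg_slope_le_derivative:
  fixes f K :: "real \<Rightarrow> real"
  assumes der: "(f has_real_derivative D) (at z)"
    and jump: "\<And>\<xi>. \<xi> > 0 \<Longrightarrow> f (z + \<xi>) - f z \<ge> - K \<xi>"
    and slope: "slope_at_zero K = ennreal l" and l: "l \<ge> 0"
  shows "D \<ge> - l"
proof (rule ccontr)
  assume less: "\<not> - l \<le> D"
  define r where "r = (l - D) / 2"
  have r: "l < r" "D < - r" using less by (auto simp: r_def field_simps)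
  have "((\<lambda>\<xi>. (f (z + \<xi>) - f z) / \<xi>) \<longlongrightarrow> D) (at_right 0)"
    using der unfolding DERIV_def by (rule tendsto_mono[OF at_le[OF subset_UNIV]])
  from order_tendstoD(2)[OF this r(2)]
  have ev: "\<forall>\<^sub>F \<xi> in at_right 0. (f (z + \<xi>) - f z) / \<xi> < - r" .
  have "\<forall>\<^sub>F \<xi> in at_right 0. ennreal r \<le> ennreal (K \<xi> / \<xi>)"
    using ev eventually_at_right_less[of 0]
  proof eventually_elim
    case (elim \<xi>)
    have "- K \<xi> / \<xi> \<le> (f (z + \<xi>) - f z) / \<xi>" using jump elim(2) by (intro divide_right_mono) auto
    then show ?case using elim(1) by (intro ennreal_leI) simp
  qed
  then have "ennreal r \<le> slope_at_zero K" unfolding slope_at_zero_def by (rule Liminf_bounded)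
  then show False using slope l r by simp
qed

lemma power_add_le_even:
  fixes p q :: real
  shows "(p + q) ^ (2 * a) \<le> 2 ^ (2 * a) * (p ^ (2 * a) + q ^ (2 * a))"
proof -
  have pw: "r ^ (2 * a) = \<bar>r\<bar> ^ (2 * a)" for r :: real by (simp add: power_even_abs)
  have "\<bar>p + q\<bar> ^ (2 * a) \<le> (2 * max \<bar>p\<bar> \<bar>q\<bar>) ^ (2 * a)"
    by (intro power_mono) auto
  also have "\<dots> = 2 ^ (2 * a) * (max \<bar>p\<bar> \<bar>q\<bar>) ^ (2 * a)" by (rule power_mult_distrib)
  also have "\<dots> \<le> 2 ^ (2 * a) * (\<bar>p\<bar> ^ (2 * a) + \<bar>q\<bar> ^ (2 * a))"
    by (intro mult_left_mono) (auto simp: max_def)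
  finally show ?thesis using pw[of p] pw[of q] pw[of "p + q"] by simp
qed

section \<open>Polynomial moments, and the product of time and sample space\<close>

context inventory_model
begin

text \<open>Supplies the majorant for removing the mollification: \<open>X\<close> has all moments,
  whereas those of \<open>Z\<close> are not under control. The shift by 1 is the largest
  displacement \<open>2 * \<eta>\<close> occurring there. Positive times are those where
  \<open>B\<close> has a normal density.\<close>

lemma shifted_X_cost_bound:
  fixes h :: "real \<Rightarrow> real"
  assumes h_growth: "\<And>z. h z \<le> b0 + b1 * \<bar>z\<bar> ^ a" and b: "b0 \<ge> 0" "b1 \<ge> 0"
  shows "\<exists>C. \<forall>u. 0 < u \<longrightarrow> u \<le> t \<longrightarrow> (\<integral>\<^sup>+\<omega>. ennreal (h (X u \<omega> - 1)) \<partial>M) \<le> ennreal C"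
proof -
  \<comment> \<open>\<open>m\<close> is the moment of order \<open>2 * a\<close> of a standard
    normal variable; \<open>c\<close> bounds the modulus of the deterministic part of
    \<open>X u \<omega> - 1\<close> for \<open>u \<le> t\<close>.\<close>
  define m :: real where "m = fact (2 * a) / (2 ^ a * fact a)"
  define c where "c = \<bar>x\<bar> + 1 + \<mu> * t"
  define C where "C = b0 + b1 * (1 + 2 ^ (2 * a) * (c ^ (2 * a) + \<sigma> ^ (2 * a) * (m * t ^ a)))"
  have "(\<integral>\<^sup>+\<omega>. ennreal (h (X u \<omega> - 1)) \<partial>M) \<le> ennreal C" if u: "0 < u" "u \<le> t" for u
  proof -
    let ?g = "\<lambda>\<omega>. b0 + b1 * (1 + 2 ^ (2 * a) * (c ^ (2 * a) + \<sigma> ^ (2 * a) * (B u \<omega>) ^ (2 * a)))"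
    have le: "h (X u \<omega> - 1) \<le> ?g \<omega>" for \<omega>
    proof -
      let ?p = "x - 1 - \<mu> * u" and ?q = "\<sigma> * B u \<omega>"
      have eq: "X u \<omega> - 1 = ?p + ?q" by (simp add: X_def)
      have "\<mu> * u \<le> \<mu> * t" using u mu by simp
      moreover have "0 \<le> \<mu> * u" using u mu by simp
      ultimately have "\<bar>?p\<bar> \<le> c" unfolding c_def by linarith
      then have "\<bar>?p\<bar> ^ (2 * a) \<le> c ^ (2 * a)" by (intro power_mono) auto
      then have p: "?p ^ (2 * a) \<le> c ^ (2 * a)" by (simp add: power_even_abs)
      have "\<bar>X u \<omega> - 1\<bar> ^ a \<le> 1 + (?p + ?q) ^ (2 * a)" unfolding eq by (rule power_le_one_add_even)
      also have "\<dots> \<le> 1 + 2 ^ (2 * a) * (?p ^ (2 * a) + ?q ^ (2 * a))"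
        by (intro add_left_mono power_add_le_even)
      also have "\<dots> \<le> 1 + 2 ^ (2 * a) * (c ^ (2 * a) + ?q ^ (2 * a))"
        using p by (intro add_left_mono mult_left_mono add_right_mono) auto
      finally have "b1 * \<bar>X u \<omega> - 1\<bar> ^ a \<le> b1 * (1 + 2 ^ (2 * a) * (c ^ (2 * a) + ?q ^ (2 * a)))"
        using b by (intro mult_left_mono)
      then show ?thesis using h_growth[of "X u \<omega> - 1"] by (simp add: power_mult_distrib)
    qed
    have int: "integrable M ?g" using B_moments(1)[OF u(1)] by simp
    have pos: "0 \<le> ?g \<omega>" for \<omega> using b sigma by simp
    have "(\<integral>\<^sup>+\<omega>. ennreal (h (X u \<omega> - 1)) \<partial>M) \<le> (\<integral>\<^sup>+\<omega>. ennreal (?g \<omega>) \<partial>M)"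
      by (intro nn_integral_mono ennreal_leI le)
    also have "\<dots> = ennreal (expectation ?g)"
      using int pos by (intro nn_integral_eq_integral) auto
    also have "expectation ?g = b0 + b1 * (1 + 2 ^ (2 * a) * (c ^ (2 * a) + \<sigma> ^ (2 * a) * (m * u ^ a)))"
      using B_moments(1,2)[OF u(1), of a] by (simp add: prob_space m_def)
    also have "\<dots> \<le> C"
      unfolding C_def using b u sigma
      by (intro add_left_mono mult_left_mono power_mono) (auto simp: m_def)
    finally show ?thesis by (simp add: ennreal_leI)
  qed
  then show ?thesis by blast
qed

abbreviation "time_space \<equiv> (lborel :: real measure) \<Otimes>\<^sub>M M"

abbreviation "window t p \<equiv> (indicator {0..t} (fst p) :: real)"

abbreviation "Zv p \<equiv> right_version Z (fst p) (snd p)"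

lemma nn_integral_time_space:
  assumes "g \<in> borel_measurable time_space"
  shows "(\<integral>\<^sup>+p. g p \<partial>time_space) = (\<integral>\<^sup>+u. \<integral>\<^sup>+\<omega>. g (u, \<omega>) \<partial>M \<partial>lborel)"
    "(\<integral>\<^sup>+p. g p \<partial>time_space) = (\<integral>\<^sup>+\<omega>. \<integral>\<^sup>+u. g (u, \<omega>) \<partial>lborel \<partial>M)"
proof -
  interpret P: pair_sigma_finite lborel M ..
  show "(\<integral>\<^sup>+p. g p \<partial>time_space) = (\<integral>\<^sup>+u. \<integral>\<^sup>+\<omega>. g (u, \<omega>) \<partial>M \<partial>lborel)"
    using nn_integral_fst[OF assms] by simp
  show "(\<integral>\<^sup>+p. g p \<partial>time_space) = (\<integral>\<^sup>+\<omega>. \<integral>\<^sup>+u. g (u, \<omega>) \<partial>lborel \<partial>M)"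
    using P.nn_integral_snd[OF assms] by simp
qed

lemma window_integrable:
  assumes t: "t \<ge> 0"
  shows "integrable time_space (window t)" "(\<integral>p. window t p \<partial>time_space) = t"
proof -
  have "(\<integral>\<^sup>+p. ennreal (window t p) \<partial>time_space) = (\<integral>\<^sup>+u. indicator {0..t} u \<partial>lborel)"
    by (subst nn_integral_time_space(1)) (simp_all add: emeasure_space_1 ennreal_indicator)
  also have "\<dots> = ennreal t" using t by simp
  finally have n: "(\<integral>\<^sup>+p. ennreal (window t p) \<partial>time_space) = ennreal t" .
  then show "integrable time_space (window t)" by (intro integrableI_nonneg) auto
  show "(\<integral>p. window t p \<partial>time_space) = t"
    using n t by (subst integral_eq_nn_integral) auto
qed

section \<open>Removing the mollification\<close>

context
  fixes f f' h K :: "real \<Rightarrow> real" and k \<nu> A m c t :: real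
  assumes t: "t > 0" and Y: "integrable M (Y t)" and c: "c \<ge> 0" and k: "k \<ge> 0"
    and df: "\<And>z. (f has_real_derivative f' z) (at z)" and f'_cont: "continuous_on UNIV f'"
    and h_cont: "continuous_on UNIV h" and h_nonneg: "\<And>z. h z \<ge> 0"
    and h_max: "\<And>x y z. x \<le> y \<Longrightarrow> y \<le> z \<Longrightarrow> h y \<le> max (h x) (h z)"
    and h_far: "\<And>z. z \<ge> m \<Longrightarrow> h z \<ge> \<nu>"
    and f'_bound: "\<And>z. \<bar>f' z\<bar> \<le> A" and f'_far: "\<And>z. z \<ge> m \<Longrightarrow> f' z = 0" and f'_ge: "\<And>z. f' z \<ge> - c"
    and c_slope: "ennreal c \<le> slope_at_zero K"
    and jump: "\<And>z1 z2. z1 > z2 \<Longrightarrow> f z1 - f z2 \<ge> - K (z1 - z2)"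
    and K0: "K 0 = 0" and K_nonneg: "\<And>\<xi>. \<xi> \<ge> 0 \<Longrightarrow> K \<xi> \<ge> 0"
    and gen_f: "\<And>a b. a \<le> b \<Longrightarrow> integral {a..b} (\<lambda>z. \<mu> * f' z + \<nu> - h z) \<le> \<sigma>\<^sup>2 / 2 * (f' b - f' a)"
    and h_fin: "(\<integral>\<^sup>+\<omega>. (\<integral>\<^sup>+u\<in>{0..t}. ennreal (h (right_version Z u \<omega>)) \<partial>lborel) \<partial>M) < \<infinity>"
begin

text \<open>
  Mollification replaces \<open>h\<close> by an average, which may exceed \<open>h\<close> by this amount. Beyond \<open>m + 1\<close> the
  mollified potential is constant and nothing is lost.
\<close>

definition excess :: "real \<Rightarrow> real \<Rightarrow> real" where
  "excess \<eta> z = (if z \<le> m + 1 then max (h (z - 2 * \<eta>)) (h (z + 2 * \<eta>)) - h z else 0)"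

lemma h_measurable[measurable]: "h \<in> borel_measurable borel"
  using h_cont by (rule borel_measurable_continuous_onI)

lemma excess_measurable[measurable]: "excess \<eta> \<in> borel_measurable borel"
  unfolding excess_def[abs_def] by measurable

lemma nn_h: "(\<integral>\<^sup>+p. ennreal (window t p * h (Zv p)) \<partial>time_space)
    = (\<integral>\<^sup>+\<omega>. (\<integral>\<^sup>+u\<in>{0..t}. ennreal (h (right_version Z u \<omega>)) \<partial>lborel) \<partial>M)"
  by (subst nn_integral_time_space(2))
    (auto intro!: nn_integral_cong simp: ennreal_mult' ennreal_indicator mult.commute indicator_def)

lemma h_integrable: "integrable time_space (\<lambda>p. window t p * h (Zv p))"
  using h_fin nn_h h_nonneg by (intro integrableI_nonneg) auto

text \<open>The lower bound for smooth potentials is applied to the mollified one. Its generator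
  plus \<open>h\<close> falls short of \<open>\<nu>\<close> by at most the excess, and passing from
  \<open>G\<close> back to \<open>f\<close> costs \<open>2 * \<eta> * A\<close> at the start and
  again at the end.\<close>

lemma mollified_cost:
  assumes eta: "0 < \<eta>" "\<eta> \<le> 1 / 2" and ei: "integrable time_space (\<lambda>p. window t p * excess \<eta> (Zv p))"
  shows "ennreal (k * expectation (Y t) + \<nu> * t - (\<integral>p. window t p * excess \<eta> (Zv p) \<partial>time_space)
      + f x - expectation (\<lambda>\<omega>. f (Z t \<omega>)) - 4 * \<eta> * A)
    \<le> (\<integral>\<^sup>+\<omega>. path_cost h K k (\<lambda>u. inventory \<mu> \<sigma> B x Y u \<omega>) (\<lambda>u. Y u \<omega>) t \<partial>M)"
proof -
  have s2: "\<sigma>\<^sup>2 / 2 > 0" using sigma by simp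
  have "\<exists>G G' G'' L1 L2. (\<forall>z. (G has_real_derivative G' z) (at z)) \<and> (\<forall>z. (G' has_real_derivative G'' z) (at z)) \<and>
    (\<forall>x y. \<bar>G'' x - G'' y\<bar> \<le> L2 * \<bar>x - y\<bar>) \<and> (\<forall>z. \<bar>G'' z\<bar> \<le> L1) \<and> (\<forall>z. \<bar>G' z\<bar> \<le> A) \<and> (\<forall>z. G' z \<ge> - c) \<and>
    (\<forall>z1 z2. z1 > z2 \<longrightarrow> G z1 - G z2 \<ge> - K (z1 - z2)) \<and>
    (\<forall>z. \<sigma>\<^sup>2 / 2 * G'' z - \<mu> * G' z \<ge> \<nu> - max (h (z - 2 * \<eta>)) (h (z + 2 * \<eta>))) \<and>
    (\<forall>z\<ge>m + 2 * \<eta>. G' z = 0 \<and> G'' z = 0) \<and> (\<forall>z. \<bar>G z - f z\<bar> \<le> 2 * \<eta> * A)"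
    by (rule mollified_potential[OF s2 eta(1) df f'_cont h_cont h_max f'_bound f'_far f'_ge jump gen_f])
  then obtain G G' G'' L1 L2 where G0: "(\<forall>z. (G has_real_derivative G' z) (at z)) \<and> (\<forall>z. (G' has_real_derivative G'' z) (at z)) \<and>
    (\<forall>x y. \<bar>G'' x - G'' y\<bar> \<le> L2 * \<bar>x - y\<bar>) \<and> (\<forall>z. \<bar>G'' z\<bar> \<le> L1) \<and> (\<forall>z. \<bar>G' z\<bar> \<le> A) \<and> (\<forall>z. G' z \<ge> - c) \<and>
    (\<forall>z1 z2. z1 > z2 \<longrightarrow> G z1 - G z2 \<ge> - K (z1 - z2)) \<and>
    (\<forall>z. \<sigma>\<^sup>2 / 2 * G'' z - \<mu> * G' z \<ge> \<nu> - max (h (z - 2 * \<eta>)) (h (z + 2 * \<eta>))) \<and>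
    (\<forall>z\<ge>m + 2 * \<eta>. G' z = 0 \<and> G'' z = 0) \<and> (\<forall>z. \<bar>G z - f z\<bar> \<le> 2 * \<eta> * A)"
    by (elim exE)
  have G: "\<And>z. (G has_real_derivative G' z) (at z)"
    "\<And>z. (G' has_real_derivative G'' z) (at z)" "\<And>x y. \<bar>G'' x - G'' y\<bar> \<le> L2 * \<bar>x - y\<bar>"
    "\<And>z. \<bar>G'' z\<bar> \<le> L1" "\<And>z. \<bar>G' z\<bar> \<le> A" "\<And>z. G' z \<ge> - c"
    "\<And>z1 z2. z1 > z2 \<Longrightarrow> G z1 - G z2 \<ge> - K (z1 - z2)"
    "\<And>z. \<sigma>\<^sup>2 / 2 * G'' z - \<mu> * G' z \<ge> \<nu> - max (h (z - 2 * \<eta>)) (h (z + 2 * \<eta>))"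
    "\<And>z. z \<ge> m + 2 * \<eta> \<Longrightarrow> G' z = 0 \<and> G'' z = 0" "\<And>z. \<bar>G z - f z\<bar> \<le> 2 * \<eta> * A"
    using G0 by blast+
  interpret S: smooth_potential M F B Y \<mu> \<sigma> x G G' G'' L1 L2 A
    by unfold_locales (use G in auto)
  have cost: "ennreal (enn2real (\<integral>\<^sup>+\<omega>. (\<integral>\<^sup>+u\<in>{0..t}. ennreal (h (right_version Z u \<omega>)) \<partial>lborel) \<partial>M)
      + k * expectation (Y t) + (LINT u:{0..t}|lborel. S.mean_gen u) + G x - expectation (\<lambda>\<omega>. G (Z t \<omega>)))
    \<le> (\<integral>\<^sup>+\<omega>. path_cost h K k (\<lambda>u. inventory \<mu> \<sigma> B x Y u \<omega>) (\<lambda>u. Y u \<omega>) t \<partial>M)"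
    by (rule S.expected_cost_lower_bound[OF t Y c k G(6) c_slope G(7) K0 K_nonneg h_measurable h_fin])
  have H: "enn2real (\<integral>\<^sup>+\<omega>. (\<integral>\<^sup>+u\<in>{0..t}. ennreal (h (right_version Z u \<omega>)) \<partial>lborel) \<partial>M)
      = (\<integral>p. window t p * h (Zv p) \<partial>time_space)"
    unfolding nn_h[symmetric] using h_nonneg by (intro integral_eq_nn_integral[symmetric]) auto
  have w: "integrable time_space (window t)" "(\<integral>p. window t p \<partial>time_space) = t"
    using window_integrable[of t] t by auto
  define Cg where "Cg = \<sigma>\<^sup>2 / 2 * L1 + \<mu> * A"
  have gi: "integrable time_space (\<lambda>p. window t p * S.gen (Zv p))"
  proof (rule Bochner_Integration.integrable_bound)
    show "integrable time_space (\<lambda>p. Cg * window t p)" using w by simp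
    show "AE p in time_space. norm (window t p * S.gen (Zv p)) \<le> norm (Cg * window t p)"
      using S.gen_bound by (intro AE_I2) (auto simp: indicator_def Cg_def abs_mult intro: order_trans[OF _ abs_ge_self])
  qed measurable
  have Gi: "(LINT u:{0..t}|lborel. S.mean_gen u) = (\<integral>p. window t p * S.gen (Zv p) \<partial>time_space)"
  proof -
    interpret P: pair_sigma_finite lborel M ..
    show ?thesis
      using P.integral_fst'[OF gi] by (simp add: set_lebesgue_integral_def S.mean_gen_def)
  qed
  have "(\<integral>p. \<nu> * window t p - window t p * excess \<eta> (Zv p) \<partial>time_space)
      \<le> (\<integral>p. window t p * h (Zv p) + window t p * S.gen (Zv p) \<partial>time_space)"
  proof (rule integral_mono)
    \<comment> \<open>A point \<open>z > m + 1\<close> lies beyond \<open>m + 2 * \<eta>\<close>, so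
      the generator vanishes there and \<open>h z\<close> alone is at least
      \<open>\<nu>\<close>.\<close>
    have "\<nu> - excess \<eta> z \<le> h z + S.gen z" for z
    proof (cases "z \<le> m + 1")
      case True
      then show ?thesis using G(8)[of z] by (simp add: excess_def S.gen_def)
    next
      case False
      then show ?thesis using G(9)[of z] h_far[of z] eta by (simp add: excess_def S.gen_def)
    qed
    then show "\<nu> * window t p - window t p * excess \<eta> (Zv p) \<le> window t p * h (Zv p) + window t p * S.gen (Zv p)" for p
      by (simp add: indicator_def)
  qed (use w ei gi h_integrable in simp_all)
  then have main: "\<nu> * t - (\<integral>p. window t p * excess \<eta> (Zv p) \<partial>time_space)
      \<le> (\<integral>p. window t p * h (Zv p) \<partial>time_space) + (\<integral>p. window t p * S.gen (Zv p) \<partial>time_space)"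
    using w ei gi h_integrable by simp
  have Zt: "integrable M (Z t)" unfolding Z_def[abs_def] using integrable_X[of t] t Y by simp
  have GZ: "integrable M (\<lambda>\<omega>. G (Z t \<omega>))" by (rule S.integrable_G[OF Zt])
  have fm[measurable]: "f \<in> borel_measurable borel"
    using df by (meson DERIV_isCont continuous_at_imp_continuous_on borel_measurable_continuous_onI)
  have Zm[measurable]: "Z t \<in> borel_measurable M" using Zt by simp
  have di: "integrable M (\<lambda>\<omega>. G (Z t \<omega>) - f (Z t \<omega>))"
    using G(10) by (intro integrable_const_bound[where B = "2 * \<eta> * A"]) auto
  then have "expectation (\<lambda>\<omega>. G (Z t \<omega>) - f (Z t \<omega>)) \<le> expectation (\<lambda>\<omega>. 2 * \<eta> * A)"
    using G(10) by (intro integral_mono) (auto simp: abs_le_iff)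
  moreover have fZ: "integrable M (\<lambda>\<omega>. f (Z t \<omega>))"
    using Bochner_Integration.integrable_diff[OF GZ di] by simp
  ultimately have EG: "expectation (\<lambda>\<omega>. G (Z t \<omega>)) \<le> expectation (\<lambda>\<omega>. f (Z t \<omega>)) + 2 * \<eta> * A"
    using GZ by (simp add: prob_space)
  have "G x \<ge> f x - 2 * \<eta> * A" using G(10)[of x] by (simp add: abs_le_iff)
  with EG main have "k * expectation (Y t) + \<nu> * t - (\<integral>p. window t p * excess \<eta> (Zv p) \<partial>time_space)
      + f x - expectation (\<lambda>\<omega>. f (Z t \<omega>)) - 4 * \<eta> * A
    \<le> enn2real (\<integral>\<^sup>+\<omega>. (\<integral>\<^sup>+u\<in>{0..t}. ennreal (h (right_version Z u \<omega>)) \<partial>lborel) \<partial>M)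
      + k * expectation (Y t) + (LINT u:{0..t}|lborel. S.mean_gen u) + G x - expectation (\<lambda>\<omega>. G (Z t \<omega>))"
    unfolding H Gi by linarith
  then show ?thesis using cost by (meson ennreal_leI order_trans)
qed

text \<open>
  The bound at \<open>y = X u\<close> serves as an integrable majorant: \<open>h (Z u - 1)\<close> itself is not known to be integrable.
\<close>

lemma excess_bounds:
  assumes "0 \<le> \<eta>" "\<eta> \<le> 1 / 2" "y \<le> z"
  shows "0 \<le> excess \<eta> z" "excess \<eta> z \<le> h (y - 1) + h z + h (m + 2)"
proof -
  show "0 \<le> excess \<eta> z" using h_max[of "z - 2 * \<eta>" z "z + 2 * \<eta>"] assms by (simp add: excess_def)
  show "excess \<eta> z \<le> h (y - 1) + h z + h (m + 2)"
  proof (cases "z \<le> m + 1")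
    case True
    have pos: "0 \<le> h z" "0 \<le> h (y - 1)" "0 \<le> h (m + 2)" by (rule h_nonneg)+
    have "h (z - 2 * \<eta>) \<le> max (h (y - 1)) (h z)" using assms by (intro h_max) auto
    then have "h (z - 2 * \<eta>) \<le> h (y - 1) + h z" using pos by linarith
    moreover have "h (z + 2 * \<eta>) \<le> max (h z) (h (m + 2))" using assms True by (intro h_max) auto
    then have "h (z + 2 * \<eta>) \<le> h z + h (m + 2)" using pos by linarith
    ultimately have "max (h (z - 2 * \<eta>)) (h (z + 2 * \<eta>)) - h z \<le> h (y - 1) + h z + h (m + 2)"
      using pos by linarith
    then show ?thesis using True by (simp add: excess_def)
  qed (use h_nonneg in \<open>simp add: excess_def\<close>)
qed

lemma excess_tendsto:
  assumes "e \<longlonglongrightarrow> 0"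
  shows "(\<lambda>n. excess (e n) z) \<longlonglongrightarrow> 0"
proof (cases "z \<le> m + 1")
  case True
  have hc: "isCont h y" for y using h_cont by (simp add: continuous_on_eq_continuous_at)
  have "(\<lambda>n. z - 2 * e n) \<longlonglongrightarrow> z - 2 * 0" "(\<lambda>n. z + 2 * e n) \<longlonglongrightarrow> z + 2 * 0"
    by (intro tendsto_intros assms)+
  then have "(\<lambda>n. z - 2 * e n) \<longlonglongrightarrow> z" "(\<lambda>n. z + 2 * e n) \<longlonglongrightarrow> z" by simp_all
  then have "(\<lambda>n. max (h (z - 2 * e n)) (h (z + 2 * e n)) - h z) \<longlonglongrightarrow> max (h z) (h z) - h z"
    by (intro tendsto_diff tendsto_max tendsto_const isCont_tendsto_compose[OF hc])
  then show ?thesis using True by (simp add: excess_def)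
qed (simp add: excess_def)

text \<open>In the mollified bound \<open>\<eta>\<close> tends to 0: the excess tends to 0 pointwise
  because \<open>h\<close> is continuous, and dominated convergence over time and sample space
  removes its integral.\<close>

lemma potential_cost:
  assumes h_growth: "\<And>z. h z \<le> b0 + b1 * \<bar>z\<bar> ^ a" and b: "b0 \<ge> 0" "b1 \<ge> 0"
  shows "ennreal (k * expectation (Y t) + \<nu> * t + f x - expectation (\<lambda>\<omega>. f (Z t \<omega>)))
    \<le> (\<integral>\<^sup>+\<omega>. path_cost h K k (\<lambda>u. inventory \<mu> \<sigma> B x Y u \<omega>) (\<lambda>u. Y u \<omega>) t \<partial>M)"
    (is "_ \<le> ?cost")
proof -
  \<comment> \<open>The minimum with \<open>Zv\<close> forces \<open>Xv p \<le> Zv p\<close> at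
    every point, as the bound on the excess requires; almost surely it is \<open>X\<close> at all
    nonnegative times, because \<open>Y\<close> is nonnegative.\<close>
  define Xv where "Xv p = min (right_version X (fst p) (snd p)) (Zv p)" for p
  have [measurable]: "Xv \<in> borel_measurable time_space"
    unfolding Xv_def using measurable_right_version[of X M, OF X_measurable] by measurable
  have Xv: "AE \<omega> in M. \<forall>u\<ge>0. Xv (u, \<omega>) = X u \<omega>"
    using AE_good AE_space
  proof eventually_elim
    case (elim \<omega>)
    have "Xv (u, \<omega>) = X u \<omega>" if u: "u \<ge> 0" for u
    proof -
      have "continuous (at_right u) (\<lambda>s. X s \<omega>)"
        unfolding X_def using elim u by (intro continuous_intros B_right_continuous) auto
      then have "right_version X u \<omega> = X u \<omega>" by (rule right_version_eq[OF u])
      moreover have "right_version Z u \<omega> = Z u \<omega>" using elim u by (intro right_version_Z) auto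
      moreover have "X u \<omega> \<le> Z u \<omega>" using Y_props(2)[of \<omega> u] elim u by (simp add: Z_def)
      ultimately show ?thesis by (simp add: Xv_def)
    qed
    then show ?case by blast
  qed
  obtain Cx where Cx: "\<And>u. 0 < u \<Longrightarrow> u \<le> t \<Longrightarrow> (\<integral>\<^sup>+\<omega>. ennreal (h (X u \<omega> - 1)) \<partial>M) \<le> ennreal Cx"
    using shifted_X_cost_bound[OF h_growth b, of t] by blast
  have "(\<integral>\<^sup>+p. ennreal (window t p * h (Xv p - 1)) \<partial>time_space)
      = (\<integral>\<^sup>+u. \<integral>\<^sup>+\<omega>. ennreal (window t (u, \<omega>) * h (Xv (u, \<omega>) - 1)) \<partial>M \<partial>lborel)"
    by (rule nn_integral_time_space(1)) measurable
  also have "\<dots> \<le> (\<integral>\<^sup>+u. ennreal Cx * indicator {0..t} u \<partial>lborel)"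
  proof (rule nn_integral_mono_AE)
    \<comment> \<open>The moment bound holds at positive times, so time 0 is removed as a null
      set.\<close>
    have "AE u in lborel. u \<noteq> (0::real)" by (rule AE_lborel_singleton)
    then show "AE u in lborel. (\<integral>\<^sup>+\<omega>. ennreal (window t (u, \<omega>) * h (Xv (u, \<omega>) - 1)) \<partial>M) \<le> ennreal Cx * indicator {0..t} u"
    proof eventually_elim
      case (elim u)
      show ?case
      proof (cases "u \<in> {0..t}")
        case True
        then have u: "0 < u" "u \<le> t" using elim by auto
        have "(\<integral>\<^sup>+\<omega>. ennreal (window t (u, \<omega>) * h (Xv (u, \<omega>) - 1)) \<partial>M) = (\<integral>\<^sup>+\<omega>. ennreal (h (X u \<omega> - 1)) \<partial>M)"
          using Xv by (intro nn_integral_cong_AE) (use u in \<open>auto elim!: eventually_mono\<close>)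
        then show ?thesis using Cx[OF u] u by simp
      qed simp
    qed
  qed
  also have "\<dots> < \<infinity>" using t by (simp add: nn_integral_cmult ennreal_mult_less_top)
  finally have "integrable time_space (\<lambda>p. window t p * h (Xv p - 1))"
    using h_nonneg by (intro integrableI_nonneg) auto
  then have Di: "integrable time_space (\<lambda>p. window t p * h (Xv p - 1) + window t p * h (Zv p) + h (m + 2) * window t p)"
    using h_integrable window_integrable(1)[of t] t by simp
  define e where "e n = inverse (real (Suc n)) / 2" for n
  have e: "0 < e n" "e n \<le> 1 / 2" for n by (simp_all add: e_def inverse_le_1_iff)
  have e0: "e \<longlonglongrightarrow> 0"
    unfolding e_def using tendsto_divide[OF LIMSEQ_inverse_real_of_nat tendsto_const, of 2] by simp
  have bound: "norm (window t p * excess (e n) (Zv p))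
      \<le> window t p * h (Xv p - 1) + window t p * h (Zv p) + h (m + 2) * window t p" for n p
    using excess_bounds[of "e n" "Xv p" "Zv p"] e[of n] by (auto simp: indicator_def Xv_def)
  have ei: "integrable time_space (\<lambda>p. window t p * excess (e n) (Zv p))" for n
    by (rule Bochner_Integration.integrable_bound[OF Di])
      (use bound in \<open>auto intro!: AE_I2 intro: order_trans[OF _ abs_ge_self]\<close>)
  have "(\<lambda>n. \<integral>p. window t p * excess (e n) (Zv p) \<partial>time_space) \<longlonglongrightarrow> (\<integral>p. 0 \<partial>time_space)"
  proof (rule integral_dominated_convergence[where w = "\<lambda>p. window t p * h (Xv p - 1) + window t p * h (Zv p) + h (m + 2) * window t p"])
    show "integrable time_space (\<lambda>p. window t p * h (Xv p - 1) + window t p * h (Zv p) + h (m + 2) * window t p)" by (rule Di)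
    have "(\<lambda>n. window t p * excess (e n) (Zv p)) \<longlonglongrightarrow> window t p * 0" for p
      by (intro tendsto_mult tendsto_const excess_tendsto e0)
    then show "AE p in time_space. (\<lambda>n. window t p * excess (e n) (Zv p)) \<longlonglongrightarrow> 0" by simp
    show "AE p in time_space. norm (window t p * excess (e n) (Zv p))
      \<le> window t p * h (Xv p - 1) + window t p * h (Zv p) + h (m + 2) * window t p" for n
      using bound by simp
  qed measurable
  then have a0: "(\<lambda>n. \<integral>p. window t p * excess (e n) (Zv p) \<partial>time_space) \<longlonglongrightarrow> 0" by simp
  let ?r = "\<lambda>n. k * expectation (Y t) + \<nu> * t - (\<integral>p. window t p * excess (e n) (Zv p) \<partial>time_space)
      + f x - expectation (\<lambda>\<omega>. f (Z t \<omega>)) - 4 * e n * A"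
  have "?r \<longlonglongrightarrow> k * expectation (Y t) + \<nu> * t - 0 + f x - expectation (\<lambda>\<omega>. f (Z t \<omega>)) - 4 * 0 * A"
    by (intro tendsto_intros a0 e0)
  then have "(\<lambda>n. ennreal (?r n)) \<longlonglongrightarrow> ennreal (k * expectation (Y t) + \<nu> * t + f x - expectation (\<lambda>\<omega>. f (Z t \<omega>)))"
    by (intro tendsto_ennrealI) simp
  then show ?thesis
    using mollified_cost[OF e ei] by (intro LIMSEQ_le_const2) auto
qed

end

end

text \<open>The signs of \<open>deriv h\<close> give monotonicity on each side of 0, hence
  nonnegativity and the bound by the values at the ends of an interval. Convexity with
  \<open>h 0 = 0\<close> gives \<open>h v * r \<le> h (r * v)\<close> for \<open>r \<ge> 1\<close>,
  hence at least linear growth on both sides.\<close>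

lemma holding_cost_properties:
  fixes h :: "real \<Rightarrow> real"
  assumes conv: "convex_on UNIV h" and h0: "h 0 = 0"
    and diff: "\<forall>z. z \<noteq> 0 \<longrightarrow> h differentiable (at z)"
    and pos: "\<forall>z>0. deriv h z > 0" and neg: "\<forall>z<0. deriv h z < 0"
  shows "continuous_on UNIV h" "\<And>z. h z \<ge> 0" "\<And>y z. 0 \<le> y \<Longrightarrow> y \<le> z \<Longrightarrow> h y \<le> h z"
    "\<And>y z w. y \<le> z \<Longrightarrow> z \<le> w \<Longrightarrow> h z \<le> max (h y) (h w)"
    "\<exists>\<alpha>>0. \<forall>z. h z \<ge> \<alpha> * \<bar>z\<bar> - \<alpha>"
proof -
  show cont: "continuous_on UNIV h" by (rule convex_on_continuous[OF _ conv]) simp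
  have der: "(h has_real_derivative deriv h z) (at z)" if "z \<noteq> 0" for z
    using diff that by (simp add: DERIV_deriv_iff_real_differentiable)
  have inc: "h y < h z" if "0 \<le> y" "y < z" for y z
  proof (rule DERIV_pos_imp_increasing_open[OF that(2)])
    show "\<exists>d. (h has_real_derivative d) (at v) \<and> 0 < d" if "y < v" "v < z" for v
      using der[of v] pos that \<open>0 \<le> y\<close> by (intro exI[of _ "deriv h v"]) auto
  qed (rule continuous_on_subset[OF cont], simp)
  have dec: "h z < h y" if "z \<le> 0" "y < z" for y z
  proof (rule DERIV_neg_imp_decreasing_open[OF that(2)])
    show "\<exists>d. (h has_real_derivative d) (at v) \<and> d < 0" if "y < v" "v < z" for v
      using der[of v] neg that \<open>z \<le> 0\<close> by (intro exI[of _ "deriv h v"]) auto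
  qed (rule continuous_on_subset[OF cont], simp)
  show nonneg: "h z \<ge> 0" for z using inc[of 0 z] dec[of 0 z] h0 by (cases z "0 :: real" rule: linorder_cases) auto
  show mono: "h y \<le> h z" if "0 \<le> y" "y \<le> z" for y z using inc[of y z] that by (cases "y = z") auto
  show "h z \<le> max (h y) (h w)" if "y \<le> z" "z \<le> w" for y z w
  proof (cases "0 \<le> z")
    case True
    then show ?thesis using mono[of z w] that by simp
  next
    case False
    then show ?thesis using dec[of z y] that by (cases "y = z") auto
  qed
  \<comment> \<open>The values at 1 and -1 are the slopes obtained by scaling. Subtracting
    \<open>\<alpha>\<close> makes the bound nonpositive for arguments of modulus below 1, where only
    \<open>h z \<ge> 0\<close> is used.\<close>
  define \<alpha> where "\<alpha> = min (h 1) (h (- 1))"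
  have a: "\<alpha> > 0" using inc[of 0 1] dec[of 0 "- 1"] h0 by (simp add: \<alpha>_def)
  have scale: "h v * r \<le> h (r * v)" if r: "r \<ge> 1" for r v :: real
  proof -
    have "h ((1 - 1 / r) *\<^sub>R 0 + (1 / r) *\<^sub>R (r * v)) \<le> (1 - 1 / r) * h 0 + (1 / r) * h (r * v)"
      using r by (intro convex_onD[OF conv]) auto
    then have "h v \<le> h (r * v) / r" using r h0 by simp
    then show ?thesis using r by (simp add: field_simps)
  qed
  have "h z \<ge> \<alpha> * \<bar>z\<bar> - \<alpha>" for z
  proof -
    consider "z \<ge> 1" | "z \<le> - 1" | "\<bar>z\<bar> < 1" by linarith
    then show ?thesis
    proof cases
      case 1
      then have "\<alpha> * z \<le> h 1 * z" by (intro mult_right_mono) (auto simp: \<alpha>_def)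
      moreover have "h 1 * z \<le> h z" using scale[of z 1] 1 by simp
      moreover have abs: "\<bar>z\<bar> = z" using 1 by simp
      ultimately show ?thesis unfolding abs using a by linarith
    next
      case 2
      then have "\<alpha> * (- z) \<le> h (- 1) * (- z)" by (intro mult_right_mono) (auto simp: \<alpha>_def)
      moreover have "h (- 1) * (- z) \<le> h z" using scale[of "- z" "- 1"] 2 by simp
      moreover have abs: "\<bar>z\<bar> = - z" using 2 by simp
      ultimately show ?thesis unfolding abs using a by linarith
    next
      case 3
      then have "\<alpha> * \<bar>z\<bar> \<le> \<alpha> * 1" using a by (intro mult_left_mono) auto
      then show ?thesis using nonneg[of z] by simp
    qed
  qed
  with a show "\<exists>\<alpha>>0. \<forall>z. h z \<ge> \<alpha> * \<bar>z\<bar> - \<alpha>" by blast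
qed

theorem proposition2:
  fixes M :: "'a measure" and F :: "real \<Rightarrow> 'a measure" and B :: "real \<Rightarrow> 'a \<Rightarrow> real"
    and \<mu> \<sigma> k \<nu> :: real and K h f :: "real \<Rightarrow> real"
  assumes "\<mu> > 0" and "\<sigma> > 0" and "k \<ge> 0"
    and "filtered_prob_space M F" and "brownian_motion M F B"
    and K_measurable: "K \<in> borel_measurable (restrict_space borel {0..})"
    and K_nonneg: "\<forall>\<xi>\<ge>0. K \<xi> \<ge> 0"
    and K_zero: "K 0 = 0"
    and K_bounded: "bounded (K ` {0..})"
    and K_right_limit: "\<exists>L. (K \<longlongrightarrow> L) (at_right 0)"
    and K_right_derivative:
      "(K \<longlongrightarrow> 0) (at_right 0) \<longrightarrow> (\<exists>D. (K has_real_derivative D) (at_right 0))"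
    and h_convex: "convex_on UNIV h"
    and h_zero: "h 0 = 0"
    and h_differentiable: "\<forall>z. z \<noteq> 0 \<longrightarrow> h differentiable (at z)"
    and h_C1: "continuous_on (- {0}) (deriv h)"
    and h_deriv_pos: "\<forall>z>0. deriv h z > 0"
    and h_deriv_neg: "\<forall>z<0. deriv h z < 0"
    and h_growth: "\<exists>a::nat. a > 0 \<and> (\<exists>b0>0. \<exists>b1>0. \<forall>z. h z \<le> b0 + b1 * \<bar>z\<bar> ^ a)"
    and f_differentiable: "\<forall>z. f differentiable (at z)"
    and f_C1: "continuous_on UNIV (deriv f)"
    and f_deriv_AC: "\<forall>a b. absolutely_continuous_on_interval a b (deriv f)"
    and f_K: "\<forall>z1 z2. z1 > z2 \<longrightarrow> f z1 - f z2 \<ge> - K (z1 - z2) - k * (z1 - z2)"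
    and f_growth: "\<exists>d::nat. d > 0 \<and> (\<exists>a0>0. \<exists>a1>0.
        (\<forall>z<0. \<bar>deriv f z\<bar> < a0) \<and> (\<forall>z\<ge>0. \<bar>deriv f z\<bar> < a0 + a1 * z ^ d))"
    and "\<nu> > 0"
    and f_generator: "\<forall>z. deriv f differentiable (at z) \<longrightarrow>
        1/2 * \<sigma>\<^sup>2 * deriv (deriv f) z - \<mu> * deriv f z + h z \<ge> \<nu>"
  shows "\<forall>x Y. admissible_policy M F Y \<longrightarrow> average_cost M \<mu> \<sigma> B h K k x Y \<ge> ennreal \<nu>"
proof (intro allI impI)
  fix x Y assume Y_adm: "admissible_policy M F Y"
  have "prob_space M" using assms(4) by (simp add: filtered_prob_space_def)
  then interpret inventory_model M F B Y \<mu> \<sigma> x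
    using assms(1,2,4,5) Y_adm by (intro inventory_model.intro inventory_model_axioms.intro)
  let ?cost = "\<lambda>t. \<integral>\<^sup>+\<omega>. path_cost h K k (\<lambda>u. inventory \<mu> \<sigma> B x Y u \<omega>) (\<lambda>u. Y u \<omega>) t \<partial>M"
  note hp = holding_cost_properties[OF h_convex h_zero h_differentiable h_deriv_pos h_deriv_neg]
  obtain \<alpha> where \<alpha>: "\<alpha> > 0" "\<And>z. h z \<ge> \<alpha> * \<bar>z\<bar> - \<alpha>" using hp(5) by blast
  have [measurable]: "h \<in> borel_measurable borel" using hp(1) by (rule borel_measurable_continuous_onI)
  obtain a b0 b1 where hg: "b0 > 0" "b1 > 0" "\<And>z. h z \<le> b0 + b1 * \<bar>z\<bar> ^ a" using h_growth by blast
  obtain d a0 a1 where fg: "a1 > 0" "\<And>z. z < 0 \<Longrightarrow> \<bar>deriv f z\<bar> < a0"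
    "\<And>z. z \<ge> 0 \<Longrightarrow> \<bar>deriv f z\<bar> < a0 + a1 * z ^ d" using f_growth by blast
  obtain Kb where Kb: "\<And>\<xi>. \<xi> \<ge> 0 \<Longrightarrow> K \<xi> \<le> Kb"
    using K_bounded unfolding bounded_iff by (auto simp: abs_le_iff)
  show "ennreal \<nu> \<le> average_cost M \<mu> \<sigma> B h K k x Y"
  proof (rule ccontr)
    assume "\<not> ?thesis"
    then have "average_cost M \<mu> \<sigma> B h K k x Y < ennreal \<nu>" by simp
    \<comment> \<open>A value strictly between turns the limit superior into a bound valid for all
      large \<open>t\<close>, still with a gap below \<open>\<nu>\<close>.\<close>
    then obtain q where q: "average_cost M \<mu> \<sigma> B h K k x Y < q" "q < ennreal \<nu>" using dense by blast
    define \<nu>0 where "\<nu>0 = enn2real q"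
    have "q < \<top>" using q(2) by (rule less_le_trans) simp
    then have q_eq: "q = ennreal \<nu>0" by (simp add: \<nu>0_def)
    have \<nu>0: "0 \<le> \<nu>0" "\<nu>0 < \<nu>" 
    proof -
      show "0 \<le> \<nu>0" by (simp add: \<nu>0_def)
      moreover have "ennreal \<nu>0 < ennreal \<nu>" using q(2) by (simp only: q_eq)
      ultimately show "\<nu>0 < \<nu>" by (simp add: ennreal_less_iff)
    qed
    have "\<forall>\<^sub>F t in at_top. ?cost t / ennreal t < q"
      using q(1) unfolding average_cost_def by (rule Limsup_lessD)
    then obtain T1 where T1: "\<And>t. t \<ge> T1 \<Longrightarrow> ?cost t / ennreal t < q"
      by (auto simp: eventually_at_top_linorder)
    define T where "T = max T1 1"
    have cost_le: "?cost t \<le> ennreal (\<nu>0 * t)" if "t \<ge> T" for t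
    proof -
      have t: "t > 0" "t \<ge> T1" using that by (auto simp: T_def)
      have "ennreal t / ennreal t = 1" using t by (intro ennreal_divide_self) auto
      then have "?cost t = ?cost t / ennreal t * ennreal t" by (simp only: ennreal_divide_times mult_1_right)
      also have "\<dots> \<le> ennreal \<nu>0 * ennreal t"
        using T1[OF t(2)] unfolding q_eq by (intro mult_right_mono) auto
      finally show ?thesis using \<nu>0 t by (simp add: ennreal_mult')
    qed
    let ?H = "\<lambda>t. \<integral>\<^sup>+\<omega>. (\<integral>\<^sup>+u\<in>{0..t}. ennreal (h (right_version Z u \<omega>)) \<partial>lborel) \<partial>M"
    have H_le: "?H t \<le> ?cost t" for t
    proof (rule nn_integral_mono_AE)
      show "AE \<omega> in M. (\<integral>\<^sup>+u\<in>{0..t}. ennreal (h (right_version Z u \<omega>)) \<partial>lborel)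
          \<le> path_cost h K k (\<lambda>u. inventory \<mu> \<sigma> B x Y u \<omega>) (\<lambda>u. Y u \<omega>) t"
        using AE_right_version_Z
      proof eventually_elim
        case (elim \<omega>)
        have "(\<integral>\<^sup>+u\<in>{0..t}. ennreal (h (right_version Z u \<omega>)) \<partial>lborel)
            = (\<integral>\<^sup>+u\<in>{0..t}. ennreal (h (inventory \<mu> \<sigma> B x Y u \<omega>)) \<partial>lborel)"
          using elim by (intro nn_integral_cong) (auto simp: inventory_eq_Z indicator_def)
        then show ?case unfolding path_cost_def by (simp add: add_increasing2 add.assoc)
      qed
    qed
    \<comment> \<open>If the mean of \<open>\<bar>Z u\<bar>\<close> exceeded \<open>C1\<close>
      throughout \<open>{s..2 * s}\<close>, integrating
      \<open>\<alpha> * \<bar>z\<bar> \<le> h z + \<alpha>\<close> would give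
      \<open>\<alpha> * C1 * s \<le> 2 * (\<nu>0 + \<alpha>) * s\<close>, which the summand 1
      excludes. It matters that \<open>C1\<close> does not depend on \<open>s\<close>.\<close>
    define C1 where "C1 = 2 * (\<nu>0 + \<alpha>) / \<alpha> + 1"
    have C1: "C1 > 0" using \<nu>0 \<alpha> by (simp add: C1_def add_nonneg_pos)
    have good: "\<exists>u\<in>{s..2 * s}. (\<integral>\<^sup>+\<omega>. ennreal \<bar>Z u \<omega>\<bar> \<partial>M) \<le> ennreal C1" if s: "s \<ge> T" for s
    proof (rule ccontr)
      assume "\<not> ?thesis"
      then have big: "(\<integral>\<^sup>+\<omega>. ennreal \<bar>Z u \<omega>\<bar> \<partial>M) \<ge> ennreal C1" if "u \<in> {s..2 * s}" for u
        using that by (meson linear)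
      have s0: "s > 0" using s by (simp add: T_def)
      have point: "ennreal \<alpha> * (\<integral>\<^sup>+\<omega>. ennreal \<bar>Z u \<omega>\<bar> \<partial>M) \<le> (\<integral>\<^sup>+\<omega>. ennreal (h (Z u \<omega>)) \<partial>M) + ennreal \<alpha>"
        if u: "u \<ge> 0" for u
      proof -
        have [measurable]: "Z u \<in> borel_measurable M" using u by (rule Z_measurable)
        have "ennreal \<alpha> * (\<integral>\<^sup>+\<omega>. ennreal \<bar>Z u \<omega>\<bar> \<partial>M) = (\<integral>\<^sup>+\<omega>. ennreal (\<alpha> * \<bar>Z u \<omega>\<bar>) \<partial>M)"
          using \<alpha> by (subst nn_integral_cmult[symmetric]) (auto simp: ennreal_mult')
        also have "\<dots> \<le> (\<integral>\<^sup>+\<omega>. ennreal (h (Z u \<omega>)) + ennreal \<alpha> \<partial>M)"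
        proof (rule nn_integral_mono)
          fix \<omega>
          have "ennreal (\<alpha> * \<bar>Z u \<omega>\<bar>) \<le> ennreal (h (Z u \<omega>) + \<alpha>)" using \<alpha>(2)[of "Z u \<omega>"] by (intro ennreal_leI) simp
          then show "ennreal (\<alpha> * \<bar>Z u \<omega>\<bar>) \<le> ennreal (h (Z u \<omega>)) + ennreal \<alpha>"
            by (rule order_trans[OF _ ennreal_add_le_add])
        qed
        also have "\<dots> = (\<integral>\<^sup>+\<omega>. ennreal (h (Z u \<omega>)) \<partial>M) + ennreal \<alpha>"
          by (subst nn_integral_add) (auto simp: emeasure_space_1)
        finally show ?thesis .
      qed
      let ?E = "\<lambda>u. \<integral>\<^sup>+\<omega>. ennreal (h (right_version Z u \<omega>)) \<partial>M"
      have E_eq: "?E u = (\<integral>\<^sup>+\<omega>. ennreal (h (Z u \<omega>)) \<partial>M)" if "u \<ge> 0" for u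
        using AE_right_version_Z by (intro nn_integral_cong_AE) (use that in \<open>auto elim!: eventually_mono\<close>)
      have Em: "?E \<in> borel_measurable lborel"
        by (rule borel_measurable_nn_integral) (simp add: case_prod_beta)
      have "ennreal (\<alpha> * C1 * s) = (\<integral>\<^sup>+u. ennreal (\<alpha> * C1) * indicator {s..2 * s} u \<partial>lborel)"
        using \<alpha> C1 s0 by (simp add: nn_integral_cmult ennreal_mult')
      also have "\<dots> \<le> (\<integral>\<^sup>+u. ?E u * indicator {0..2 * s} u + ennreal \<alpha> * indicator {0..2 * s} u \<partial>lborel)"
      proof (rule nn_integral_mono)
        fix u
        show "ennreal (\<alpha> * C1) * indicator {s..2 * s} u \<le> ?E u * indicator {0..2 * s} u + ennreal \<alpha> * indicator {0..2 * s} u"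
        proof (cases "u \<in> {s..2 * s}")
          case True
          then have u: "u \<ge> 0" "u \<le> 2 * s" using s0 by auto
          have "ennreal (\<alpha> * C1) \<le> ennreal \<alpha> * (\<integral>\<^sup>+\<omega>. ennreal \<bar>Z u \<omega>\<bar> \<partial>M)"
            using big[OF True] \<alpha> by (auto simp: ennreal_mult' intro: mult_left_mono)
          also have "\<dots> \<le> ?E u + ennreal \<alpha>" using point[OF u(1)] E_eq[OF u(1)] by simp
          finally show ?thesis using u True by simp
        qed simp
      qed
      also have "\<dots> = (\<integral>\<^sup>+u. ?E u * indicator {0..2 * s} u \<partial>lborel) + ennreal (\<alpha> * (2 * s))"
        using Em \<alpha> s0 by (subst nn_integral_add) (auto simp: nn_integral_cmult ennreal_mult')
      also have "(\<integral>\<^sup>+u. ?E u * indicator {0..2 * s} u \<partial>lborel) = ?H (2 * s)"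
        unfolding nn_integral_Z_Fubini[OF \<open>h \<in> borel_measurable borel\<close>]
        by (intro nn_integral_cong) (auto simp: E_eq indicator_def)
      also have "\<dots> \<le> ennreal (\<nu>0 * (2 * s))"
        using order_trans[OF H_le cost_le[of "2 * s"]] s s0 by simp
      finally have "ennreal (\<alpha> * C1 * s) \<le> ennreal (\<nu>0 * (2 * s)) + ennreal (\<alpha> * (2 * s))"
        by (simp add: add_right_mono)
      also have "\<dots> = ennreal (2 * (\<nu>0 + \<alpha>) * s)"
        using \<nu>0 \<alpha> s0 by (subst ennreal_plus[symmetric]) (auto simp: algebra_simps)
      finally have "\<alpha> * C1 * s \<le> 2 * (\<nu>0 + \<alpha>) * s"
        using \<nu>0 \<alpha> s0 by (subst (asm) ennreal_le_iff) auto
      then have "\<alpha> * C1 \<le> 2 * (\<nu>0 + \<alpha>)" using s0 by simp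
      then show False using \<alpha> by (simp add: C1_def field_simps)
    qed
    \<comment> \<open>Chosen so that the total loss \<open>\<epsilon> * (\<nu> + \<mu>)\<close> is
      at most half the gap between \<open>\<nu>0\<close> and \<open>\<nu>\<close>; the minimum with
      \<open>1 / 2\<close> keeps it below 1.\<close>
    define \<epsilon> where "\<epsilon> = min (1 / 2) ((\<nu> - \<nu>0) / (2 * (\<nu> + \<mu>)))"
    have eps: "0 < \<epsilon>" "\<epsilon> < 1" using \<nu>0 \<open>\<nu> > 0\<close> \<open>\<mu> > 0\<close> by (simp_all add: \<epsilon>_def)
    have "\<epsilon> \<le> (\<nu> - \<nu>0) / (2 * (\<nu> + \<mu>))" by (simp add: \<epsilon>_def)
    then have eps_small: "\<epsilon> * (\<nu> + \<mu>) \<le> (\<nu> - \<nu>0) / 2"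
      using \<open>\<nu> > 0\<close> \<open>\<mu> > 0\<close> by (simp add: field_simps)
    define \<nu>' where "\<nu>' = (1 - \<epsilon>) * \<nu> - \<mu> * (k + \<epsilon>)"
    \<comment> \<open>\<open>\<nu>'\<close> itself may lie far below \<open>\<nu>0\<close>, even
      below zero; the comparison is made after adding \<open>\<mu> * k\<close>, which the mean of
      \<open>k * Y t\<close> will bring back.\<close>
    have gap: "\<nu>' + \<mu> * k - \<nu>0 \<ge> (\<nu> - \<nu>0) / 2"
    proof -
      have "\<nu>' + \<mu> * k = \<nu> - \<epsilon> * (\<nu> + \<mu>)" by (simp add: \<nu>'_def algebra_simps)
      then have "\<nu>' + \<mu> * k - \<nu>0 = (\<nu> - \<nu>0) - \<epsilon> * (\<nu> + \<mu>)" by simp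
      also have "\<dots> \<ge> (\<nu> - \<nu>0) - (\<nu> - \<nu>0) / 2" using eps_small by (rule diff_left_mono)
      also have "(\<nu> - \<nu>0) - (\<nu> - \<nu>0) / 2 = (\<nu> - \<nu>0) / 2" by (simp add: field_simps)
      finally show ?thesis .
    qed
    define s where "s = \<sigma>\<^sup>2 / 2"
    have s: "s > 0" using \<open>\<sigma> > 0\<close> by (simp add: s_def)
    have df: "(f has_real_derivative deriv f z) (at z)" for z
      using f_differentiable by (simp add: DERIV_deriv_iff_real_differentiable)
    have genf: "integral {a..b} (\<lambda>z. \<mu> * deriv f z + \<nu> - h z) \<le> s * (deriv f b - deriv f a)" if ab: "a \<le> b" for a b
    proof -
      let ?g = "\<lambda>z. \<mu> * deriv f z + \<nu> - h z"
      have "integral {a..b} (\<lambda>z. ?g z / s) \<le> deriv f b - deriv f a"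
      proof (rule absolutely_continuous_increment_ge[OF _ ab])
        show "absolutely_continuous_on_interval a b (deriv f)" using f_deriv_AC by blast
        show "continuous_on {a..b} (\<lambda>z. ?g z / s)"
          using s by (intro continuous_intros continuous_on_subset[OF f_C1] continuous_on_subset[OF hp(1)]) auto
        fix z assume "deriv f differentiable (at z)"
        then have "1/2 * \<sigma>\<^sup>2 * deriv (deriv f) z - \<mu> * deriv f z + h z \<ge> \<nu>" using f_generator by blast
        then have "?g z \<le> deriv (deriv f) z * s" by (simp add: s_def algebra_simps)
        then show "?g z / s \<le> deriv (deriv f) z" using s by (simp add: divide_le_eq)
      qed
      then have "integral {a..b} ?g / s \<le> deriv f b - deriv f a" by simp
      then show ?thesis using s by (simp add: divide_le_eq mult.commute)
    qed
    obtain Q where Q: "Q \<ge> 0" "\<And>z. z \<ge> Q \<Longrightarrow> h z > \<nu>"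
    proof (rule that[of "\<nu> / \<alpha> + 2"])
      show "0 \<le> \<nu> / \<alpha> + 2" using \<open>\<nu> > 0\<close> \<alpha> by simp
      fix z assume z: "\<nu> / \<alpha> + 2 \<le> z"
      then have "\<nu> + 2 * \<alpha> \<le> \<alpha> * z" using \<alpha> by (simp add: field_simps)
      moreover have "z > 0" using z \<open>\<nu> > 0\<close> \<alpha> by (smt (verit) divide_pos_pos)
      ultimately show "\<nu> < h z" using \<alpha>(2)[of z] \<alpha>(1) by simp
    qed
    have "\<exists>P P' A m C. (\<forall>z. (P has_real_derivative P' z) (at z)) \<and> continuous_on UNIV P' \<and>
      (\<forall>z. \<bar>P' z\<bar> \<le> A) \<and> m \<ge> 0 \<and> (\<forall>z\<ge>m. P' z = 0) \<and> (\<forall>z. P z \<le> C) \<and>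
      (\<forall>z1 z2. z1 > z2 \<longrightarrow> P z1 - P z2 \<ge> - K (z1 - z2)) \<and>
      (\<forall>a b. a \<le> b \<longrightarrow> integral {a..b} (\<lambda>z. \<mu> * P' z + ((1 - \<epsilon>) * \<nu> - \<mu> * (k + \<epsilon>)) - h z) \<le> s * (P' b - P' a))"
      by (rule truncated_potential[OF s \<open>\<mu> > 0\<close> \<open>k \<ge> 0\<close> eps \<open>\<nu> > 0\<close> df f_C1 hp(1) hp(2) hp(3) Q genf
          K_nonneg[rule_format] Kb f_K[rule_format] less_imp_le[OF fg(2)] less_imp_le[OF fg(3)] fg(1)])
    then obtain P P' A m C where P: "\<forall>z. (P has_real_derivative P' z) (at z)" "continuous_on UNIV P'"
      "\<forall>z. \<bar>P' z\<bar> \<le> A" "m \<ge> 0" "\<forall>z\<ge>m. P' z = 0" "\<forall>z. P z \<le> C"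
      "\<forall>z1 z2. z1 > z2 \<longrightarrow> P z1 - P z2 \<ge> - K (z1 - z2)"
      "\<forall>a b. a \<le> b \<longrightarrow> integral {a..b} (\<lambda>z. \<mu> * P' z + ((1 - \<epsilon>) * \<nu> - \<mu> * (k + \<epsilon>)) - h z) \<le> s * (P' b - P' a)"
      by (elim exE conjE)
    have A0: "A \<ge> 0" using P(3)[rule_format, of 0] by linarith
    \<comment> \<open>\<open>c\<close> must bound \<open>- P' z\<close> and stay at most the slope
      of \<open>K\<close>. If that slope is at least \<open>A\<close>, then \<open>A\<close> serves;
      otherwise the slope is finite and the jump condition itself bounds \<open>- P' z\<close> by
      it.\<close>
    obtain c where c: "c \<ge> 0" "ennreal c \<le> slope_at_zero K" "\<And>z. P' z \<ge> - c"
    proof (cases "ennreal A \<le> slope_at_zero K")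
      case True
      show thesis
        using P(3) A0 by (intro that[OF A0 True]) (auto simp: abs_le_iff minus_le_iff)
    next
      case False
      then have "slope_at_zero K < ennreal A" by simp
      then have "slope_at_zero K < \<top>" by (rule less_le_trans) simp
      then have l: "slope_at_zero K = ennreal (enn2real (slope_at_zero K))" by simp
      have "P' z \<ge> - enn2real (slope_at_zero K)" for z
      proof (rule neg_slope_le_derivative[OF P(1)[rule_format] _ l])
        fix \<xi> :: real assume "\<xi> > 0"
        then show "- K \<xi> \<le> P (z + \<xi>) - P z" using P(7)[rule_format, of z "z + \<xi>"] by simp
      qed simp
      then show thesis using l by (intro that[of "enn2real (slope_at_zero K)"]) auto
    qed
    \<comment> \<open>\<open>D0\<close> collects what does not grow with \<open>t\<close>, and
      \<open>s1\<close> is so large that half the gap times \<open>t\<close> exceeds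
      \<open>\<bar>D0\<bar>\<close> for every \<open>t \<ge> s1\<close>. Only then is a time with
      bounded mean picked from \<open>{s1..2 * s1}\<close>.\<close>
    define D0 where "D0 = k * (- C1 - x) + P x - C"
    define s1 where "s1 = max T (2 * (\<bar>D0\<bar> + 1) / (\<nu> - \<nu>0))"
    obtain t where t: "t \<in> {s1..2 * s1}" "(\<integral>\<^sup>+\<omega>. ennreal \<bar>Z t \<omega>\<bar> \<partial>M) \<le> ennreal C1"
      using good[of s1] by (auto simp: s1_def)
    have tT: "t \<ge> T" "t > 0" using t(1) by (auto simp: s1_def T_def)
    have Zm: "Z t \<in> borel_measurable M" using tT by (intro Z_measurable) auto
    have Zi: "integrable M (Z t)"
      using Zm t(2) by (intro integrableI_bounded) (auto intro: order.strict_trans1)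
    have Yi: "integrable M (Y t)"
    proof -
      have "integrable M (\<lambda>\<omega>. Z t \<omega> - X t \<omega>)" using Zi integrable_X[of t] tT by simp
      then show ?thesis by (simp add: Z_def)
    qed
    have "ennreal (expectation (\<lambda>\<omega>. \<bar>Z t \<omega>\<bar>)) = (\<integral>\<^sup>+\<omega>. ennreal \<bar>Z t \<omega>\<bar> \<partial>M)"
      using Zi by (intro nn_integral_eq_integral[symmetric]) auto
    then have "ennreal (expectation (\<lambda>\<omega>. \<bar>Z t \<omega>\<bar>)) \<le> ennreal C1" using t(2) by (simp only:)
    then have EZ: "expectation (\<lambda>\<omega>. \<bar>Z t \<omega>\<bar>) \<le> C1" unfolding ennreal_le_iff[OF less_imp_le[OF C1]] .
    \<comment> \<open>Since \<open>B t\<close> has mean zero, a bounded mean of \<open>Z t\<close>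
      forces the mean of \<open>Y t\<close> to follow the drift.\<close>
    have "expectation (Z t) = x - \<mu> * t + expectation (Y t)"
      using Yi integrable_B[of t] B_moments(4)[of t] tT by (simp add: Z_def[abs_def] X_def prob_space)
    moreover have "- C1 \<le> expectation (Z t)"
      using EZ integral_abs_bound[of M "Z t"] by linarith
    ultimately have EY: "expectation (Y t) \<ge> - C1 - x + \<mu> * t" by linarith
    \<comment> \<open>The truncation pays off here: the bound \<open>C\<close> is independent of
      \<open>t\<close>, and integrability follows from the first moment and the bounded
      derivative.\<close>
    have "expectation (\<lambda>\<omega>. P (Z t \<omega>)) \<le> C"
    proof (rule integral_le_const)
      show "integrable M (\<lambda>\<omega>. P (Z t \<omega>))"
      proof (rule Bochner_Integration.integrable_bound)
        show "integrable M (\<lambda>\<omega>. \<bar>P 0\<bar> + A * \<bar>Z t \<omega>\<bar>)" using Zi by simp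
        have "continuous_on UNIV P" using P(1) by (meson DERIV_isCont continuous_at_imp_continuous_on)
        then have "P \<in> borel_measurable borel" by (rule borel_measurable_continuous_onI)
        then show "(\<lambda>\<omega>. P (Z t \<omega>)) \<in> borel_measurable M" using Zm by measurable
        have "\<bar>P z - P 0\<bar> \<le> A * \<bar>z - 0\<bar>" for z
          using field_differentiable_bound[of UNIV P P' A z 0] P(1,3) by auto
        then have "\<bar>P z\<bar> \<le> \<bar>P 0\<bar> + A * \<bar>z\<bar>" for z by (smt (verit))
        then show "AE \<omega> in M. norm (P (Z t \<omega>)) \<le> norm (\<bar>P 0\<bar> + A * \<bar>Z t \<omega>\<bar>)"
          using A0 by (intro AE_I2) simp
      qed
      show "AE \<omega> in M. P (Z t \<omega>) \<le> C" using P(6) by simp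
    qed
    moreover have "k * expectation (Y t) \<ge> k * (- C1 - x + \<mu> * t)" using EY \<open>k \<ge> 0\<close> by (intro mult_left_mono)
    ultimately have low: "(\<nu>' + \<mu> * k) * t + D0 \<le> k * expectation (Y t) + \<nu>' * t + P x - expectation (\<lambda>\<omega>. P (Z t \<omega>))"
      by (simp add: D0_def algebra_simps)
    \<comment> \<open>Beyond \<open>max m Q\<close> both requirements on the far region hold:
      \<open>P'\<close> vanishes and \<open>h\<close> exceeds \<open>\<nu>\<close>, hence
      \<open>\<nu>'\<close>.\<close>
    have "ennreal (k * expectation (Y t) + \<nu>' * t + P x - expectation (\<lambda>\<omega>. P (Z t \<omega>))) \<le> ?cost t"
    proof (rule potential_cost[where f' = P' and A = A and m = "max m Q" and c = c and ?b0.0 = b0 and ?b1.0 = b1 and a = a])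
      show "?H t < \<infinity>" using order_trans[OF H_le cost_le[OF tT(1)]] by (auto intro: order.strict_trans1)
      have "\<nu>' \<le> \<nu>" using eps \<open>k \<ge> 0\<close> \<open>\<mu> > 0\<close> \<open>\<nu> > 0\<close> by (simp add: \<nu>'_def algebra_simps)
      then show "\<nu>' \<le> h z" if "max m Q \<le> z" for z using Q(2)[of z] that by simp
      show "integral {a..b} (\<lambda>z. \<mu> * P' z + \<nu>' - h z) \<le> \<sigma>\<^sup>2 / 2 * (P' b - P' a)" if "a \<le> b" for a b
        using P(8) that unfolding \<nu>'_def s_def by blast
    qed (use tT Yi c \<open>k \<ge> 0\<close> P hp hg K_zero K_nonneg in auto)
    also have "\<dots> \<le> ennreal (\<nu>0 * t)" by (rule cost_le[OF tT(1)])
    finally have "k * expectation (Y t) + \<nu>' * t + P x - expectation (\<lambda>\<omega>. P (Z t \<omega>)) \<le> \<nu>0 * t"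
      using \<nu>0 tT by (subst (asm) ennreal_le_iff) simp_all
    with low have "(\<nu>' + \<mu> * k - \<nu>0) * t + D0 \<le> 0" by (simp add: algebra_simps)
    moreover have "(\<nu> - \<nu>0) / 2 * t \<le> (\<nu>' + \<mu> * k - \<nu>0) * t" using gap tT by (intro mult_right_mono) auto
    moreover have "\<bar>D0\<bar> + 1 \<le> (\<nu> - \<nu>0) / 2 * t"
    proof -
      have "2 * (\<bar>D0\<bar> + 1) / (\<nu> - \<nu>0) \<le> t" using t(1) by (simp add: s1_def)
      then show ?thesis using \<nu>0 by (simp add: field_simps)
    qed
    ultimately show False by linarith
  qed
qed

end
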